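(* Let $S$ and $T$ be two trivalent quasiconformal trees that are uniformly branching. Then $S$ and $T$ are quasisymmetrically equivalent.
   Context: Distances are written $|x-y|$. Quasisymmetry: a homeomorphism $F\colon (S,d)\to(T,\rho)$ between metric spaces is a quasisymmetry if there exists a homeomorphism $\eta\colon[0,\infty)\to[0,\infty)$ such that for all $t>0$ and all $x,y,z\in S$, $d(x,y)\le t\,d(x,z)$ implies $\rho(F(x),F(y))\le \eta(t)\,\rho(F(x),F(z))$. Two metric spaces are quasisymmetrically equivalent if there is a quasisymmetry from one onto the other. Trees: a (metric) tree is a compact, connected, locally connected metric space $T$ with at least two points such that for all $x,y\in T$ there is a unique (possibly degenerate) arc $[x,y]$ in $T$ with endpoints $x$ and $y$. For $p\in T$, a branch of $p$ in $T$ is the closure $\overline U=U\cup\{p\}$ of a connected component $U$ of $T\setminus\{p\}$; there are at most countably many, and only finitely many have diameter exceeding a given positive number. A branch point is a point with at least three branches. $T$ is trivalent if every branch point has exactly three branches. $T$ is a quasiconformal tree if it is doubling (there is $N\in\mathbb N$ such that every ball of radius $r>0$ can be covered by $N$ or fewer balls of radius $r/2$) and of bounded turning (there is $K\ge1$ with $\operatorname{diam}[x,y]\le K|x-y|$ for all $x,y\in T$). Height: for a branch point $p$ of $T$ label its branches $B_1,B_2,B_3,\dots$ so that $\operatorname{diam}(B_1)\ge \operatorname{diam}(B_2)\ge \operatorname{diam}(B_3)\ge\dots$; the height is $H_T(p)=\operatorname{diam}(B_3)$. Uniform branching: $T$ has uniformly relatively separated branch points if there is a constant $C>0$ with $|p-q|\ge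 \frac1C\min\{H_T(p),H_T(q)\}$ for all distinct branch points $p,q\in T$. $T$ has uniformly relatively dense branch points if there is a constant $C>0$ such that for all $x,y\in T$, $x\neq y$, there is a branch point $p\in[x,y]$ of $T$ with $H_T(p)\ge\frac1C|x-y|$. $T$ is uniformly branching if it has both properties. *)

theory Defs
  imports "HOL-Analysis.Analysis"
begin

text \<open>
  A metric space is a subset of a type of class \<open>metric_space\<close> with the restricted metric.
  All notions below are intrinsic to the subset: points, centres of balls and arcs are taken
  inside it.
\<close>

section \<open>Quasisymmetries\<close>

definition quasisymmetry ::
  "'a::metric_space set \<Rightarrow> 'b::metric_space set \<Rightarrow> ('a \<Rightarrow> 'b) \<Rightarrow> bool" where
  "quasisymmetry S T F \<longleftrightarrow>
     (\<exists>G. homeomorphism S T F G) \<and>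
     (\<exists>\<eta> \<theta> :: real \<Rightarrow> real. homeomorphism {0..} {0..} \<eta> \<theta> \<and>
        (\<forall>t>0. \<forall>x\<in>S. \<forall>y\<in>S. \<forall>z\<in>S.
           dist x y \<le> t * dist x z \<longrightarrow> dist (F x) (F y) \<le> \<eta> t * dist (F x) (F z)))"

definition quasisymmetrically_equivalent ::
  "'a::metric_space set \<Rightarrow> 'b::metric_space set \<Rightarrow> bool" where
  "quasisymmetrically_equivalent S T \<longleftrightarrow> (\<exists>F. quasisymmetry S T F)"

section \<open>Metric trees\<close>

text \<open>
  The library predicate \<open>arc\<close> describes injective paths, so the degenerate arc has
  to be added.
\<close>

definition arc_between :: "'a::metric_space set \<Rightarrow> 'a \<Rightarrow> 'a \<Rightarrow> 'a set \<Rightarrow> bool" where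
  "arc_between T x y A \<longleftrightarrow> A \<subseteq> T \<and>
     (x = y \<and> A = {x} \<or>
      (\<exists>g. arc g \<and> path_image g = A \<and> pathstart g = x \<and> pathfinish g = y))"

definition metric_tree :: "'a::metric_space set \<Rightarrow> bool" where
  "metric_tree T \<longleftrightarrow>
     compact T \<and> connected T \<and> locally connected T \<and>
     (\<exists>x\<in>T. \<exists>y\<in>T. x \<noteq> y) \<and>
     (\<forall>x\<in>T. \<forall>y\<in>T. \<exists>!A. arc_between T x y A)"

text \<open>The arc \<open>[x, y]\<close>; meaningful for points of a tree.\<close>

definition tree_arc :: "'a::metric_space set \<Rightarrow> 'a \<Rightarrow> 'a \<Rightarrow> 'a set" where
  "tree_arc T x y = (THE A. arc_between T x y A)"

text \<open>
  The closure is taken in the ambient type; it agrees with the closure in \<open>T\<close> since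
  trees are compact.
\<close>

definition branches :: "'a::metric_space set \<Rightarrow> 'a \<Rightarrow> 'a set set" where
  "branches T p = closure ` components (T - {p})"

definition branch_point :: "'a::metric_space set \<Rightarrow> 'a \<Rightarrow> bool" where
  "branch_point T p \<longleftrightarrow> p \<in> T \<and> (\<exists>\<B> \<subseteq> branches T p. card \<B> = 3)"

definition trivalent :: "'a::metric_space set \<Rightarrow> bool" where
  "trivalent T \<longleftrightarrow> (\<forall>p. branch_point T p \<longrightarrow> card (branches T p) = 3)"

definition doubling :: "'a::metric_space set \<Rightarrow> bool" where
  "doubling T \<longleftrightarrow>
     (\<exists>N::nat. \<forall>x\<in>T. \<forall>r>0. \<exists>C\<subseteq>T. finite C \<and> card C \<le> N \<and>
        T \<inter> ball x r \<subseteq> (\<Union>c\<in>C. ball c (r / 2)))"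

definition bounded_turning :: "'a::metric_space set \<Rightarrow> bool" where
  "bounded_turning T \<longleftrightarrow>
     (\<exists>K\<ge>1. \<forall>x\<in>T. \<forall>y\<in>T. diameter (tree_arc T x y) \<le> K * dist x y)"

definition quasiconformal_tree :: "'a::metric_space set \<Rightarrow> bool" where
  "quasiconformal_tree T \<longleftrightarrow> metric_tree T \<and> doubling T \<and> bounded_turning T"

section \<open>Height and uniform branching\<close>

text \<open>
  \<open>B\<close> labels the branches of \<open>p\<close> without repetition as
  \<open>B 1, B 2, B 3, \<dots>\<close> in order of non-increasing diameter. The index set \<open>I\<close> is
  an initial segment of the positive integers, finite or infinite.
\<close>

definition branch_labelling ::
  "'a::metric_space set \<Rightarrow> 'a \<Rightarrow> nat set \<Rightarrow> (nat \<Rightarrow> 'a set) \<Rightarrow> bool" where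
  "branch_labelling T p I B \<longleftrightarrow>
     (I = {1..} \<or> (\<exists>n. I = {1..n})) \<and>
     bij_betw B I (branches T p) \<and>
     (\<forall>i\<in>I. \<forall>j\<in>I. i \<le> j \<longrightarrow> diameter (B j) \<le> diameter (B i))"

text \<open>
  Labellings may differ by permuting branches of equal diameter, but the third largest
  diameter does not depend on the choice. Meaningful only for branch points.
\<close>

definition height :: "'a::metric_space set \<Rightarrow> 'a \<Rightarrow> real" where
  "height T p = (THE h. \<exists>I B. branch_labelling T p I B \<and> h = diameter (B 3))"

definition uniformly_relatively_separated_branch_points :: "'a::metric_space set \<Rightarrow> bool" where
  "uniformly_relatively_separated_branch_points T \<longleftrightarrow>
     (\<exists>C>0. \<forall>p q. branch_point T p \<and> branch_point T q \<and> p \<noteq> q \<longrightarrow>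
        dist p q \<ge> 1 / C * min (height T p) (height T q))"

definition uniformly_relatively_dense_branch_points :: "'a::metric_space set \<Rightarrow> bool" where
  "uniformly_relatively_dense_branch_points T \<longleftrightarrow>
     (\<exists>C>0. \<forall>x\<in>T. \<forall>y\<in>T. x \<noteq> y \<longrightarrow>
        (\<exists>p\<in>tree_arc T x y. branch_point T p \<and> height T p \<ge> 1 / C * dist x y))"

definition uniformly_branching :: "'a::metric_space set \<Rightarrow> bool" where
  "uniformly_branching T \<longleftrightarrow>
     uniformly_relatively_separated_branch_points T \<and>
     uniformly_relatively_dense_branch_points T"

end

theory Submission
  imports Defs
begin

text \<open>
  Both trees are cut up repeatedly according to one and the same combinatorial pattern, and the
  homeomorphism matches tiles with equal addresses. A tile is the whole tree, a branch of a branch point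
  (leaf tile), or the part \<open>E a b\<close> of the tree between two branch points (edge tile). A leaf tile is cut at
  one branch point into an edge tile and two leaf tiles; an edge tile is cut at \<open>m\<close> points of \<open>[a, b]\<close>.
  Cutting \<open>[a, b]\<close> where the height is largest gives pieces of size comparable to \<open>|a - b|\<close> that
  satisfy the same bounds again, so the constants do not deteriorate.

  Neighbouring tiles of one generation have to stay comparable in size. Hence in every step the tiles at an
  old vertex shrink by a fixed factor \<open>\<theta>\<close>: cut repeatedly towards each end until the target length
  is reached, which by doubling takes boundedly many cuts, and then cut the middle further until exactly \<open>m\<close>
  points are used. Every sufficiently large \<open>m\<close> works, so one \<open>m\<close> serves both trees. Tiles then
  shrink geometrically, disjoint tiles of one generation are relatively separated by bounded turning, and
  matching two such tilings is a quasisymmetry.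
\<close>

section \<open>Quasisymmetries from matched tilings\<close>

text \<open>A common pattern is possible because trivalence leaves exactly one branch off [a, b] at
  each inner cut point. A word over a finite alphabet then names a tile in either tree, and which
  tiles of a generation meet is read off from the names of vertices alone. All metric information
  sits in constants, so the larger constants of the two trees serve both.

  The obstacle is that separation bounds only the smaller of two heights: a branch off an arc could
  be huge compared with the arc. An arc passes this on because it is cut at a highest point, a
  branch because it is cut at a point whose height is comparable to its diameter.

  Shrinking of tiles rests on doubling once more. Every tile of a nested chain contributes a new
  branch point whose height is comparable to the size of the tile. A long chain without loss of
  diameter would crowd too many high branch points into one small set.\<close>

locale tiling =
  fixes W :: "nat list set" and X :: "nat list \<Rightarrow> 'a::metric_space set" and S :: "'a set"
    and A \<rho> :: real
  assumes compact: "compact S" and A: "A > 1" and \<rho>: "0 < \<rho>" "\<rho> < 1"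
    and Nil_mem: "[] \<in> W" and tl_mem: "i # w \<in> W \<Longrightarrow> w \<in> W"
    and root: "X [] = S"
    and cover: "w \<in> W \<Longrightarrow> X w = (\<Union>i\<in>{i. i # w \<in> W}. X (i # w))"
    and closed: "w \<in> W \<Longrightarrow> closed (X w)"
    and diam_pos: "w \<in> W \<Longrightarrow> diameter (X w) > 0"
    and adjacent: "\<lbrakk>u \<in> W; w \<in> W; length u = length w; X u \<inter> X w \<noteq> {}\<rbrakk>
      \<Longrightarrow> diameter (X u) \<le> A * diameter (X w)"
    and separated: "\<lbrakk>u \<in> W; w \<in> W; length u = length w; X u \<inter> X w = {}; x \<in> X u; y \<in> X w\<rbrakk>
      \<Longrightarrow> diameter (X u) \<le> A * dist x y"
    and child: "i # w \<in> W \<Longrightarrow> diameter (X w) \<le> A * diameter (X (i # w))"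
    and decay: "v @ w \<in> W \<Longrightarrow> diameter (X (v @ w)) \<le> A * \<rho> ^ length v * diameter (X w)"
begin

lemma nonempty: "w \<in> W \<Longrightarrow> X w \<noteq> {}"
  using diam_pos[of w] by (auto simp: diameter_def)

lemma child_subset: "i # w \<in> W \<Longrightarrow> X (i # w) \<subseteq> X w"
  using cover[OF tl_mem] by blast

text \<open>Addresses grow at the head: \<open>i # w\<close> is a child of \<open>w\<close>, and
  \<open>v @ w\<close> is a descendant of \<open>w\<close> that is \<open>length v\<close>
  generations younger.\<close>

lemma append_mem: "v @ w \<in> W \<Longrightarrow> w \<in> W"
  by (induction v) (auto dest: tl_mem)

lemma append_subset: "v @ w \<in> W \<Longrightarrow> X (v @ w) \<subseteq> X w"
proof (induction v)
  case (Cons i v)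
  then have "v @ w \<in> W" using tl_mem by simp
  with Cons.IH child_subset[of i "v @ w"] Cons.prems show ?case by auto
qed auto

lemma subset_S: "w \<in> W \<Longrightarrow> X w \<subseteq> S"
  using append_subset[of w "[]"] root by simp

lemma bdd: "w \<in> W \<Longrightarrow> bounded (X w)"
  by (rule bounded_subset[OF compact_imp_bounded[OF compact] subset_S])

lemma dist_le_diam: "\<lbrakk>w \<in> W; x \<in> X w; y \<in> X w\<rbrakk> \<Longrightarrow> dist x y \<le> diameter (X w)"
  by (rule diameter_bounded_bound[OF bdd])

text \<open>Iterates \<open>child\<close>. Together with \<open>decay\<close> it turns the number of
  generations between nested tiles into an exponent in the ratio of their diameters, which is what
  the quasisymmetric estimate uses.\<close>

lemma deeper: "v @ w \<in> W \<Longrightarrow> diameter (X w) \<le> A ^ length v * diameter (X (v @ w))"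
proof (induction v)
  case (Cons i v)
  have "diameter (X w) \<le> A ^ length v * diameter (X (v @ w))"
    using Cons tl_mem by auto
  also have "\<dots> \<le> A ^ length v * (A * diameter (X (i # v @ w)))"
    using child[of i "v @ w"] Cons.prems A by (intro mult_left_mono) auto
  finally show ?case by (simp add: mult_ac)
qed auto

text \<open>A point may lie in several tiles of one generation; dependent choice follows one
  descending chain of them, starting from any prescribed tile around \<open>x\<close>.\<close>

lemma address:
  assumes "w \<in> W" "x \<in> X w"
  obtains \<alpha> where "\<And>n. \<alpha> n \<in> W" "\<And>n. x \<in> X (\<alpha> n)" "\<And>n. length (\<alpha> n) = length w + n"
    "\<And>n. \<exists>v. length v = n \<and> \<alpha> n = v @ w"
    "\<And>n. \<exists>i. \<alpha> (Suc n) = i # \<alpha> n"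
proof -
  have "\<exists>\<alpha>. \<forall>n. (\<alpha> n \<in> W \<and> x \<in> X (\<alpha> n) \<and> (\<exists>v. length v = n \<and> \<alpha> n = v @ w)) \<and>
      (\<exists>i. \<alpha> (Suc n) = i # \<alpha> n)"
  proof (rule dependent_nat_choice)
    show "\<exists>u. u \<in> W \<and> x \<in> X u \<and> (\<exists>v. length v = 0 \<and> u = v @ w)"
      using assms by auto
  next
    fix u n assume u: "u \<in> W \<and> x \<in> X u \<and> (\<exists>v. length v = n \<and> u = v @ w)"
    then obtain i where "i # u \<in> W" "x \<in> X (i # u)" using cover by blast
    then show "\<exists>y. (y \<in> W \<and> x \<in> X y \<and> (\<exists>v. length v = Suc n \<and> y = v @ w)) \<and> (\<exists>i. y = i # u)"
      using u by (metis append_Cons length_Cons)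
  qed
  then obtain \<alpha> where \<alpha>: "\<And>n. \<alpha> n \<in> W" "\<And>n. x \<in> X (\<alpha> n)"
      "\<And>n. \<exists>v. length v = n \<and> \<alpha> n = v @ w" "\<And>n. \<exists>i. \<alpha> (Suc n) = i # \<alpha> n"
    by auto
  show thesis
  proof (rule that[of \<alpha>])
    fix n
    show "length (\<alpha> n) = length w + n" using \<alpha>(3)[of n] by auto
  qed (use \<alpha> in auto)
qed

lemma small: assumes "e > 0" obtains n where "\<And>w. \<lbrakk>w \<in> W; length w \<ge> n\<rbrakk> \<Longrightarrow> diameter (X w) < e"
proof -
  let ?d = "diameter (X [])"
  have d: "?d > 0" using diam_pos Nil_mem by auto
  obtain n where n: "\<rho> ^ n < e / (A * ?d)"
    using real_arch_pow_inv[of "e / (A * ?d)" \<rho>] assms A d \<rho> by auto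
  show thesis
  proof (rule that)
    fix w assume w: "w \<in> W" "length w \<ge> n"
    have "diameter (X w) \<le> A * \<rho> ^ length w * ?d" using decay[of w "[]"] w by simp
    also have "\<dots> \<le> A * \<rho> ^ n * ?d"
      using w \<rho> A d by (intro mult_right_mono mult_left_mono power_decreasing) auto
    also have "\<dots> < e" using n A d by (simp add: field_simps)
    finally show "diameter (X w) < e" .
  qed
qed

text \<open>Tiles of high generation are small, so a point is determined by the tiles that contain
  it.\<close>

lemma common_tiles_imp_eq:
  assumes "x \<in> S" "\<And>w. \<lbrakk>w \<in> W; x \<in> X w\<rbrakk> \<Longrightarrow> x' \<in> X w"
  shows "x' = x"
proof (rule ccontr)
  assume "x' \<noteq> x"
  then obtain n where n: "\<And>w. \<lbrakk>w \<in> W; length w \<ge> n\<rbrakk> \<Longrightarrow> diameter (X w) < dist x x'"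
    using small[of "dist x x'"] by auto
  obtain \<alpha> where \<alpha>: "\<And>n. \<alpha> n \<in> W" "\<And>n. x \<in> X (\<alpha> n)" "\<And>n. length (\<alpha> n) = 0 + n"
    using address[of "[]" x] assms(1) Nil_mem root by (metis list.size(3))
  have "dist x x' \<le> diameter (X (\<alpha> n))" using assms(2) \<alpha> by (intro dist_le_diam) auto
  with n[of "\<alpha> n"] \<alpha> show False by force
qed

end

text \<open>Apart from shared addresses and constants, the two spaces are linked only by which tiles
  of a generation meet. The assumption is symmetric, so whatever is proved for one direction holds
  for the other.\<close>

locale tiling_pair = X: tiling W X S A \<rho> + Y: tiling W Y T A \<rho>
  for W and X :: "nat list \<Rightarrow> 'a::metric_space set" and S
    and Y :: "nat list \<Rightarrow> 'b::metric_space set" and T A \<rho> +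
  assumes incidence: "\<lbrakk>u \<in> W; w \<in> W; length u = length w\<rbrakk>
    \<Longrightarrow> X u \<inter> X w = {} \<longleftrightarrow> Y u \<inter> Y w = {}"
begin

lemma swap: "tiling_pair W Y T X S A \<rho>"
  by unfold_locales (use incidence in auto)

text \<open>Compactness gives a point \<open>y\<close> in all tiles along one address of
  \<open>x\<close>. For another tile \<open>X w\<close> around \<open>x\<close>, descendants of both
  kinds are compared in the same generation: they meet at \<open>x\<close>, so their counterparts in
  \<open>T\<close> meet as well, and these shrink to points while \<open>Y w\<close> is
  closed.\<close>

lemma corresponding_point:
  assumes x: "x \<in> S"
  shows "\<exists>y\<in>T. \<forall>w\<in>W. x \<in> X w \<longrightarrow> y \<in> Y w"
proof -
  obtain \<alpha> where \<alpha>: "\<And>n. \<alpha> n \<in> W" "\<And>n. x \<in> X (\<alpha> n)" "\<And>n. length (\<alpha> n) = 0 + n"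
      and ext: "\<And>n. \<exists>i. \<alpha> (Suc n) = i # \<alpha> n"
    using X.address[of "[]" x] x X.Nil_mem X.root by (metis list.size(3))
  have suc: "Y (\<alpha> (Suc n)) \<subseteq> Y (\<alpha> n)" for n using ext[of n] \<alpha>(1) Y.child_subset by metis
  have "\<exists>y. \<forall>n. y \<in> Y (\<alpha> n)"
  proof -
    have cl: "compact (Y (\<alpha> n))" for n
      using Y.closed[OF \<alpha>(1)] Y.compact Y.subset_S[OF \<alpha>(1)] by (metis compact_Int_closed inf.absorb2)
    have anti: "Y (\<alpha> n) \<subseteq> Y (\<alpha> m)" if "m \<le> n" for m n
      using lift_Suc_antimono_le[of "\<lambda>n. Y (\<alpha> n)", OF suc that] .
    have "Y (\<alpha> 0) \<inter> (\<Inter>n\<in>UNIV. Y (\<alpha> n)) \<noteq> {}"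
    proof (rule compact_imp_fip_image)
      fix I :: "nat set" assume "finite I"
      then have "Y (\<alpha> (Max (insert 0 I))) \<subseteq> Y (\<alpha> 0) \<inter> (\<Inter>n\<in>I. Y (\<alpha> n))"
        using anti by (simp add: le_INF_iff)
      then show "Y (\<alpha> 0) \<inter> (\<Inter>n\<in>I. Y (\<alpha> n)) \<noteq> {}" using Y.nonempty[OF \<alpha>(1)] by blast
    qed (use cl \<alpha> Y.closed in auto)
    then show ?thesis by auto
  qed
  then obtain y where y: "\<And>n. y \<in> Y (\<alpha> n)" by blast
  show ?thesis
  proof (intro bexI[of _ y] ballI impI)
    show "y \<in> T" using y Y.subset_S \<alpha> by blast
    fix w assume w: "w \<in> W" "x \<in> X w"
    obtain \<beta> where \<beta>: "\<And>n. \<beta> n \<in> W" "\<And>n. x \<in> X (\<beta> n)" "\<And>n. length (\<beta> n) = length w + n"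
        and bv: "\<And>n. \<exists>v. length v = n \<and> \<beta> n = v @ w"
      using X.address[OF w] by metis
    have sub: "Y (\<beta> n) \<subseteq> Y w" for n using bv[of n] \<beta>(1)[of n] Y.append_subset by metis
    show "y \<in> Y w"
    proof (rule ccontr)
      assume "y \<notin> Y w"
      then obtain e where e: "e > 0" "\<And>z. z \<in> Y w \<Longrightarrow> dist y z \<ge> e"
        using Y.closed[OF w(1)] open_contains_ball[of "- Y w"]
        by (metis ComplI ComplD in_mono mem_ball not_le open_Compl)
      obtain n where n: "\<And>w. \<lbrakk>w \<in> W; length w \<ge> n\<rbrakk> \<Longrightarrow> diameter (Y w) < e"
        using Y.small[OF e(1)] by blast
      have "X (\<alpha> (length w + n)) \<inter> X (\<beta> n) \<noteq> {}" using \<alpha> \<beta> by blast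
      then have "Y (\<alpha> (length w + n)) \<inter> Y (\<beta> n) \<noteq> {}" using incidence[of "\<alpha> (length w + n)" "\<beta> n"] \<alpha> \<beta> by simp
      then obtain z where z: "z \<in> Y (\<alpha> (length w + n))" "z \<in> Y (\<beta> n)" by blast
      have "dist y z \<le> diameter (Y (\<alpha> (length w + n)))" using y z \<alpha> by (intro Y.dist_le_diam) auto
      also have "\<dots> < e" using n \<alpha> by auto
      finally show False using e(2)[of z] z sub by force
    qed
  qed
qed

definition corr :: "'a \<Rightarrow> 'b" where
  "corr x = (SOME y. y \<in> T \<and> (\<forall>w\<in>W. x \<in> X w \<longrightarrow> y \<in> Y w))"

lemma corr: assumes "x \<in> S" shows "corr x \<in> T" "\<And>w. \<lbrakk>w \<in> W; x \<in> X w\<rbrakk> \<Longrightarrow> corr x \<in> Y w"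
  using someI_ex[OF corresponding_point[OF assms, unfolded Bex_def]] unfolding corr_def by auto

text \<open>Going to \<open>T\<close> and back ends in every tile that contains \<open>x\<close>,
  and such a point can only be \<open>x\<close>.\<close>

lemma corr_inverse:
  assumes x: "x \<in> S" shows "tiling_pair.corr W Y X S (corr x) = x"
proof -
  interpret sw: tiling_pair W Y T X S A \<rho> by (rule swap)
  show ?thesis
    using x corr[OF x] sw.corr[of "corr x"] by (intro X.common_tiles_imp_eq) auto
qed

text \<open>Take the last generation in which \<open>x\<close> and \<open>y\<close> lie in equal or
  intersecting tiles. The intersection bounds the distance from above through
  \<open>adjacent\<close>; one generation later the tiles are disjoint and \<open>separated\<close>
  bounds it from below. Both conditions are incidences, so the same \<open>u\<close> measures the
  distance of the images.\<close>

lemma scale: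
  assumes x: "x \<in> S" and y: "y \<in> S" and "x \<noteq> y"
  obtains u where "u \<in> W" "x \<in> X u"
    "diameter (X u) \<le> A\<^sup>2 * dist x y" "dist x y \<le> 2 * A * diameter (X u)"
    "diameter (Y u) \<le> A\<^sup>2 * dist (corr x) (corr y)"
    "dist (corr x) (corr y) \<le> 2 * A * diameter (Y u)"
proof -
  define near where "near n \<longleftrightarrow> (\<exists>u\<in>W. \<exists>w\<in>W. length u = n \<and> length w = n \<and>
    x \<in> X u \<and> y \<in> X w \<and> X u \<inter> X w \<noteq> {})" for n
  have 0: "near 0" unfolding near_def using X.Nil_mem X.root x y by auto
  obtain N where N: "\<And>w. \<lbrakk>w \<in> W; length w \<ge> N\<rbrakk> \<Longrightarrow> diameter (X w) < dist x y / 2"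
    using X.small[of "dist x y / 2"] assms by auto
  have far: "n < N" if nn: "near n" for n
  proof (rule ccontr)
    assume "\<not> n < N"
    moreover obtain u w z where uw: "u \<in> W" "w \<in> W" "length u = n" "length w = n"
        "x \<in> X u" "y \<in> X w" "z \<in> X u" "z \<in> X w"
      using nn unfolding near_def by blast
    ultimately have "diameter (X u) < dist x y / 2" "diameter (X w) < dist x y / 2" using N by auto
    moreover have "dist x z \<le> diameter (X u)" "dist y z \<le> diameter (X w)"
      using uw X.dist_le_diam by auto
    ultimately show False using dist_triangle2[of x y z] by linarith
  qed
  define n where "n = (GREATEST n. near n)"
  have n: "near n" unfolding n_def using GreatestI_nat[of near 0 N] 0 far by fastforce
  have n': "\<not> near (Suc n)" using Greatest_le_nat[of near "Suc n" N] far n_def by fastforce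
  obtain u w where uw: "u \<in> W" "w \<in> W" "length u = n" "length w = n" "x \<in> X u" "y \<in> X w"
      "X u \<inter> X w \<noteq> {}"
    using n unfolding near_def by blast
  obtain i where i: "i # u \<in> W" "x \<in> X (i # u)" using X.cover[OF uw(1)] uw by blast
  obtain j where j: "j # w \<in> W" "y \<in> X (j # w)" using X.cover[OF uw(2)] uw by blast
  have dj: "X (i # u) \<inter> X (j # w) = {}" using n' uw i j unfolding near_def by fastforce
  have pw: "0 < A" "A\<^sup>2 = A * A" using X.A by (auto simp: power2_eq_square)
  \<comment> \<open>Stated for an arbitrary metric space, since it is applied in \<open>S\<close>
    and in \<open>T\<close>.\<close>
  have up: "dist a b \<le> 2 * A * du" 
    if "a \<in> Zu" "c \<in> Zu" "c \<in> Zw" "b \<in> Zw" "bounded Zu" "bounded Zw" "diameter Zw \<le> A * diameter Zu"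
      "du = diameter Zu" for a b c :: "'c::metric_space" and Zu Zw du
  proof -
    have 1: "dist a c \<le> diameter Zu" "dist c b \<le> diameter Zw"
      using that diameter_bounded_bound by blast+
    then have "dist a b \<le> diameter Zu + A * diameter Zu"
      using dist_triangle[of a b c] that by linarith
    moreover have "1 * diameter Zu \<le> A * diameter Zu"
      using 1(1) zero_le_dist[of a c] X.A by (intro mult_right_mono) linarith+
    moreover have "2 * A * du = A * diameter Zu + A * diameter Zu" using that by simp
    ultimately show ?thesis by linarith
  qed
  have low: "d0 \<le> A\<^sup>2 * dd" if "d0 \<le> A * d1" "d1 \<le> A * dd" for d0 d1 dd
    using order_trans[OF that(1) mult_left_mono[OF that(2), of A]] pw by (simp add: mult_ac)
  have Yint: "Y u \<inter> Y w \<noteq> {}" and Ydj: "Y (i # u) \<inter> Y (j # w) = {}"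
    using incidence uw dj i j by auto
  note mm = corr(2)[OF x uw(1,5)] corr(2)[OF y uw(2,6)] corr(2)[OF x i] corr(2)[OF y j]
  show thesis
  proof (rule that[of u])
    show "diameter (X u) \<le> A\<^sup>2 * dist x y"
      using low X.child[OF i(1)] X.separated[OF i(1) j(1) _ dj i(2) j(2)] uw by simp
    show "diameter (Y u) \<le> A\<^sup>2 * dist (corr x) (corr y)"
      using low Y.child[OF i(1)] Y.separated[OF i(1) j(1) _ Ydj mm(3,4)] uw by simp
    obtain z where "z \<in> X u" "z \<in> X w" using uw by blast
    then show "dist x y \<le> 2 * A * diameter (X u)"
      using up[of x "X u" z "X w" y] uw X.bdd X.adjacent[of w u] by auto
    obtain z' where "z' \<in> Y u" "z' \<in> Y w" using Yint by blast
    then show "dist (corr x) (corr y) \<le> 2 * A * diameter (Y u)"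
      using up[of "corr x" "Y u" z' "Y w" "corr y"] uw mm Y.bdd Y.adjacent[of w u] by auto
  qed (use uw in auto)
qed

text \<open>\<open>\<beta>\<close> is chosen so that \<open>\<rho> = A powr (- \<beta>)\<close>. Let
  \<open>u\<close> and \<open>v\<close> be the tiles of \<open>scale\<close> for \<open>x, y\<close>
  and for \<open>x, z\<close>, and \<open>k\<close> the difference of their generations. If
  \<open>v\<close> is not younger than \<open>u\<close>, comparison in \<open>S\<close> gives
  \<open>A ^ k \<ge> 1 / s\<close>, so the decay \<open>\<rho> ^ k\<close> in \<open>T\<close> is at
  most \<open>s powr \<beta>\<close>. Otherwise it gives \<open>\<rho> ^ k \<ge> 1 / s\<close>, so
  the loss \<open>A ^ k\<close> in \<open>T\<close> is at most \<open>s powr (1 / \<beta>)\<close>.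
  The sum of the two powers covers both cases.\<close>

lemma quasisymmetric_estimate:
  defines "\<beta> \<equiv> ln (1 / \<rho>) / ln A"
  assumes xyz: "x \<in> S" "y \<in> S" "z \<in> S" and t: "t > 0" and le: "dist x y \<le> t * dist x z"
  shows "dist (corr x) (corr y) \<le>
    2 * A ^ 5 * ((2 * A ^ 5 * t) powr \<beta> + (2 * A ^ 5 * t) powr (1 / \<beta>)) * dist (corr x) (corr z)"
proof (cases "x = y \<or> x = z")
  case True
  then show ?thesis
  proof
    assume "x = z" then have "x = y" using le by auto
    then show ?thesis using X.A by simp
  qed (use X.A in simp)
next
  case False
  note A = X.A and \<rho> = X.\<rho>
  have \<beta>: "\<beta> > 0" unfolding \<beta>_def using A \<rho> by (auto intro: divide_pos_pos)
  have rho: "\<rho> = A powr (- \<beta>)"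
    using A \<rho> by (simp add: \<beta>_def powr_def ln_div)
  obtain u where u: "u \<in> W" "x \<in> X u" "diameter (X u) \<le> A\<^sup>2 * dist x y"
      "dist (corr x) (corr y) \<le> 2 * A * diameter (Y u)"
    using scale[of x y] xyz False by metis
  obtain v where v: "v \<in> W" "x \<in> X v" "dist x z \<le> 2 * A * diameter (X v)"
      "diameter (Y v) \<le> A\<^sup>2 * dist (corr x) (corr z)"
    using scale[of x z] xyz False by metis
  have mY: "corr x \<in> Y u" "corr x \<in> Y v" using corr xyz u v by auto
  have A1: "A \<ge> 1" "A > 0" using A by auto
  define s where "s = 2 * A ^ 5 * t"
  have s: "s > 0" unfolding s_def using A1 t by simp
  have dX: "diameter (X u) \<le> (2 * A ^ 3 * t) * diameter (X v)"
  proof -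
    have "diameter (X u) \<le> A\<^sup>2 * (t * (2 * A * diameter (X v)))"
      using u(3) mult_left_mono[OF le, of "A\<^sup>2"] v(3) t A1
      by (smt (verit) mult_left_mono zero_le_power)
    then show ?thesis by (simp add: power2_eq_square power3_eq_cube mult_ac)
  qed
  have main: "diameter (Y u) \<le> A\<^sup>2 * (s powr \<beta> + s powr (1 / \<beta>)) * diameter (Y v)"
  proof (cases "length v \<le> length u")
    case True
    define k where "k = length u - length v"
    obtain u1 u0 where uu: "u = u1 @ u0" "length u0 = length v" "length u1 = k"
      by (metis True append_take_drop_id diff_diff_cancel k_def length_drop length_take min.absorb2 diff_le_self)
    have u0: "u0 \<in> W" "x \<in> X u0" "corr x \<in> Y u0"
      using X.append_mem X.append_subset Y.append_subset u(1,2) mY uu by blast+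
    have pv: "diameter (X v) > 0" "diameter (Y v) > 0" using v X.diam_pos Y.diam_pos by auto
    have "diameter (X v) \<le> A * diameter (X u0)" using X.adjacent[of v u0] u0 v uu by auto
    also have "\<dots> \<le> A * (A ^ k * diameter (X u))"
      using X.deeper[of u1 u0] u(1) uu A1 by (intro mult_left_mono) auto
    also have "\<dots> \<le> A * (A ^ k * ((2 * A ^ 3 * t) * diameter (X v)))"
      using dX A1 by (intro mult_left_mono) auto
    finally have "1 * diameter (X v) \<le> A ^ k * (2 * A ^ 4 * t) * diameter (X v)"
      by (simp add: power3_eq_cube power4_eq_xxxx mult_ac)
    then have 1: "1 \<le> A ^ k * (2 * A ^ 4 * t)" using pv by (simp only: mult_le_cancel_right)
    \<comment> \<open>\<open>2 * A ^ 4 * t\<close> would suffice in this case; \<open>s\<close> has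
      the exponent that the other case produces.\<close>
    have "2 * A ^ 4 * t \<le> s" unfolding s_def using A1 t by (intro mult_right_mono mult_left_mono power_increasing) auto
    then have "1 \<le> A ^ k * s" using 1 A1 by (smt (verit) mult_left_mono zero_le_power)
    then have "inverse (A ^ k) \<le> s" using A1 by (simp add: field_simps)
    then have "inverse (A ^ k) powr \<beta> \<le> s powr \<beta>" using A1 \<beta> by (intro powr_mono2) auto
    moreover have "\<rho> ^ k = inverse (A ^ k) powr \<beta>"
      unfolding rho using A1 by (simp add: powr_realpow[symmetric] powr_powr powr_minus[symmetric] powr_power mult_ac)
    ultimately have rk: "\<rho> ^ k \<le> s powr \<beta>" by simp
    have "diameter (Y u) \<le> A * \<rho> ^ k * diameter (Y u0)" using Y.decay[of u1 u0] u(1) uu by auto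
    also have "\<dots> \<le> A * \<rho> ^ k * (A * diameter (Y v))"
      using Y.adjacent[of u0 v] u0 v uu mY A1 \<rho> by (intro mult_left_mono) auto
    also have "\<dots> = A\<^sup>2 * \<rho> ^ k * diameter (Y v)" by (simp add: power2_eq_square)
    also have "\<dots> \<le> A\<^sup>2 * (s powr \<beta> + s powr (1 / \<beta>)) * diameter (Y v)"
      using rk pv A1 by (intro mult_right_mono mult_left_mono) (auto intro: add_increasing2)
    finally show ?thesis .
  next
    case False
    define k where "k = length v - length u"
    obtain v1 v0 where vv: "v = v1 @ v0" "length v0 = length u" "length v1 = k"
      by (metis False append_take_drop_id diff_diff_cancel k_def length_drop length_take min.absorb2 diff_le_self linear)
    have v0: "v0 \<in> W" "x \<in> X v0" "corr x \<in> Y v0"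
      using X.append_mem X.append_subset Y.append_subset v(1,2) mY vv by blast+
    have pv: "diameter (X v) > 0" "diameter (Y v) > 0" using v X.diam_pos Y.diam_pos by auto
    have "diameter (X v) \<le> A * \<rho> ^ k * diameter (X v0)" using X.decay[of v1 v0] v(1) vv by auto
    also have "\<dots> \<le> A * \<rho> ^ k * (A * diameter (X u))"
      using X.adjacent[of v0 u] v0 u vv A1 \<rho> by (intro mult_left_mono) auto
    also have "\<dots> \<le> A * \<rho> ^ k * (A * ((2 * A ^ 3 * t) * diameter (X v)))"
      using dX A1 \<rho> by (intro mult_left_mono) auto
    finally have "1 * diameter (X v) \<le> \<rho> ^ k * s * diameter (X v)"
      by (simp add: s_def eval_nat_numeral mult_ac)
    then have 1: "1 \<le> \<rho> ^ k * s" using pv by (simp only: mult_le_cancel_right)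
    then have "inverse (\<rho> ^ k) \<le> s" using \<rho> by (simp add: field_simps)
    then have "inverse (\<rho> ^ k) powr (1 / \<beta>) \<le> s powr (1 / \<beta>)" using \<rho> \<beta> by (intro powr_mono2) auto
    moreover have "A ^ k = inverse (\<rho> ^ k) powr (1 / \<beta>)"
      unfolding rho using A1 \<beta> by (simp add: powr_realpow[symmetric] powr_powr powr_minus[symmetric] powr_power)
    ultimately have rk: "A ^ k \<le> s powr (1 / \<beta>)" by simp
    have "diameter (Y u) \<le> A * diameter (Y v0)" using Y.adjacent[of u v0] v0 u vv mY by auto
    also have "\<dots> \<le> A * (A ^ k * diameter (Y v))"
      using Y.deeper[of v1 v0] v(1) vv A1 by (intro mult_left_mono) auto
    also have "\<dots> \<le> A * (A * (A ^ k * diameter (Y v)))"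
      using pv A1 by (intro mult_left_mono) auto
    also have "\<dots> = A\<^sup>2 * A ^ k * diameter (Y v)" by (simp add: power2_eq_square)
    also have "\<dots> \<le> A\<^sup>2 * (s powr \<beta> + s powr (1 / \<beta>)) * diameter (Y v)"
      using rk pv A1 by (intro mult_right_mono mult_left_mono) (auto intro: add_increasing)
    finally show ?thesis .
  qed
  let ?E = "s powr \<beta> + s powr (1 / \<beta>)"
  have "dist (corr x) (corr y) \<le> 2 * A * (A\<^sup>2 * ?E * diameter (Y v))"
    using u(4) main A1 by (smt (verit) mult_left_mono)
  also have "\<dots> \<le> 2 * A * (A\<^sup>2 * ?E * (A\<^sup>2 * dist (corr x) (corr z)))"
    using v(4) A1 by (intro mult_left_mono) auto
  also have "\<dots> = 2 * A ^ 5 * ?E * dist (corr x) (corr z)" by (simp add: eval_nat_numeral mult_ac)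
  finally show ?thesis unfolding s_def .
qed

lemma homeomorphism_powr_sum:
  fixes B b c :: real
  assumes "B > 0" "b > 0" "c > 0"
  obtains \<theta> where "homeomorphism {0..} {0..} (\<lambda>t. B * ((B * t) powr b + (B * t) powr c)) \<theta>"
proof -
  define f where "f t = B * ((B * t) powr b + (B * t) powr c)" for t
  have cont: "continuous_on {0..} f"
    unfolding f_def using assms
    by (intro continuous_on_mult continuous_on_add continuous_on_powr' continuous_on_const
        continuous_on_id) auto
  have mono: "strict_mono_on {0..} f"
    unfolding f_def using assms
    by (auto intro!: strict_mono_onI add_strict_mono powr_less_mono2)
  \<comment> \<open>At this point the first summand alone already gives \<open>t\<close>, so the
    intermediate value theorem reaches every \<open>t\<close>.\<close>
  have big: "t \<le> f (t powr (1 / b) / B / B powr (1 / b))" if "t \<ge> 0" for t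
  proof -
    have "B * (B * (t powr (1 / b) / B / B powr (1 / b))) powr b = t"
      using that assms by (simp add: powr_divide powr_powr)
    then show ?thesis unfolding f_def using assms by (simp add: distrib_left)
  qed
  have "f ` {0..} = {0..}"
  proof
    show "f ` {0..} \<subseteq> {0..}" unfolding f_def using assms by auto
    show "{0..} \<subseteq> f ` {0..}"
    proof
      fix t :: real assume t: "t \<in> {0..}"
      let ?b = "t powr (1 / b) / B / B powr (1 / b)"
      have "f 0 \<le> t" using t by (simp add: f_def)
      moreover have "t \<le> f ?b" using big t by auto
      moreover have "0 \<le> ?b" using assms by auto
      ultimately obtain x where "0 \<le> x" "f x = t"
        using IVT'[of f 0 t ?b] continuous_on_subset[OF cont, of "{0..?b}"] by auto
      then show "t \<in> f ` {0..}" by force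
    qed
  qed
  moreover have "inj_on f {0..}" using mono strict_mono_on_imp_inj_on by blast
  ultimately have "\<exists>g. homeomorphism {0..} {0..} f g"
    using cont by (intro homeomorphism_into_1d) (auto intro: convex_imp_path_connected)
  then show thesis using that unfolding f_def by blast
qed

text \<open>If \<open>y\<close> is close to \<open>x\<close> compared with a tile of generation
  \<open>n\<close> around \<open>x\<close>, the tile \<open>u\<close> of \<open>scale\<close> has
  generation at least \<open>n\<close>. Its counterpart in \<open>T\<close> is then small and bounds
  the distance of the images.\<close>

lemma corr_continuous: "continuous_on S corr"
proof (rule continuous_on_iff[THEN iffD2], intro ballI allI impI)
  fix x and e :: real assume x: "x \<in> S" and e: "e > 0"
  obtain n where n: "\<And>w. \<lbrakk>w \<in> W; length w \<ge> n\<rbrakk> \<Longrightarrow> diameter (Y w) < e / (2 * A)"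
    using Y.small[of "e / (2 * A)"] e X.A by auto
  obtain \<alpha> where \<alpha>: "\<And>n. \<alpha> n \<in> W" "\<And>n. x \<in> X (\<alpha> n)" "\<And>n. length (\<alpha> n) = 0 + n"
    using X.address[of "[]" x] x X.Nil_mem X.root by (metis list.size(3))
  \<comment> \<open>A tile \<open>u\<close> older than generation \<open>n\<close> would be adjacent
    to an ancestor of \<open>\<alpha> n\<close> and yield
    \<open>diameter (X (\<alpha> n)) \<le> A ^ 3 * dist x y\<close>; this threshold excludes
    it.\<close>
  let ?d = "diameter (X (\<alpha> n)) / (2 * A ^ 3)"
  have d: "?d > 0" using X.diam_pos[OF \<alpha>(1)] X.A by simp
  show "\<exists>d>0. \<forall>x'\<in>S. dist x' x < d \<longrightarrow> dist (corr x') (corr x) < e"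
  proof (intro exI conjI ballI impI)
    fix y assume y: "y \<in> S" "dist y x < ?d"
    show "dist (corr y) (corr x) < e"
    proof (cases "x = y")
      case False
      obtain u where u: "u \<in> W" "x \<in> X u" "diameter (X u) \<le> A\<^sup>2 * dist x y"
          "dist (corr x) (corr y) \<le> 2 * A * diameter (Y u)"
        using scale[OF x y(1) False] by metis
      have "length u \<ge> n"
      proof (rule ccontr)
        assume "\<not> length u \<ge> n"
        then have "length u \<le> n" by simp
        then obtain v1 v0 where vv: "\<alpha> n = v1 @ v0" "length v0 = length u"
          by (metis \<alpha>(3) add_0 append_take_drop_id diff_diff_cancel length_drop)
        have "v0 \<in> W" using \<alpha>(1)[of n] vv X.append_mem by metis
        moreover have "X (\<alpha> n) \<subseteq> X v0" using \<alpha>(1)[of n] vv X.append_subset by metis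
        ultimately have "diameter (X v0) \<le> A * diameter (X u)"
          using X.adjacent[of v0 u] u vv \<alpha> by blast
        moreover have "diameter (X (\<alpha> n)) \<le> diameter (X v0)"
          by (rule diameter_subset) (use X.bdd \<open>v0 \<in> W\<close> \<open>X (\<alpha> n) \<subseteq> X v0\<close> in auto)
        ultimately have "diameter (X (\<alpha> n)) \<le> A * (A\<^sup>2 * dist x y)"
          using u(3) mult_left_mono[OF u(3), of A] X.A by linarith
        also have "\<dots> = A ^ 3 * dist x y" by (simp add: eval_nat_numeral mult_ac)
        also have "\<dots> < A ^ 3 * ?d" using y(2) X.A by (intro mult_strict_left_mono) (auto simp: dist_commute)
        finally show False using X.A X.diam_pos[OF \<alpha>(1), of n] by (simp add: field_simps)
      qed
      then have "diameter (Y u) < e / (2 * A)" using n u by auto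
      then have "2 * A * diameter (Y u) < e" using X.A by (simp add: field_simps)
      then show ?thesis using u(4) by (simp add: dist_commute)
    qed (use e in simp)
  qed (rule d)
qed

lemma corr_quasisymmetry: "quasisymmetry S T corr"
proof -
  interpret sw: tiling_pair W Y T X S A \<rho> by (rule swap)
  have "homeomorphism S T corr sw.corr"
  proof (rule homeomorphismI)
    show "sw.corr (corr x) = x" if "x \<in> S" for x using corr_inverse that .
    show "corr (sw.corr y) = y" if "y \<in> T" for y using sw.corr_inverse that .
  qed (use corr_continuous sw.corr_continuous corr(1) sw.corr(1) in auto)
  moreover define \<beta> where "\<beta> = ln (1 / \<rho>) / ln A"
  have "\<beta> > 0" unfolding \<beta>_def using X.A X.\<rho> by (auto intro: divide_pos_pos)
  then obtain \<theta> where "homeomorphism {0..} {0..}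
      (\<lambda>t. 2 * A ^ 5 * ((2 * A ^ 5 * t) powr \<beta> + (2 * A ^ 5 * t) powr (1 / \<beta>))) \<theta>"
    using homeomorphism_powr_sum[of "2 * A ^ 5" \<beta> "1 / \<beta>"] X.A by auto
  ultimately show ?thesis
    unfolding quasisymmetry_def using quasisymmetric_estimate[folded \<beta>_def] by blast
qed

end

section \<open>Arcs and branches in trees of bounded turning\<close>

lemma compact_diameter_le_twice_dist:
  assumes "compact X" "x \<in> X"
  obtains y where "y \<in> X" "diameter X \<le> 2 * dist x y"
proof -
  obtain u v where uv: "u \<in> X" "v \<in> X" "dist u v = diameter X"
    using diameter_compact_attained[of X] assms by auto
  have "dist u v \<le> dist x u + dist x v" by (rule dist_triangle3)
  then show thesis using that[of u] that[of v] uv by linarith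
qed

locale tree =
  fixes T :: "'a::metric_space set" and K :: real
  assumes tree: "metric_tree T" and K: "K \<ge> 1"
    and turning: "\<lbrakk>x \<in> T; y \<in> T\<rbrakk> \<Longrightarrow> diameter (tree_arc T x y) \<le> K * dist x y"
begin

abbreviation "seg \<equiv> tree_arc T"

section \<open>Arcs: splitting, joining, medians\<close>

lemma compact_T: "compact T" and connected_T: "connected T"
  using tree by (auto simp: metric_tree_def)

lemma seg_eqI: "arc_between T x y A \<Longrightarrow> seg x y = A"
proof -
  assume A: "arc_between T x y A"
  have "x \<in> T" "y \<in> T"
    using A by (auto simp: arc_between_def pathstart_def pathfinish_def path_image_def)
  then have "\<exists>!A. arc_between T x y A" using tree by (auto simp: metric_tree_def)
  then show ?thesis unfolding tree_arc_def using A by (rule the1_equality)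
qed

lemma arc_between_seg: assumes "x \<in> T" "y \<in> T" shows "arc_between T x y (seg x y)"
proof -
  have "\<exists>!A. arc_between T x y A" using assms tree by (auto simp: metric_tree_def)
  then show ?thesis unfolding tree_arc_def by (rule theI')
qed

lemma seg_refl [simp]: "x \<in> T \<Longrightarrow> seg x x = {x}"
  by (intro seg_eqI) (simp add: arc_between_def)

lemma seg_arc: "\<lbrakk>arc g; path_image g \<subseteq> T\<rbrakk> \<Longrightarrow> seg (g 0) (g 1) = path_image g"
  by (intro seg_eqI) (auto simp: arc_between_def pathstart_def pathfinish_def)

lemma seg_param:
  assumes "x \<in> T" "y \<in> T" "x \<noteq> y"
  obtains g where "arc g" "g 0 = x" "g 1 = y" "path_image g = seg x y" "path_image g \<subseteq> T"
  using arc_between_seg[OF assms(1,2)] assms(3) that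
  unfolding arc_between_def pathstart_def pathfinish_def by auto

lemma seg_subarc:
  assumes g: "arc g" "path_image g \<subseteq> T" and st: "0 \<le> s" "s \<le> t" "t \<le> 1"
  shows "seg (g s) (g t) = g ` {s..t}"
proof (cases "s = t")
  case True
  then have "g s \<in> T" using g st by (auto simp: path_image_def)
  then show ?thesis using True by simp
next
  case False
  define f where "f u = s + (t - s) * u" for u :: real
  have f: "f ` {0..1} = {s..t}"
    unfolding f_def using False st image_affinity_atLeastAtMost[of "t - s" s 0 1]
    by (simp add: add.commute)
  have sub: "{s..t} \<subseteq> {0..1}" using st by auto
  have "arc (g \<circ> f)" unfolding arc_def path_def
  proof
    show "continuous_on {0..1} (g \<circ> f)"
      using g f sub unfolding arc_def path_def
      by (intro continuous_on_compose) (auto simp: f_def intro!: continuous_intros intro: continuous_on_subset)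
    have "inj_on f {0..1}" using False by (auto simp: f_def inj_on_def)
    then show "inj_on (g \<circ> f) {0..1}"
      using g f sub unfolding arc_def by (intro comp_inj_on) (auto intro: inj_on_subset)
  qed
  moreover have im: "path_image (g \<circ> f) = g ` {s..t}" using f unfolding path_image_def image_comp[symmetric] by simp
  moreover have "path_image (g \<circ> f) \<subseteq> T" using im g sub by (auto simp: path_image_def)
  ultimately have "seg ((g \<circ> f) 0) ((g \<circ> f) 1) = g ` {s..t}"
    using seg_arc[of "g \<circ> f"] by metis
  then show ?thesis by (simp add: f_def)
qed

lemma seg_sym: assumes "x \<in> T" "y \<in> T" shows "seg x y = seg y x"
proof (cases "x = y")
  case False
  then obtain g where g: "arc g" "g 0 = x" "g 1 = y" "path_image g = seg x y" "path_image g \<subseteq> T"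
    using seg_param assms by metis
  have "arc (reversepath g)" using g arc_reversepath by auto
  moreover have "path_image (reversepath g) = path_image g" using path_image_reversepath by auto
  ultimately have "seg (reversepath g 0) (reversepath g 1) = seg x y"
    using seg_arc[of "reversepath g"] g by simp
  then show ?thesis using g by (simp add: reversepath_def)
qed simp

lemma seg_subset: "\<lbrakk>x \<in> T; y \<in> T\<rbrakk> \<Longrightarrow> seg x y \<subseteq> T"
  using arc_between_seg by (auto simp: arc_between_def)

lemma ends_in_seg: assumes "x \<in> T" "y \<in> T" shows "x \<in> seg x y" "y \<in> seg x y"
  using arc_between_seg[OF assms] by (auto simp: arc_between_def pathstart_def pathfinish_def path_image_def)

lemma seg_cases:
  assumes "x \<in> T" "y \<in> T"
  shows "seg x y = {x} \<or> (\<exists>g. arc g \<and> path_image g = seg x y)"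
  using arc_between_seg[OF assms] unfolding arc_between_def by metis

lemma compact_seg: "\<lbrakk>x \<in> T; y \<in> T\<rbrakk> \<Longrightarrow> compact (seg x y)"
  using seg_cases[of x y] compact_arc_image by (metis compact_sing)

lemma connected_seg: "\<lbrakk>x \<in> T; y \<in> T\<rbrakk> \<Longrightarrow> connected (seg x y)"
  using seg_cases[of x y] connected_arc_image by (metis connected_sing)

lemma seg_split:
  assumes "x \<in> T" "y \<in> T" "z \<in> seg x y"
  shows "seg x y = seg x z \<union> seg z y" "seg x z \<inter> seg z y = {z}"
proof -
  have "seg x y = seg x z \<union> seg z y \<and> seg x z \<inter> seg z y = {z}"
  proof (cases "x = y")
    case False
    then obtain g where g: "arc g" "g 0 = x" "g 1 = y" "path_image g = seg x y" "path_image g \<subseteq> T"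
      using seg_param assms by metis
    have "z \<in> g ` {0..1}" using assms(3) g(4) by (simp add: path_image_def)
    then obtain s where s: "0 \<le> s" "s \<le> 1" "z = g s" by auto
    have 1: "seg x z = g ` {0..s}" "seg z y = g ` {s..1}"
      using seg_subarc[of g 0 s] seg_subarc[of g s 1] g s by auto
    have "{0..1} = {0..s} \<union> {s..1}" "{0..s} \<inter> {s..1} = {s}" using s by auto
    moreover have "g ` ({0..s} \<inter> {s..1}) = g ` {0..s} \<inter> g ` {s..1}"
      using g(1) s by (intro inj_on_image_Int[of _ "{0..1}"]) (auto simp: arc_def)
    ultimately show ?thesis using 1 s g(4) by (auto simp: path_image_def image_Un[symmetric])
  qed (use assms in simp)
  then show "seg x y = seg x z \<union> seg z y" "seg x z \<inter> seg z y = {z}" by auto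
qed

lemma seg_join:
  assumes xyz: "x \<in> T" "y \<in> T" "z \<in> T" and int: "seg x y \<inter> seg y z \<subseteq> {y}"
  shows "seg x z = seg x y \<union> seg y z"
proof (cases "x = y \<or> y = z")
  case True
  then show ?thesis using assms ends_in_seg by auto
next
  case False
  obtain g where g: "arc g" "g 0 = x" "g 1 = y" "path_image g = seg x y" "path_image g \<subseteq> T"
    using seg_param xyz False by metis
  obtain h where h: "arc h" "h 0 = y" "h 1 = z" "path_image h = seg y z" "path_image h \<subseteq> T"
    using seg_param xyz False by metis
  have e: "pathfinish g = pathstart h" using g h by (simp add: pathstart_def pathfinish_def)
  have a: "arc (g +++ h)" by (rule arc_join[OF g(1) h(1) e]) (use g h int in \<open>auto simp: pathstart_def\<close>)
  have im: "path_image (g +++ h) = seg x y \<union> seg y z" using path_image_join[OF e] g h by simp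
  have "seg ((g +++ h) 0) ((g +++ h) 1) = seg x y \<union> seg y z"
    using seg_arc[OF a] im g h by auto
  then show ?thesis using g h by (simp add: joinpaths_def)
qed

text \<open>Let \<open>m\<close> be the first point of \<open>[x, y]\<close> that lies on
  \<open>[y, z]\<close>. Then \<open>[x, m]\<close> and \<open>[m, z]\<close> meet only in
  \<open>m\<close>, so by \<open>seg_join\<close> their union is \<open>[x, z]\<close>.\<close>

lemma median_triangle:
  assumes xyz: "x \<in> T" "y \<in> T" "z \<in> T"
  shows "(\<exists>m. m \<in> seg x y \<and> m \<in> seg y z \<and> m \<in> seg x z) \<and> seg x z \<subseteq> seg x y \<union> seg y z"
proof (cases "x = y")
  case False
  obtain g where g: "arc g" "g 0 = x" "g 1 = y" "path_image g = seg x y" "path_image g \<subseteq> T"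
    using seg_param xyz False by metis
  define C where "C = {t\<in>{0..1}. g t \<in> seg y z}"
  have "closed C"
    unfolding C_def using g(1) compact_seg[OF xyz(2,3)]
    by (intro continuous_closed_preimage[of "{0..1}" g "seg y z", simplified vimage_def Int_def mem_Collect_eq])
      (auto simp: arc_def path_def compact_imp_closed)
  then have "compact C" using compact_Int_closed[of "{0..1}" C] by (simp add: C_def Int_def conj_commute cong: conj_cong)
  moreover have "1 \<in> C" unfolding C_def using g ends_in_seg xyz by auto
  ultimately obtain t where t: "t \<in> C" "\<And>u. u \<in> C \<Longrightarrow> t \<le> u"
    using compact_attains_inf[of C] by auto
  define m where "m = g t"
  have t01: "0 \<le> t" "t \<le> 1" using t by (auto simp: C_def)
  have m: "m \<in> seg y z" "m \<in> seg x y" "m \<in> T"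
    using t g unfolding m_def C_def by (auto simp: path_image_def)
  have sx: "seg x m = g ` {0..t}" using seg_subarc[of g 0 t] g t01 by (simp add: m_def)
  have sub: "seg m z \<subseteq> seg y z" using seg_split[OF xyz(2,3) m(1)] by auto
  have "seg x m \<inter> seg m z \<subseteq> {m}"
  proof
    fix w assume w: "w \<in> seg x m \<inter> seg m z"
    then obtain u where u: "0 \<le> u" "u \<le> t" "w = g u" using sx by auto
    then have "u \<in> C" unfolding C_def using w sub t01 by auto
    then have "u = t" using t(2)[of u] u by linarith
    then show "w \<in> {m}" using u by (simp add: m_def)
  qed
  then have "seg x z = seg x m \<union> seg m z" using seg_join[OF xyz(1) m(3) xyz(3)] by blast
  moreover have "seg x m \<subseteq> seg x y" using seg_split[OF xyz(1,2) m(2)] by auto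
  ultimately show ?thesis using sub m ends_in_seg(2)[OF xyz(1) m(3)] by blast
qed (use xyz ends_in_seg in auto)

lemma median:
  assumes "x \<in> T" "y \<in> T" "z \<in> T"
  obtains m where "m \<in> seg x y" "m \<in> seg y z" "m \<in> seg x z"
  using median_triangle[OF assms] by auto

lemma seg_triangle: "\<lbrakk>x \<in> T; y \<in> T; z \<in> T\<rbrakk> \<Longrightarrow> seg x z \<subseteq> seg x y \<union> seg y z"
  using median_triangle by blast

lemma dist_in_seg:
  assumes "x \<in> T" "y \<in> T" "z \<in> seg x y" "w \<in> seg x y" shows "dist z w \<le> K * dist x y"
  using diameter_bounded_bound[OF compact_imp_bounded[OF compact_seg[OF assms(1,2)]] assms(3,4)]
    turning[OF assms(1,2)] by linarith

lemma seg_point_at: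
  assumes "x \<in> T" "y \<in> T" "0 \<le> \<tau>" "\<tau> \<le> dist x y"
  obtains z where "z \<in> seg x y" "dist x z = \<tau>"
proof (cases "x = y")
  case True
  then show thesis using that[of x] assms by simp
next
  case False
  obtain g where g: "arc g" "g 0 = x" "g 1 = y" "path_image g = seg x y" "path_image g \<subseteq> T"
    using seg_param assms False by metis
  have "continuous_on {0..1} (\<lambda>t. dist x (g t))"
    using g(1) by (intro continuous_intros) (auto simp: arc_def path_def)
  then obtain t where "0 \<le> t" "t \<le> 1" "dist x (g t) = \<tau>"
    using IVT'[of "\<lambda>t. dist x (g t)" 0 \<tau> 1] g assms by auto
  moreover have "g t \<in> path_image g" using calculation by (auto simp: path_image_def)
  ultimately show thesis using that[of "g t"] g(4) by simp
qed

text \<open>The branch of \<open>a\<close> containing \<open>b\<close>.\<close>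

definition Br :: "'a \<Rightarrow> 'a \<Rightarrow> 'a set" where
  "Br a b = insert a {x \<in> T. a \<notin> seg x b}"

section \<open>Branches: openness, components, closure\<close>

lemma separates_trans:
  assumes "x \<in> T" "y \<in> T" "z \<in> T" "a \<notin> seg x y" "a \<notin> seg y z" shows "a \<notin> seg x z"
  using seg_triangle[of x y z] assms by auto

text \<open>By bounded turning the arc from \<open>x\<close> to a nearby \<open>y\<close> is too
  small to reach \<open>a\<close>. This makes separation by \<open>a\<close> a locally constant
  relation.\<close>

lemma not_separated_near:
  assumes "x \<in> T" "y \<in> T" "K * dist x y < dist x a" shows "a \<notin> seg x y"
  using dist_in_seg[of x y x a] ends_in_seg[of x y] assms by force

lemma self_mem_Br [simp]: "a \<in> Br a b"
  by (simp add: Br_def)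

lemma mem_Br [simp]: "\<lbrakk>b \<in> T; a \<noteq> b\<rbrakk> \<Longrightarrow> b \<in> Br a b"
  by (simp add: Br_def)

lemma Br_subset: "a \<in> T \<Longrightarrow> Br a b \<subseteq> T"
  by (auto simp: Br_def)

text \<open>Lying on the same side of \<open>a\<close> is transitive by
  \<open>separates_trans\<close> and holds between a point other than \<open>a\<close> and all
  points near it. So the class of \<open>b\<close> and its complement in \<open>T - {a}\<close> are
  both open.\<close>

lemma openin_unseparated:
  assumes "a \<in> T" "b \<in> T" "a \<noteq> b"
  shows "openin (top_of_set T) {x \<in> T. a \<notin> seg x b}"
    "openin (top_of_set T) {x \<in> T - {a}. a \<in> seg x b}"
proof -
  have near: "\<exists>e>0. \<forall>y\<in>T. dist y x < e \<longrightarrow> a \<notin> seg x y \<and> y \<noteq> a" if "x \<in> T" "x \<noteq> a" for x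
  proof (intro exI conjI ballI impI)
    show "dist x a / K > 0" using that K by simp
    fix y assume y: "y \<in> T" "dist y x < dist x a / K"
    then have "K * dist x y < dist x a" using K by (simp add: field_simps dist_commute)
    then show "a \<notin> seg x y" using not_separated_near that y by auto
    then show "y \<noteq> a" using ends_in_seg[of x y] that y by auto
  qed
  have ne: "x \<noteq> a" if "a \<notin> seg x b" for x using ends_in_seg[of a b] assms that by auto
  show "openin (top_of_set T) {x \<in> T. a \<notin> seg x b}"
    unfolding openin_euclidean_subtopology_iff
  proof (intro conjI ballI)
    fix x assume x: "x \<in> {x \<in> T. a \<notin> seg x b}"
    then obtain e where "e > 0" "\<forall>y\<in>T. dist y x < e \<longrightarrow> a \<notin> seg x y \<and> y \<noteq> a" using near ne by blast
    moreover have "a \<notin> seg y b" if "y \<in> T" "a \<notin> seg x y" for y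
      using separates_trans[of y x b a] seg_sym that x assms by auto
    ultimately show "\<exists>e>0. \<forall>x'\<in>T. dist x' x < e \<longrightarrow> x' \<in> {x \<in> T. a \<notin> seg x b}" by auto
  qed auto
  show "openin (top_of_set T) {x \<in> T - {a}. a \<in> seg x b}"
    unfolding openin_euclidean_subtopology_iff
  proof (intro conjI ballI)
    fix x assume x: "x \<in> {x \<in> T - {a}. a \<in> seg x b}"
    then obtain e where "e > 0" "\<forall>y\<in>T. dist y x < e \<longrightarrow> a \<notin> seg x y \<and> y \<noteq> a" using near by blast
    moreover have "a \<in> seg y b" if "y \<in> T" "a \<notin> seg x y" for y
      using separates_trans[of x y b a] that x assms by auto
    ultimately show "\<exists>e>0. \<forall>x'\<in>T. dist x' x < e \<longrightarrow> x' \<in> {x \<in> T - {a}. a \<in> seg x b}" by auto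
  qed auto
qed

text \<open>The right-hand side is a union of arcs ending in \<open>b\<close>, hence connected. A
  larger connected set in \<open>T - {a}\<close> would be split by the two open sets of
  \<open>openin_unseparated\<close>.\<close>

lemma connected_component_unseparated:
  assumes ab: "a \<in> T" "b \<in> T" "a \<noteq> b"
  shows "connected_component_set (T - {a}) b = {x \<in> T. a \<notin> seg x b}" (is "?C = ?U")
proof
  have U: "?U \<subseteq> T - {a}" using ends_in_seg ab by auto
  have bU: "b \<in> ?U" using ab by auto
  have "?U = \<Union> ((\<lambda>x. seg x b) ` ?U)"
  proof
    show "?U \<subseteq> \<Union> ((\<lambda>x. seg x b) ` ?U)" using ends_in_seg(1)[OF _ ab(2)] by blast
    show "\<Union> ((\<lambda>x. seg x b) ` ?U) \<subseteq> ?U"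
    proof
      fix z assume "z \<in> \<Union> ((\<lambda>x. seg x b) ` ?U)"
      then obtain x where x: "x \<in> T" "a \<notin> seg x b" "z \<in> seg x b" by auto
      then show "z \<in> ?U" using seg_split[of x b z] seg_subset[of x b] ab by auto
    qed
  qed
  moreover have "connected (\<Union> ((\<lambda>x. seg x b) ` ?U))"
  proof (rule connected_Union)
    have "b \<in> \<Inter> ((\<lambda>x. seg x b) ` ?U)" using ends_in_seg ab by auto
    then show "\<Inter> ((\<lambda>x. seg x b) ` ?U) \<noteq> {}" by auto
  qed (use connected_seg ab in auto)
  ultimately have "connected ?U" by simp
  then show "?U \<subseteq> ?C" by (intro connected_component_maximal) (use U bU in auto)
  have C: "?C \<subseteq> T - {a}" "connected ?C" "b \<in> ?C"
    using connected_component_subset[of "T - {a}" b] ab by auto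
  show "?C \<subseteq> ?U"
  proof (rule ccontr)
    assume *: "\<not> ?C \<subseteq> ?U"
    let ?V = "{x \<in> T - {a}. a \<in> seg x b}"
    obtain O1 O2 where O: "open O1" "?U = T \<inter> O1" "open O2" "?V = T \<inter> O2"
      using openin_unseparated[OF ab] unfolding openin_open by auto
    define D where "D = ?C"
    have D: "D \<subseteq> T - {a}" "b \<in> D" "\<not> D \<subseteq> ?U" using C * by (simp_all add: D_def)
    have cover: "D \<subseteq> ?U \<union> ?V" using D(1) by auto
    have disj: "?U \<inter> ?V = {}" by auto
    have "O1 \<inter> D \<noteq> {}" using bU O(2) D(2) by auto
    moreover have "O2 \<inter> D \<noteq> {}" using D(3) cover O(4) by auto
    moreover have "D \<subseteq> O1 \<union> O2" using cover O(2,4) by auto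
    moreover have "O1 \<inter> O2 \<inter> D = {}" using disj O(2,4) D(1) by auto
    ultimately show False using connectedD[OF C(2) O(1,3)] by (simp add: D_def)
  qed
qed

lemma closed_Br: assumes "a \<in> T" "b \<in> T" "a \<noteq> b" shows "closed (Br a b)"
proof -
  have "Br a b = T - {x \<in> T - {a}. a \<in> seg x b}" using assms by (auto simp: Br_def)
  moreover have "closedin (top_of_set T) (T - {x \<in> T - {a}. a \<in> seg x b})"
    using openin_unseparated(2)[OF assms] by (simp add: openin_closedin_eq)
  ultimately show ?thesis using compact_T by (metis closedin_closed_trans compact_imp_closed)
qed

text \<open>The point \<open>a\<close> is a limit of the other points of \<open>[a, b]\<close>, and
  adding it gives a closed set.\<close>

lemma closure_unseparated:
  assumes "a \<in> T" "b \<in> T" "a \<noteq> b" shows "closure {x \<in> T. a \<notin> seg x b} = Br a b"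
proof
  show "closure {x \<in> T. a \<notin> seg x b} \<subseteq> Br a b"
    by (rule closure_minimal) (use closed_Br assms in \<open>auto simp: Br_def\<close>)
  obtain g where g: "arc g" "g 0 = a" "g 1 = b" "path_image g = seg a b" "path_image g \<subseteq> T"
    using seg_param assms by metis
  have U: "g t \<in> {x \<in> T. a \<notin> seg x b}" if "t \<in> {0<..1}" for t
  proof -
    have "seg (g t) b = g ` {t..1}" using seg_subarc[of g t 1] g that by auto
    moreover have "a \<notin> g ` {t..1}"
      using g(1,2) that by (auto simp: arc_def inj_on_def) (metis atLeastAtMost_iff less_eq_real_def
          linorder_not_less order_trans zero_le_one)
    ultimately show ?thesis using g that by (auto simp: path_image_def)
  qed
  have "g ` closure {0<..1} \<subseteq> closure {x \<in> T. a \<notin> seg x b}"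
  proof (rule image_closure_subset)
    show "continuous_on (closure {0<..1}) g" using g(1) by (simp add: arc_def path_def)
    show "g ` {0<..1} \<subseteq> closure {x \<in> T. a \<notin> seg x b}" using U closure_subset by blast
  qed auto
  then have "a \<in> closure {x \<in> T. a \<notin> seg x b}" using g by force
  then show "Br a b \<subseteq> closure {x \<in> T. a \<notin> seg x b}"
    using closure_subset[of "{x \<in> T. a \<notin> seg x b}"] by (auto simp: Br_def)
qed

text \<open>The bridge from the topological definition of branches to arcs; later arguments about
  branches work with \<open>Br\<close>.\<close>

lemma branches_eq: assumes "a \<in> T" shows "branches T a = Br a ` (T - {a})"
  unfolding branches_def components_def image_image
  using connected_component_unseparated closure_unseparated assms by (intro image_cong) auto

lemma compact_Br: assumes "a \<in> T" "b \<in> T" "a \<noteq> b" shows "compact (Br a b)"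
  using closed_Br[OF assms] Br_subset[OF assms(1)] compact_T by (metis compact_Int_closed inf.absorb2)

lemma Br_eq:
  assumes "a \<in> T" "b \<in> T" "a \<noteq> b" "c \<in> Br a b" "c \<noteq> a" shows "Br a c = Br a b"
proof -
  have c: "c \<in> T" "a \<notin> seg c b" using assms by (auto simp: Br_def)
  then have "a \<notin> seg x c \<longleftrightarrow> a \<notin> seg x b" if "x \<in> T" for x
    using separates_trans[of x c b a] separates_trans[of x b c a] seg_sym assms that by auto
  then show ?thesis by (auto simp: Br_def)
qed

lemma Br_Int:
  assumes "a \<in> T" "b \<in> T" "c \<in> T" "a \<noteq> b" "a \<noteq> c" "Br a b \<noteq> Br a c"
  shows "Br a b \<inter> Br a c = {a}"
proof (rule ccontr)
  assume "Br a b \<inter> Br a c \<noteq> {a}"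
  then obtain x where "x \<in> Br a b" "x \<in> Br a c" "x \<noteq> a" by fastforce
  then show False using Br_eq[of a b x] Br_eq[of a c x] assms by auto
qed

lemma seg_through:
  assumes "a \<in> T" "b \<in> T" "a \<noteq> b" "x \<in> Br a b" "y \<in> T" "y \<notin> Br a b" shows "a \<in> seg x y"
proof (rule ccontr)
  assume n: "a \<notin> seg x y"
  have "x \<noteq> a" using n ends_in_seg[of a y] assms by auto
  then have x: "x \<in> T" "a \<notin> seg x b" using assms by (auto simp: Br_def)
  then have "a \<notin> seg y b" using separates_trans[of y x b a] n seg_sym[of x y] assms by auto
  then show False using assms by (auto simp: Br_def)
qed

lemma Br_convex:
  assumes ab: "a \<in> T" "b \<in> T" "a \<noteq> b" and x: "x \<in> Br a b" and y: "y \<in> Br a b"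
  shows "seg x y \<subseteq> Br a b"
proof
  fix z assume z: "z \<in> seg x y"
  have T: "x \<in> T" "y \<in> T" "z \<in> T" using x y z Br_subset[OF ab(1)] seg_subset by blast+
  show "z \<in> Br a b"
  proof (rule ccontr)
    assume n: "z \<notin> Br a b"
    have "a \<in> seg x z" by (rule seg_through[OF ab x T(3) n])
    moreover have "a \<in> seg y z" by (rule seg_through[OF ab y T(3) n])
    ultimately
    have "a \<in> seg x z \<inter> seg z y" using seg_sym T by auto
    then show False using seg_split(2)[of x y z] T z n by auto
  qed
qed

text \<open>For \<open>y\<close> in the branch \<open>Br a c\<close> the arc from \<open>y\<close>
  to \<open>a\<close> stays in that branch, which misses \<open>r\<close>; so \<open>r\<close> does
  not separate \<open>y\<close> from \<open>a\<close>.\<close>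

lemma Br_nested:
  assumes "a \<in> T" "c \<in> T" "r \<in> T" "a \<noteq> c" "a \<noteq> r" "r \<notin> Br a c"
  shows "Br a c \<subseteq> Br r a"
proof
  fix y assume y: "y \<in> Br a c"
  then have "r \<notin> seg y a" using Br_convex[of a c y a] assms by auto
  then show "y \<in> Br r a" using y Br_subset[of a c] assms by (auto simp: Br_def)
qed

lemma notin_Br_iff:
  assumes "x \<in> T" "a \<noteq> x" shows "x \<notin> Br a b \<longleftrightarrow> a \<in> seg x b"
  using assms by (auto simp: Br_def)

text \<open>Everything that hangs off the interior of \<open>[a, b]\<close> is included, whereas the
  branches of \<open>a\<close> and \<open>b\<close> that lead away from the arc contribute nothing
  but their base points.\<close>

definition E :: "'a \<Rightarrow> 'a \<Rightarrow> 'a set" where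
  "E a b = Br a b \<inter> Br b a"

lemma E_sym: "E a b = E b a"
  by (auto simp: E_def)

lemma seg_subset_E: assumes "a \<in> T" "b \<in> T" "a \<noteq> b" shows "seg a b \<subseteq> E a b"
  using Br_convex[of a b a b] Br_convex[of b a a b] assms by (auto simp: E_def)

lemma E_subset: "a \<in> T \<Longrightarrow> E a b \<subseteq> T"
  using Br_subset by (auto simp: E_def)

lemma compact_E: assumes "a \<in> T" "b \<in> T" "a \<noteq> b" shows "compact (E a b)"
  unfolding E_def using compact_Br closed_Br assms by (intro compact_Int_closed) auto

lemma E_through:
  assumes "a \<in> T" "b \<in> T" "a \<noteq> b" "x \<in> E a b" "y \<in> T" "y \<notin> E a b"
  shows "a \<in> seg x y \<or> b \<in> seg x y"
  using assms seg_through[of a b x y] seg_through[of b a x y] by (auto simp: E_def)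

lemma inner_Br:
  assumes "a \<in> T" "b \<in> T" "p \<in> seg a b" "p \<noteq> a" "p \<noteq> b"
  shows "Br a p = Br a b" "Br b p = Br b a" "b \<notin> Br p a" "a \<notin> Br p b" "p \<in> T"
proof -
  have ab: "a \<noteq> b" using assms by auto
  have "p \<in> E a b" using seg_subset_E[OF assms(1,2) ab] assms by auto
  then show "Br a p = Br a b" "Br b p = Br b a"
    using Br_eq[of a b p] Br_eq[of b a p] assms ab by (auto simp: E_def)
  show "p \<in> T" using assms seg_subset[OF assms(1,2)] by auto
  then show "b \<notin> Br p a" "a \<notin> Br p b" using assms seg_sym[OF assms(1,2)] by (auto simp: Br_def)
qed

lemma E_mono:
  assumes "a \<in> T" "b \<in> T" "p \<in> seg a b" "p \<noteq> a" shows "E a p \<subseteq> E a b"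
proof (cases "p = b")
  case False
  note i = inner_Br[OF assms False]
  have "Br p a \<subseteq> Br b p" using Br_nested[of p a b] i assms False by auto
  then show ?thesis using i by (auto simp: E_def)
qed simp

text \<open>A point on neither side of \<open>p\<close> lies in a branch of \<open>p\<close> that
  avoids \<open>a\<close> and \<open>b\<close>. Conversely, \<open>Br_nested\<close> keeps every
  such branch between \<open>a\<close> and \<open>b\<close>.\<close>

lemma E_split:
  assumes "a \<in> T" "b \<in> T" "p \<in> seg a b" "p \<noteq> a" "p \<noteq> b"
  shows "E a b = E a p \<union> E p b \<union> \<Union> {B \<in> branches T p. a \<notin> B \<and> b \<notin> B} \<union> {p}"
    (is "_ = _ \<union> _ \<union> ?B \<union> _")
proof
  note i = inner_Br[OF assms]
  have ab: "a \<noteq> b" using assms by auto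
  have "p \<in> E a b" using seg_subset_E assms ab by auto
  moreover have "E p b \<subseteq> E a b"
    using E_mono[of b a p] assms seg_sym[of a b] by (auto simp: E_sym)
  moreover have "E a p \<subseteq> E a b" using E_mono assms by auto
  moreover have "B \<subseteq> E a b" if B: "B \<in> branches T p" "a \<notin> B" "b \<notin> B" for B
  proof -
    obtain d where d: "d \<in> T" "d \<noteq> p" "B = Br p d" using B(1) branches_eq[OF i(5)] by auto
    then have "Br p d \<subseteq> Br a p" "Br p d \<subseteq> Br b p"
      using Br_nested[of p d a] Br_nested[of p d b] B assms i by auto
    then show ?thesis using i d by (auto simp: E_def)
  qed
  ultimately show "E a p \<union> E p b \<union> ?B \<union> {p} \<subseteq> E a b" by auto
  show "E a b \<subseteq> E a p \<union> E p b \<union> ?B \<union> {p}"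
  proof
    fix x assume x: "x \<in> E a b"
    then have xT: "x \<in> T" using E_subset assms by auto
    show "x \<in> E a p \<union> E p b \<union> ?B \<union> {p}"
    proof (cases "x = p \<or> x \<in> Br p a \<or> x \<in> Br p b")
      case True
      then show ?thesis using x i unfolding E_def by auto
    next
      case False
      have "Br p x \<in> branches T p" using branches_eq i xT False by auto
      moreover have "a \<notin> Br p x" "b \<notin> Br p x"
        using False Br_eq[of p x a] Br_eq[of p x b] mem_Br[of x p] assms i xT by metis+
      ultimately show ?thesis using mem_Br[of x p] xT False by blast
    qed
  qed
qed

lemma branch_pointI:
  assumes "p \<in> T" "x \<in> T" "y \<in> T" "z \<in> T" "x \<noteq> p" "y \<noteq> p" "z \<noteq> p"
    "p \<in> seg x y" "p \<in> seg y z" "p \<in> seg x z"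
  shows "branch_point T p"
proof -
  have "x \<notin> Br p y" "y \<notin> Br p z" "x \<notin> Br p z" using assms notin_Br_iff by auto
  moreover have "x \<in> Br p x" "y \<in> Br p y" using assms by auto
  ultimately have "Br p x \<noteq> Br p y" "Br p y \<noteq> Br p z" "Br p x \<noteq> Br p z" by metis+
  then have "card {Br p x, Br p y, Br p z} = 3" by simp
  moreover have "{Br p x, Br p y, Br p z} \<subseteq> branches T p" using branches_eq assms by auto
  ultimately show ?thesis unfolding branch_point_def using assms(1) by blast
qed

text \<open>\<open>m\<close> is the median of \<open>x\<close>, \<open>a\<close> and
  \<open>b\<close>. These three points lie in different branches of \<open>m\<close>, which makes it
  a branch point of the arc from which \<open>x\<close> hangs off.\<close>

lemma projection:
  assumes ab: "a \<in> T" "b \<in> T" "a \<noteq> b" and x: "x \<in> E a b" "x \<notin> seg a b"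
  obtains m where "branch_point T m" "m \<in> seg a b" "m \<noteq> a" "m \<noteq> b" "x \<noteq> m"
    "a \<notin> Br m x" "b \<notin> Br m x"
proof -
  have xT: "x \<in> T" using x E_subset ab by auto
  obtain m where m: "m \<in> seg x a" "m \<in> seg a b" "m \<in> seg x b" using median[OF xT ab(1,2)] .
  have n: "x \<noteq> a" "x \<noteq> b" using x ends_in_seg ab by auto
  then have "a \<notin> seg x b" "b \<notin> seg x a" using x by (auto simp: E_def Br_def)
  then have ne: "m \<noteq> a" "m \<noteq> b" "x \<noteq> m" using m x by auto
  have mT: "m \<in> T" using m seg_subset ab by auto
  show thesis
  proof (rule that[of m])
    show "branch_point T m" using branch_pointI[of m x a b] m ne mT xT ab by auto
    show "a \<notin> Br m x" "b \<notin> Br m x"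
      using notin_Br_iff[of a m x] notin_Br_iff[of b m x] seg_sym m ne ab xT by auto
  qed (use m ne in auto)
qed

end

section \<open>Heights and nice arcs\<close>

lemma three_sorted:
  fixes d :: "'b \<Rightarrow> real"
  assumes "card X = 3"
  obtains x y z where "X = {x, y, z}" "x \<noteq> y" "y \<noteq> z" "x \<noteq> z" "d y \<le> d x" "d z \<le> d y"
proof -
  obtain x y z where X: "X = {x, y, z}" "x \<noteq> y" "y \<noteq> z" "x \<noteq> z"
    using assms card_3_iff[of X] by auto
  have perm: "X = {x, z, y}" "X = {y, x, z}" "X = {y, z, x}" "X = {z, x, y}" "X = {z, y, x}"
    using X by auto
  consider "d y \<le> d x" "d z \<le> d y" | "d z \<le> d x" "d y \<le> d z" | "d x \<le> d y" "d z \<le> d x" | "d z \<le> d y" "d x \<le> d z" | "d x \<le> d z" "d y \<le> d x" | "d y \<le> d z" "d x \<le> d y"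
    by linarith
  then show thesis
  proof cases
    case 1 show thesis by (rule that[OF X(1)]) (use X 1 in auto)
  next
    case 2 show thesis by (rule that[OF perm(1)]) (use X 2 in auto)
  next
    case 3 show thesis by (rule that[OF perm(2)]) (use X 3 in auto)
  next
    case 4 show thesis by (rule that[OF perm(3)]) (use X 4 in auto)
  next
    case 5 show thesis by (rule that[OF perm(4)]) (use X 5 in auto)
  next
    case 6 show thesis by (rule that[OF perm(5)]) (use X 6 in auto)
  qed
qed

lemma branch_labelling_three:
  assumes "card (branches T p) = 3"
  obtains B where "branch_labelling T p {1..3} B"
proof -
  obtain x y z where b: "branches T p = {x, y, z}" "x \<noteq> y" "y \<noteq> z" "x \<noteq> z"
      "diameter y \<le> diameter x" "diameter z \<le> diameter y"
    using three_sorted[OF assms, of diameter] by metis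
  define B where "B i = (if i = 1 then x else if i = 2 then y else z)" for i :: nat
  have s: "{1..3} = {1, 2, 3::nat}" by auto
  have "bij_betw B {1..3} (branches T p)"
    unfolding bij_betw_def s using b by (auto simp: B_def)
  moreover have "\<forall>i\<in>{1..3}. \<forall>j\<in>{1..3}. i \<le> j \<longrightarrow> diameter (B j) \<le> diameter (B i)"
    unfolding s using b by (auto simp: B_def)
  ultimately show thesis using that[of B] unfolding branch_labelling_def by blast
qed

text \<open>With three branches every labelling has index set \<open>{1..3}\<close>. The third
  largest diameter is therefore the smallest, and the description in \<open>height\<close> has a
  unique solution.\<close>

lemma height_eq_Min:
  assumes 3: "card (branches T p) = 3"
  shows "height T p = Min (diameter ` branches T p)"
proof -
  have *: "diameter (B 3) = Min (diameter ` branches T p)" if l: "branch_labelling T p I B" for I B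
  proof -
    have bij: "bij_betw B I (branches T p)" using l by (simp add: branch_labelling_def)
    then have I3: "card I = 3" using 3 bij_betw_same_card by fastforce
    then have fin: "finite I" by (metis card.infinite zero_neq_numeral)
    have "I = {1..} \<or> (\<exists>n. I = {1..n})" using l by (simp add: branch_labelling_def)
    moreover have "I \<noteq> {1..}" using fin infinite_Ici by metis
    ultimately have I: "I = {1..3}" using I3 by auto
    have im: "branches T p = B ` I" using bij by (auto simp: bij_betw_def)
    show ?thesis
    proof (rule Min_eqI[symmetric])
      show "finite (diameter ` branches T p)" using im fin by auto
      show "diameter (B 3) \<in> diameter ` branches T p" using im I by auto
      fix y assume "y \<in> diameter ` branches T p"
      then obtain i where "i \<in> I" "y = diameter (B i)" using im by auto
      then show "diameter (B 3) \<le> y" using l I unfolding branch_labelling_def by auto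
    qed
  qed
  obtain B where B: "branch_labelling T p {1..3} B" using branch_labelling_three[OF 3] .
  show ?thesis unfolding height_def
    by (rule the_equality) (use * B in metis)+
qed

text \<open>\<open>C\<close> serves for separation and density alike. \<open>M\<close> is the bound
  carried along by all tiles; \<open>M \<ge> 4 * C\<close> is what \<open>leaf_center\<close>
  requires, and the choice of the root tile later demands a further lower bound.\<close>

locale branching_tree = tree T K for T :: "'a::metric_space set" and K +
  fixes C M :: real
  assumes dbl: "doubling T" and triv: "trivalent T" and C: "C \<ge> 1" and M: "M \<ge> 4 * C"
    and sep: "\<lbrakk>branch_point T p; branch_point T q; p \<noteq> q\<rbrakk>
      \<Longrightarrow> min (height T p) (height T q) \<le> C * dist p q"
    and dense: "\<lbrakk>x \<in> T; y \<in> T; x \<noteq> y\<rbrakk>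
      \<Longrightarrow> \<exists>p\<in>tree_arc T x y. branch_point T p \<and> dist x y \<le> C * height T p"
begin

abbreviation "bp \<equiv> branch_point T"
abbreviation "H \<equiv> height T"

lemma M1: "M \<ge> 1" "M > 0" and C0: "C > 0" using M C by auto

lemma bp_mem: "bp p \<Longrightarrow> p \<in> T"
  by (simp add: branch_point_def)

lemma card_branches: "bp p \<Longrightarrow> card (branches T p) = 3"
  using triv by (simp add: trivalent_def)

lemma finite_branches: "bp p \<Longrightarrow> finite (branches T p)"
  using card_branches by (metis card.infinite zero_neq_numeral)

lemma branchE:
  assumes "bp p" "B \<in> branches T p"
  obtains d where "d \<in> T" "d \<noteq> p" "B = Br p d"
  using assms branches_eq[OF bp_mem[OF assms(1)]] by auto

lemma Br_branch: "\<lbrakk>bp p; d \<in> T; d \<noteq> p\<rbrakk> \<Longrightarrow> Br p d \<in> branches T p"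
  using branches_eq[OF bp_mem] by auto

lemma H_le: "\<lbrakk>bp p; B \<in> branches T p\<rbrakk> \<Longrightarrow> H p \<le> diameter B"
  using height_eq_Min[OF card_branches] finite_branches by (simp add: Min_le)

lemma H_attained: assumes "bp p" obtains B where "B \<in> branches T p" "H p = diameter B"
proof -
  have "Min (diameter ` branches T p) \<in> diameter ` branches T p"
    using finite_branches card_branches assms by (intro Min_in) force+
  then show thesis using that height_eq_Min[OF card_branches[OF assms]] by auto
qed

lemma diam_Br_pos: assumes "p \<in> T" "d \<in> T" "d \<noteq> p" shows "diameter (Br p d) > 0"
proof -
  have "dist p d \<le> diameter (Br p d)"
    by (rule diameter_bounded_bound) (use compact_imp_bounded compact_Br assms in auto)
  then show ?thesis using assms by (smt (verit) zero_less_dist_iff)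
qed

lemma H_pos: "bp p \<Longrightarrow> H p > 0"
  by (metis H_attained branchE bp_mem diam_Br_pos)

lemma bounded_T: "bounded T"
  using compact_T compact_imp_bounded by auto

lemma diam_mono: "\<lbrakk>A \<subseteq> B; B \<subseteq> T\<rbrakk> \<Longrightarrow> diameter A \<le> diameter B"
  by (intro diameter_subset bounded_subset[OF bounded_T])

lemma dist_le_diameter: "\<lbrakk>x \<in> A; y \<in> A; A \<subseteq> T\<rbrakk> \<Longrightarrow> dist x y \<le> diameter A"
  using diameter_bounded_bound[OF bounded_subset[OF bounded_T]] by auto

lemma other_branch:
  assumes "bp a" obtains d where "d \<in> T" "d \<noteq> a" "Br a d \<noteq> X"
proof -
  have "\<not> branches T a \<subseteq> {X}"
    using card_branches[OF assms] card_mono[of "{X}" "branches T a"] by auto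
  then show thesis using that branchE[OF assms] by blast
qed

lemma third_branch:
  assumes p: "bp p" and "a \<in> T" "b \<in> T" "a \<noteq> p" "b \<noteq> p" "Br p a \<noteq> Br p b"
  obtains d where "d \<in> T" "d \<noteq> p" "Br p d \<noteq> Br p a" "Br p d \<noteq> Br p b"
    "branches T p = {Br p a, Br p b, Br p d}"
proof -
  have sub: "{Br p a, Br p b} \<subseteq> branches T p" using Br_branch assms by auto
  have "card {Br p a, Br p b} = 2" using assms by simp
  then have "card (branches T p - {Br p a, Br p b}) = 1"
    using card_Diff_subset[OF _ sub] card_branches[OF p] by auto
  then obtain B where B: "branches T p - {Br p a, Br p b} = {B}" using card_1_singletonE by metis
  then have "B \<in> branches T p" "B \<noteq> Br p a" "B \<noteq> Br p b" by auto
  moreover have "branches T p = {Br p a, Br p b, B}" using B sub by auto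
  ultimately show thesis using that branchE[OF p, of B] by metis
qed

text \<open>A branch of \<open>a\<close> that misses \<open>r\<close> is contained in
  \<open>Br r a\<close>, and no branch of \<open>a\<close> has diameter below
  \<open>H a\<close>.\<close>

lemma H_le_Br:
  assumes "bp a" "r \<in> T" "r \<noteq> a" shows "H a \<le> diameter (Br r a)"
proof -
  obtain d where d: "d \<in> T" "d \<noteq> a" "Br a d \<noteq> Br a r" using other_branch[OF assms(1)] .
  then have "r \<notin> Br a d" using Br_eq[of a d r] assms bp_mem by auto
  then have "Br a d \<subseteq> Br r a" using Br_nested[of a d r] d assms bp_mem by auto
  then have "diameter (Br a d) \<le> diameter (Br r a)" using diam_mono Br_subset assms by auto
  then show ?thesis using H_le[of a "Br a d"] Br_branch d assms by force
qed

section \<open>Packing of high branch points\<close>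

lemma doubling_iterated:
  obtains N :: nat where "\<And>k x r. \<lbrakk>x \<in> T; r > 0\<rbrakk> \<Longrightarrow>
    \<exists>Z. finite Z \<and> card Z \<le> N ^ k \<and> T \<inter> ball x (2 ^ k * r) \<subseteq> (\<Union>c\<in>Z. ball c r)"
proof -
  obtain N where N: "\<And>x r. \<lbrakk>x \<in> T; r > 0\<rbrakk> \<Longrightarrow> \<exists>Z\<subseteq>T. finite Z \<and> card Z \<le> N \<and>
      T \<inter> ball x r \<subseteq> (\<Union>c\<in>Z. ball c (r / 2))"
    using dbl unfolding doubling_def by blast
  \<comment> \<open>The centres are kept in \<open>T\<close> during the induction, since the
    doubling condition speaks only of balls centred in \<open>T\<close>.\<close>
  have *: "\<exists>Z. Z \<subseteq> T \<and> finite Z \<and> card Z \<le> N ^ k \<and> T \<inter> ball x (2 ^ k * r) \<subseteq> (\<Union>c\<in>Z. ball c r)"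
    if x: "x \<in> T" and r: "r > 0" for k x r
    using x
  proof (induction k arbitrary: x)
    case 0
    then show ?case by (intro exI[of _ "{x}"]) auto
  next
    case (Suc k)
    obtain Z where Z: "Z \<subseteq> T" "finite Z" "card Z \<le> N"
        "T \<inter> ball x (2 ^ Suc k * r) \<subseteq> (\<Union>c\<in>Z. ball c (2 ^ k * r))"
      using N[of x "2 ^ Suc k * r"] Suc.prems r by auto
    have "\<forall>c\<in>Z. \<exists>Y. Y \<subseteq> T \<and> finite Y \<and> card Y \<le> N ^ k \<and> T \<inter> ball c (2 ^ k * r) \<subseteq> (\<Union>d\<in>Y. ball d r)"
      using Suc.IH Z by blast
    then obtain Y where Y: "\<And>c. c \<in> Z \<Longrightarrow> Y c \<subseteq> T \<and> finite (Y c) \<and> card (Y c) \<le> N ^ k \<and>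
        T \<inter> ball c (2 ^ k * r) \<subseteq> (\<Union>d\<in>Y c. ball d r)"
      by metis
    show ?case
    proof (intro exI conjI)
      show "(\<Union>c\<in>Z. Y c) \<subseteq> T" "finite (\<Union>c\<in>Z. Y c)" using Y Z by auto
      have "card (\<Union>c\<in>Z. Y c) \<le> (\<Sum>c\<in>Z. card (Y c))" using Z by (intro card_UN_le)
      also have "\<dots> \<le> card Z * N ^ k" using Y sum_bounded_above[of Z "\<lambda>c. card (Y c)" "N ^ k"] by simp
      also have "\<dots> \<le> N ^ Suc k" using Z by simp
      finally show "card (\<Union>c\<in>Z. Y c) \<le> N ^ Suc k" .
      show "T \<inter> ball x (2 ^ Suc k * r) \<subseteq> (\<Union>d\<in>(\<Union>c\<in>Z. Y c). ball d r)"
      proof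
        fix y assume y: "y \<in> T \<inter> ball x (2 ^ Suc k * r)"
        then obtain c where c: "c \<in> Z" "y \<in> T \<inter> ball c (2 ^ k * r)" using Z(4) by blast
        then show "y \<in> (\<Union>d\<in>(\<Union>c\<in>Z. Y c). ball d r)" using Y[OF c(1)] by blast
      qed
    qed
  qed
  show thesis by (rule that[of N]) (use * in meson)
qed

text \<open>Separation puts branch points of height at least \<open>\<delta>\<close> at mutual
  distance at least \<open>\<delta> / C\<close>, so a ball of radius
  \<open>\<delta> / (2 * C)\<close> contains at most one of them. The bound depends on the ratio
  \<open>Q\<close> but not on the scale \<open>\<delta>\<close>; this uniformity is used both for
  the number of cuts and for the decay of tiles.\<close>

lemma card_high_branch_points:
  obtains N :: nat where "\<And>V \<delta>. \<lbrakk>\<delta> > 0; \<And>v. v \<in> V \<Longrightarrow> bp v \<and> \<delta> \<le> H v;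
      \<And>v w. \<lbrakk>v \<in> V; w \<in> V\<rbrakk> \<Longrightarrow> dist v w \<le> Q * \<delta>\<rbrakk> \<Longrightarrow> finite V \<and> card V \<le> N"
proof -
  obtain N where N: "\<And>k x r. \<lbrakk>x \<in> T; r > 0\<rbrakk> \<Longrightarrow>
    \<exists>Z. finite Z \<and> card Z \<le> N ^ k \<and> T \<inter> ball x (2 ^ k * r) \<subseteq> (\<Union>c\<in>Z. ball c r)"
    using doubling_iterated by blast
  obtain k :: nat where k: "2 * C * Q < 2 ^ k" using real_arch_pow[of 2 "2 * C * Q"] by auto
  show thesis
  proof (rule that[of "N ^ k"])
    fix V \<delta>
    assume \<delta>: "\<delta> > (0::real)" and V: "\<And>v. v \<in> V \<Longrightarrow> bp v \<and> \<delta> \<le> H v"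
      and D: "\<And>v w. \<lbrakk>v \<in> V; w \<in> V\<rbrakk> \<Longrightarrow> dist v w \<le> Q * \<delta>"
    show "finite V \<and> card V \<le> N ^ k"
    proof (cases "V = {}")
      case False
      then obtain x where x: "x \<in> V" by auto
      define r where "r = \<delta> / (2 * C)"
      have r: "r > 0" unfolding r_def using \<delta> C0 by simp
      obtain Z where Z: "finite Z" "card Z \<le> N ^ k" "T \<inter> ball x (2 ^ k * r) \<subseteq> (\<Union>c\<in>Z. ball c r)"
        using N[of x r k] V x bp_mem r by auto
      have "\<forall>v\<in>V. \<exists>c. c \<in> Z \<and> dist c v < r"
      proof
        fix v assume v: "v \<in> V"
        have "Q * \<delta> < 2 ^ k * r" using k \<delta> C0 by (simp add: r_def field_simps)
        then have "v \<in> T \<inter> ball x (2 ^ k * r)" using D[OF x v] V[OF v] bp_mem by auto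
        then have "v \<in> (\<Union>c\<in>Z. ball c r)" using Z(3) by blast
        then show "\<exists>c. c \<in> Z \<and> dist c v < r" by auto
      qed
      then obtain f where f: "\<And>v. v \<in> V \<Longrightarrow> f v \<in> Z \<and> dist (f v) v < r" by metis
      have inj: "inj_on f V"
      proof (rule inj_onI, rule ccontr)
        fix v w assume vw: "v \<in> V" "w \<in> V" "f v = f w" "v \<noteq> w"
        have "dist v w \<le> dist (f v) v + dist (f v) w" by (rule dist_triangle3)
        also have "\<dots> < 2 * r" using f[OF vw(1)] f[OF vw(2)] vw by auto
        finally have "C * dist v w < \<delta>" using C0 by (simp add: r_def field_simps)
        moreover have "\<delta> \<le> C * dist v w" using sep[of v w] V[OF vw(1)] V[OF vw(2)] vw(4) by linarith
        ultimately show False by linarith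
      qed
      have "f ` V \<subseteq> Z" using f by auto
      then show ?thesis using inj Z by (meson card_inj_on_le finite_imageD finite_subset order_trans)
    qed simp
  qed
qed

lemma finite_high: assumes "\<delta> > 0" shows "finite {p. bp p \<and> \<delta> \<le> H p}"
proof -
  let ?Q = "diameter T / \<delta>"
  obtain N :: nat where N: "\<And>V \<delta>. \<lbrakk>\<delta> > 0; \<And>v. v \<in> V \<Longrightarrow> bp v \<and> \<delta> \<le> H v;
      \<And>v w. \<lbrakk>v \<in> V; w \<in> V\<rbrakk> \<Longrightarrow> dist v w \<le> ?Q * \<delta>\<rbrakk> \<Longrightarrow> finite V \<and> card V \<le> N"
    using card_high_branch_points[of ?Q] by blast
  have "dist v w \<le> ?Q * \<delta>" if "bp v" "bp w" for v w
    using dist_le_diameter[of v T w] bp_mem that assms by simp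
  then show ?thesis using N[of \<delta> "{p. bp p \<and> \<delta> \<le> H p}"] assms by blast
qed

text \<open>Density alone might return an endpoint. It is applied to a middle piece
  \<open>[u, v]\<close>, a third as long, which avoids both endpoints; hence the constant
  \<open>3 * C\<close>.\<close>

lemma inner_branch_point:
  assumes xy: "x \<in> T" "y \<in> T" "x \<noteq> y"
  obtains p where "bp p" "p \<in> seg x y" "p \<noteq> x" "p \<noteq> y" "dist x y \<le> 3 * C * H p"
proof -
  let ?d = "dist x y"
  have d: "?d > 0" using xy by simp
  obtain u where u: "u \<in> seg x y" "dist x u = ?d / 3"
    using seg_point_at[of x y "?d / 3"] xy by auto
  have uT: "u \<in> T" using u seg_subset xy by auto
  have uy: "dist u y \<ge> 2 * ?d / 3" using dist_triangle[of x y u] u by linarith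
  obtain v where v: "v \<in> seg u y" "dist u v = ?d / 3"
    using seg_point_at[of u y "?d / 3"] xy uT uy d by auto
  have vT: "v \<in> T" using v seg_subset uT xy by auto
  have xu: "x \<noteq> u" using u d by auto
  have sub: "seg u y \<subseteq> seg x y" "x \<notin> seg u y"
    using seg_split[OF xy(1,2) u(1)] ends_in_seg[OF xy(1) uT] xu by auto
  have "dist u v \<noteq> dist u y" using uy v(2) d by linarith
  then have "v \<noteq> y" by auto
  then have "y \<notin> seg u v"
    using seg_split[OF uT xy(2) v(1)] ends_in_seg[OF vT xy(2)] by auto
  moreover have "seg u v \<subseteq> seg u y" using seg_split[OF uT xy(2) v(1)] by auto
  moreover obtain p where p: "p \<in> seg u v" "bp p" "dist u v \<le> C * H p"
    using dense[OF uT vT] v d by force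
  ultimately show thesis using that[of p] sub v by force
qed

text \<open>The branches hanging off \<open>[a, b]\<close> are controlled by the heights of their base points, and these by
  the heights of \<open>a\<close> and \<open>b\<close>. Both bounds hold with the same \<open>M\<close> for the two pieces when
  \<open>[a, b]\<close> is cut at its highest branch point.\<close>

definition nice :: "'a \<Rightarrow> 'a \<Rightarrow> bool" where
  "nice a b \<longleftrightarrow> bp a \<and> bp b \<and> a \<noteq> b \<and>
    (\<forall>r. bp r \<and> r \<in> seg a b \<and> r \<noteq> a \<and> r \<noteq> b \<longrightarrow> H r \<le> M * H a \<and> H r \<le> M * H b \<and>
      (\<forall>B\<in>branches T r. a \<notin> B \<and> b \<notin> B \<longrightarrow> diameter B \<le> M * H r))"

lemma nice_sym: "nice a b \<Longrightarrow> nice b a"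
  unfolding nice_def using seg_sym[of a b] bp_mem by auto

lemma niceD:
  assumes "nice a b" shows "bp a" "bp b" "a \<noteq> b" "a \<in> T" "b \<in> T"
  using assms bp_mem by (auto simp: nice_def)

lemma nice_inner:
  assumes "nice a b" "bp r" "r \<in> seg a b" "r \<noteq> a" "r \<noteq> b"
  shows "H r \<le> M * H a" "H r \<le> M * H b"
    "\<And>B. \<lbrakk>B \<in> branches T r; a \<notin> B; b \<notin> B\<rbrakk> \<Longrightarrow> diameter B \<le> M * H r"
  using assms by (auto simp: nice_def)

text \<open>Density produces an inner branch point of height at least
  \<open>dist a b / (3 * C)\<close>, and niceness bounds this height by \<open>M * H a\<close>. So a
  low vertex cannot be the end of a long nice arc.\<close>

lemma nice_length: assumes "nice a b" shows "dist a b \<le> 3 * C * M * H a"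
proof -
  obtain p where p: "bp p" "p \<in> seg a b" "p \<noteq> a" "p \<noteq> b" "dist a b \<le> 3 * C * H p"
    using inner_branch_point[of a b] niceD[OF assms] by auto
  have "3 * C * H p \<le> 3 * C * (M * H a)"
    using nice_inner(1)[OF assms p(1-4)] C0 by (intro mult_left_mono) auto
  then show ?thesis using p by (simp add: mult_ac)
qed

text \<open>Separation controls only the smaller height. Niceness gives
  \<open>H p \<le> M * H a\<close>, so \<open>H p\<close> may replace that minimum at the cost of
  the factor \<open>M\<close>.\<close>

lemma nice_height_le: assumes "nice a b" "bp p" "p \<in> seg a b" "p \<noteq> a" "p \<noteq> b"
  shows "H p \<le> C * M * dist a p"
proof -
  have "H p \<le> M * min (H p) (H a)"
    using nice_inner(1)[OF assms] M1 H_pos[OF assms(2)] mult_right_mono[of 1 M "H p"]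
    by (auto simp: min_def)
  also have "\<dots> \<le> M * (C * dist a p)"
    using sep[of a p] niceD[OF assms(1)] assms M1 by (intro mult_left_mono) (auto simp: min.commute)
  finally show ?thesis by (simp add: mult_ac)
qed

text \<open>If \<open>p\<close> is the highest branch point inside \<open>[a, b]\<close>, then \<open>|a - b| \<le> 3 C H(p)\<close> by density and
  \<open>H(p) \<le> C M |a - p|\<close> by separation.\<close>

definition c :: real where "c = 1 / (3 * C\<^sup>2 * M)"

lemma c_pos: "c > 0" and c_le: "c \<le> 1 / 3"
proof -
  show "c > 0" using C0 M1 by (simp add: c_def)
  have "1 * 1 \<le> C\<^sup>2 * M" using C M1 by (intro mult_mono) auto
  then show "c \<le> 1 / 3" using C0 M1 by (simp add: c_def field_simps)
qed

text \<open>At the new end \<open>p\<close> the height bound holds even with factor 1, by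
  maximality. A branch at an inner \<open>r\<close> avoiding \<open>a\<close> and \<open>p\<close>
  also avoids \<open>b\<close>: otherwise \<open>r\<close> would lie on \<open>[p, b]\<close> as
  well as on \<open>[a, p]\<close>, and these meet only in \<open>p\<close>. So the bounds at
  \<open>[a, b]\<close> carry over with the same \<open>M\<close>.\<close>

lemma nice_subset:
  assumes ab: "nice a b" and p: "bp p" "p \<in> seg a b" "p \<noteq> a" "p \<noteq> b"
    and max: "\<And>r. \<lbrakk>bp r; r \<in> seg a p; r \<noteq> a; r \<noteq> p\<rbrakk> \<Longrightarrow> H r \<le> H p"
  shows "nice a p"
  unfolding nice_def
proof (intro conjI allI impI ballI)
  note T = niceD[OF ab]
  have sub: "seg a p \<subseteq> seg a b" "b \<notin> seg a p"
    using seg_split[OF T(4,5) p(2)] ends_in_seg[OF bp_mem[OF p(1)] T(5)] p(4) by auto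
  fix r assume r: "bp r \<and> r \<in> seg a p \<and> r \<noteq> a \<and> r \<noteq> p"
  then have r': "bp r" "r \<in> seg a b" "r \<noteq> a" "r \<noteq> b" using sub by auto
  show "H r \<le> M * H a" using nice_inner(1)[OF ab r'] .
  have "H r \<le> H p" using max r by auto
  also have "\<dots> \<le> M * H p" using M1 H_pos[OF p(1)] by simp
  finally show "H r \<le> M * H p" .
  fix B assume B: "B \<in> branches T r" "a \<notin> B \<and> p \<notin> B"
  have "b \<notin> B"
  proof
    assume b: "b \<in> B"
    obtain d where d: "d \<in> T" "d \<noteq> r" "B = Br r d" using branchE[OF r'(1) B(1)] .
    have "r \<in> seg b p"
      using seg_through[of r d b p] bp_mem[OF r'(1)] bp_mem[OF p(1)] d b B by auto
    then have "r \<in> seg a p \<inter> seg p b" using r seg_sym[of b p] T bp_mem[OF p(1)] by auto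
    then show False using seg_split(2)[OF T(4,5) p(2)] r by auto
  qed
  then show "diameter B \<le> M * H r" using nice_inner(3)[OF ab r' B(1)] B by auto
qed (use p niceD[OF ab] in auto)

text \<open>A highest inner branch point exists because only finitely many reach the height of the
  one supplied by density. Its maximality holds on both sub-arcs, so \<open>nice_subset\<close>
  applies to each of them.\<close>

lemma nice_split:
  assumes ab: "nice a b"
  obtains p where "bp p" "p \<in> seg a b" "p \<noteq> a" "p \<noteq> b" "nice a p" "nice p b"
    "c * dist a b \<le> dist a p" "c * dist a b \<le> dist p b" "dist a b \<le> 3 * C * H p"
proof -
  note T = niceD[OF ab]
  obtain q where q: "bp q" "q \<in> seg a b" "q \<noteq> a" "q \<noteq> b" "dist a b \<le> 3 * C * H q"
    using inner_branch_point[of a b] T by auto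
  define V where "V = {p. bp p \<and> p \<in> seg a b \<and> p \<noteq> a \<and> p \<noteq> b \<and> H q \<le> H p}"
  have "finite V" unfolding V_def by (rule finite_subset[OF _ finite_high[OF H_pos[OF q(1)]]]) auto
  moreover have qV: "q \<in> V" unfolding V_def using q by auto
  ultimately obtain p where p: "p \<in> V" "\<And>r. r \<in> V \<Longrightarrow> H r \<le> H p"
    using obtains_MAX[of V H] by (metis Max_ge empty_iff finite_imageI imageI)
  have p': "bp p" "p \<in> seg a b" "p \<noteq> a" "p \<noteq> b" "H q \<le> H p" using p(1) by (auto simp: V_def)
  have max: "H r \<le> H p" if "bp r" "r \<in> seg a b" "r \<noteq> a" "r \<noteq> b" for r
    using p(2)[of r] that p'(5) unfolding V_def by force
  note pT = bp_mem[OF p'(1)]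
  have sub: "seg a p \<subseteq> seg a b" "seg p b \<subseteq> seg a b" "b \<notin> seg a p" "a \<notin> seg p b"
    using seg_split[OF T(4,5) p'(2)] ends_in_seg[OF pT T(5)] ends_in_seg[OF T(4) pT] p' by auto
  have "nice a p" using nice_subset[OF ab p'(1-4)] max sub by blast
  have ba: "seg b a = seg a b" "seg b p = seg p b" using seg_sym T pT by auto
  have "nice b p" using nice_subset[OF nice_sym[OF ab] p'(1) _ p'(4,3)] max sub ba p'(2) by blast
  have dp: "dist a b \<le> 3 * C * H p"
    using q(5) mult_left_mono[OF p'(5), of "3 * C"] C0 by linarith
  have key: "c * dist a b \<le> d" if "H p \<le> C * M * d" for d
  proof -
    have "dist a b \<le> 3 * C * (C * M * d)"
      using dp mult_left_mono[OF that, of "3 * C"] C0 by linarith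
    then show ?thesis using C0 M1 by (simp add: c_def field_simps power2_eq_square)
  qed
  show thesis
  proof (rule that[of p])
    show "c * dist a b \<le> dist a p" using key nice_height_le[OF ab p'(1-4)] .
    show "c * dist a b \<le> dist p b"
      using key nice_height_le[OF nice_sym[OF ab] p'(1) _ p'(4,3)] ba p'(2) by (simp add: dist_commute)
  qed (use p' dp \<open>nice a p\<close> nice_sym[OF \<open>nice b p\<close>] in auto)
qed

text \<open>\<open>K\<close> accounts for the arc itself, and each of the two points realizing the
  diameter of \<open>E a b\<close> adds the bound of \<open>E_projection_close\<close>.\<close>

definition L :: real where "L = K + 2 * C * M\<^sup>2"

lemma L1: "L \<ge> 1"
  unfolding L_def using K C0 by (simp add: add_increasing2)

text \<open>A point off the arc lies in a branch hanging at some \<open>m\<close>, of diameter at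
  most \<open>M * H m\<close>. Niceness bounds \<open>H m\<close> by \<open>M\<close> times the
  smaller height of the ends, and separation bounds the latter by
  \<open>C * dist a b\<close>.\<close>

lemma E_projection_close:
  assumes ab: "nice a b" and x: "x \<in> E a b"
  obtains m where "m \<in> seg a b" "dist x m \<le> C * M\<^sup>2 * dist a b"
proof (cases "x \<in> seg a b")
  case True
  then show thesis using that[of x] C0 M1 by simp
next
  case False
  note T = niceD[OF ab]
  obtain m where m: "bp m" "m \<in> seg a b" "m \<noteq> a" "m \<noteq> b" "x \<noteq> m" "a \<notin> Br m x" "b \<notin> Br m x"
    using projection[OF T(4,5,3) x False] by metis
  have xT: "x \<in> T" using E_subset T x by auto
  have "dist x m \<le> diameter (Br m x)"
    using dist_le_diameter Br_subset bp_mem m xT by simp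
  also have "\<dots> \<le> M * H m" using nice_inner(3)[OF ab m(1-4)] Br_branch m xT by auto
  also have "\<dots> \<le> M * (M * (C * dist a b))"
  proof -
    have "H m \<le> M * min (H a) (H b)" using nice_inner[OF ab m(1-4)] by (auto simp: min_def)
    also have "\<dots> \<le> M * (C * dist a b)" using sep[OF T(1-3)] M1 by (intro mult_left_mono) auto
    finally show ?thesis using M1 by (intro mult_left_mono) auto
  qed
  finally show thesis using that[of m] m by (simp add: power2_eq_square mult_ac)
qed

lemma diam_E: assumes ab: "nice a b" shows "diameter (E a b) \<le> L * dist a b"
proof -
  note T = niceD[OF ab]
  have ne: "E a b \<noteq> {}" using seg_subset_E[OF T(4,5,3)] ends_in_seg T by blast
  obtain x y where xy: "x \<in> E a b" "y \<in> E a b" "dist x y = diameter (E a b)"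
    using diameter_compact_attained[OF compact_E[OF T(4,5,3)] ne] by auto
  obtain m where m: "m \<in> seg a b" "dist x m \<le> C * M\<^sup>2 * dist a b" using E_projection_close[OF ab xy(1)] .
  obtain n where n: "n \<in> seg a b" "dist y n \<le> C * M\<^sup>2 * dist a b" using E_projection_close[OF ab xy(2)] .
  have "dist m n \<le> K * dist a b" using dist_in_seg T m n by auto
  moreover have "dist x y \<le> dist x m + dist m n + dist y n"
    using dist_triangle[of x y m] dist_triangle2[of m y n] by linarith
  ultimately have "dist x y \<le> L * dist a b"
    unfolding L_def using m n by (simp add: algebra_simps)
  then show ?thesis using xy by simp
qed

text \<open>Go from \<open>a\<close> towards a point \<open>b\<close> of the branch at distance at
  least half its diameter, and apply density to the far part \<open>[u, b]\<close>. The point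
  \<open>c\<close> found there satisfies \<open>diameter (Br a x) \<le> 2 * dist a b \<le> 4 * dist
  u b \<le> 4 * C * H c\<close>, which explains \<open>M \<ge> 4 * C\<close>.\<close>

lemma leaf_center:
  assumes a: "bp a" and x: "x \<in> T" "x \<noteq> a" and D: "diameter (Br a x) \<le> M * H a"
  obtains c where "c \<in> Br a x" "nice a c" "diameter (Br a x) \<le> M * H c"
    "diameter (Br a x) \<le> C * M * dist a c"
    "\<And>B. \<lbrakk>B \<in> branches T c; a \<notin> B\<rbrakk> \<Longrightarrow> B \<subseteq> Br a x"
proof -
  let ?D = "diameter (Br a x)"
  have aT: "a \<in> T" using a bp_mem by auto
  have BT: "Br a x \<subseteq> T" using Br_subset aT by auto
  have Dpos: "?D > 0" using diam_Br_pos aT x by auto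
  obtain b where b: "b \<in> Br a x" "?D \<le> 2 * dist a b"
    using compact_diameter_le_twice_dist[of "Br a x" a] compact_Br aT x by auto
  have bT: "b \<in> T" and ab: "b \<noteq> a" using b BT Dpos by auto
  obtain u where u: "u \<in> seg a b" "dist a u = dist a b / 2"
    using seg_point_at[of a b "dist a b / 2"] aT bT by auto
  have uT: "u \<in> T" using u seg_subset aT bT by auto
  have ub: "dist u b \<ge> dist a b / 2" using dist_triangle[of a b u] u by linarith
  then have "u \<noteq> b" using ab by auto
  then obtain c where c: "c \<in> seg u b" "bp c" "dist u b \<le> C * H c" using dense[OF uT bT] by blast
  have "a \<noteq> u" using u ab by auto
  then have cs: "c \<in> seg a b" "c \<noteq> a"
    using seg_split[OF aT bT u(1)] ends_in_seg[OF aT uT] c by auto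
  have "seg a b \<subseteq> Br a x" using Br_convex[of a x a b] aT x b by auto
  then have cB: "c \<in> Br a x" using cs by auto
  have cT: "c \<in> T" using c bp_mem by auto
  have Bc: "Br a c = Br a x" using Br_eq[of a x c] aT x cB cs by auto
  have "4 * C * H c \<le> M * H c" using M H_pos[OF c(2)] by (intro mult_right_mono) auto
  then have DH: "?D \<le> M * H c" using b ub c(3) by linarith
  have dac: "?D \<le> C * M * dist a c"
  proof -
    have "?D \<le> M * min (H a) (H c)" using D DH by (auto simp: min_def)
    also have "\<dots> \<le> M * (C * dist a c)" using sep[OF a c(2)] cs M1 by (intro mult_left_mono) auto
    finally show ?thesis by (simp add: mult_ac)
  qed
  have sub: "B \<subseteq> Br a x" if B: "bp r" "r \<in> Br a x" "r \<noteq> a" "B \<in> branches T r" "a \<notin> B" for r B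
  proof -
    obtain d where d: "d \<in> T" "d \<noteq> r" "B = Br r d" using branchE[OF B(1,4)] .
    have "B \<subseteq> Br a r" using Br_nested[of r d a] d B aT bp_mem[OF B(1)] by auto
    then show ?thesis using Br_eq[of a x r] aT x B by auto
  qed
  have "nice a c"
    unfolding nice_def
  proof (intro conjI allI impI ballI)
    fix r assume r: "bp r \<and> r \<in> seg a c \<and> r \<noteq> a \<and> r \<noteq> c"
    then have rr: "bp r" "r \<in> seg a c" "r \<noteq> a" "r \<noteq> c" by auto
    have rT: "r \<in> T" using rr bp_mem by auto
    have "seg a c \<subseteq> Br a x" using Br_convex[of a x a c] aT x cB by auto
    then have rB: "r \<in> Br a x" using rr by auto
    note i = inner_Br[OF aT cT rr(2-4)]
    have "Br r c \<subseteq> Br a x" using sub[OF rr(1) rB rr(3)] Br_branch[OF rr(1) cT] i rr by auto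
    then have "diameter (Br r c) \<le> ?D" using diam_mono BT by auto
    then have Hr: "H r \<le> ?D" using H_le[OF rr(1) Br_branch[OF rr(1) cT]] rr by force
    then show "H r \<le> M * H a" "H r \<le> M * H c" using D DH by auto
    fix B assume B: "B \<in> branches T r" "a \<notin> B \<and> c \<notin> B"
    have "B \<subseteq> Br a x" using sub rr rB B by auto
    then have BD: "diameter B \<le> ?D" using diam_mono BT by auto
    have "Br r a \<noteq> Br r c" using i mem_Br[of c r] cT rr by metis
    then obtain d where d: "d \<in> T" "d \<noteq> r" "Br r d \<noteq> Br r a" "Br r d \<noteq> Br r c"
        "branches T r = {Br r a, Br r c, Br r d}"
      using third_branch[OF rr(1) aT cT] rr by metis
    have "B \<noteq> Br r a" "B \<noteq> Br r c" using B mem_Br[of a r] mem_Br[of c r] aT cT rr by metis+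
    then have Bd: "B = Br r d" using B d by auto
    \<comment> \<open>One of the three branches realizes \<open>H r\<close>. If it points towards
      \<open>a\<close> or \<open>c\<close>, \<open>H_le_Br\<close> gives
      \<open>H a \<le> H r\<close> or \<open>H c \<le> H r\<close>, and either height bounds the
      whole of \<open>Br a x\<close> up to the factor \<open>M\<close>.\<close>
    obtain B' where B': "B' \<in> branches T r" "H r = diameter B'" using H_attained[OF rr(1)] .
    then consider "B' = Br r a" | "B' = Br r c" | "B' = B" using d Bd by auto
    then show "diameter B \<le> M * H r"
    proof cases
      case 1
      then have "M * H a \<le> M * H r" using H_le_Br[OF a rT] rr B' M1 by (intro mult_left_mono) auto
      then show ?thesis using BD D by linarith
    next
      case 2
      then have "M * H c \<le> M * H r" using H_le_Br[OF c(2) rT] rr B' M1 by (intro mult_left_mono) auto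
      then show ?thesis using BD DH by linarith
    next
      case 3
      then show ?thesis using B' M1 H_pos[OF rr(1)] by simp
    qed
  qed (use a c cs in auto)
  then show thesis
    using that[of c] cB DH dac sub[OF c(2) cB cs(2)] by blast
qed

end

section \<open>Subdividing nice arcs\<close>

context branching_tree
begin

text \<open>The order of the points along the arc is encoded as betweenness of all index triples, a
  form that passes directly to parts, reversals and concatenations. \<open>n\<close> counts pieces,
  and \<open>e\<close> bounds their lengths from below.\<close>

definition cuts :: "nat \<Rightarrow> real \<Rightarrow> 'a \<Rightarrow> 'a \<Rightarrow> (nat \<Rightarrow> 'a) \<Rightarrow> bool" where
  "cuts n e a b P \<longleftrightarrow> P 0 = a \<and> P n = b \<and>
    (\<forall>i<n. nice (P i) (P (Suc i)) \<and> e \<le> dist (P i) (P (Suc i))) \<and>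
    (\<forall>i j k. i \<le> j \<and> j \<le> k \<and> k \<le> n \<longrightarrow> P j \<in> seg (P i) (P k))"

lemma cutsD:
  assumes "cuts n e a b P"
  shows "P 0 = a" "P n = b" "\<And>i. i < n \<Longrightarrow> nice (P i) (P (Suc i))"
    "\<And>i. i < n \<Longrightarrow> e \<le> dist (P i) (P (Suc i))"
    "\<And>i j k. \<lbrakk>i \<le> j; j \<le> k; k \<le> n\<rbrakk> \<Longrightarrow> P j \<in> seg (P i) (P k)"
  using assms by (auto simp: cuts_def)

lemma cuts_mem: assumes "cuts n e a b P" "n > 0" "i \<le> n" shows "P i \<in> T"
proof (cases "i = n")
  case True
  then have "nice (P (n - 1)) (P (Suc (n - 1)))" using cutsD(3)[OF assms(1), of "n - 1"] assms by simp
  then show ?thesis using niceD assms True by fastforce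
next
  case False
  then show ?thesis using cutsD(3)[OF assms(1), of i] niceD assms by auto
qed

lemma cuts_weaken: "\<lbrakk>cuts n e a b P; e' \<le> e\<rbrakk> \<Longrightarrow> cuts n e' a b P"
  unfolding cuts_def by (meson order_trans)

lemma cuts_single:
  assumes "nice a b" "e \<le> dist a b" shows "cuts 1 e a b (\<lambda>i. if i = 0 then a else b)"
  unfolding cuts_def using assms niceD[OF assms(1)] ends_in_seg[of a b] by auto

lemma cuts_part: assumes "cuts n e a b P" "i \<le> j" "j \<le> n" shows "cuts (j - i) e (P i) (P j) (\<lambda>k. P (i + k))"
  unfolding cuts_def using cutsD[OF assms(1)] assms(2,3) by auto

lemma cuts_rev: assumes P: "cuts n e a b P" "n > 0" shows "cuts n e b a (\<lambda>i. P (n - i))"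
  unfolding cuts_def
proof (intro conjI allI impI)
  fix i assume i: "i < n"
  then have s: "n - i = Suc (n - Suc i)" by simp
  show "nice (P (n - i)) (P (n - Suc i))"
    unfolding s by (rule nice_sym) (use cutsD(3)[OF P(1)] i in auto)
  show "e \<le> dist (P (n - i)) (P (n - Suc i))"
    unfolding s using cutsD(4)[OF P(1), of "n - Suc i"] i by (simp add: dist_commute)
next
  fix i j k assume "i \<le> j \<and> j \<le> k \<and> k \<le> n"
  then have "P (n - j) \<in> seg (P (n - k)) (P (n - i))" by (intro cutsD(5)[OF P(1)]) auto
  moreover have "seg (P (n - k)) (P (n - i)) = seg (P (n - i)) (P (n - k))"
    by (intro seg_sym cuts_mem[OF P]) auto
  ultimately show "P (n - j) \<in> seg (P (n - i)) (P (n - k))" by simp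
qed (use cutsD(1,2)[OF P(1)] in auto)

lemma cuts_glue:
  assumes P: "cuts n e a p P" "n > 0" and Q: "cuts m e p b Q" "m > 0" and p: "p \<in> seg a b"
  shows "cuts (n + m) e a b (\<lambda>i. if i \<le> n then P i else Q (i - n))" (is "cuts _ _ _ _ ?R")
  unfolding cuts_def
proof (intro conjI allI impI)
  note PT = cuts_mem[OF P] and QT = cuts_mem[OF Q]
  have T: "a \<in> T" "b \<in> T" "p \<in> T" using PT[of 0] QT[of m] PT[of n] cutsD(1,2)[OF P(1)] cutsD(2)[OF Q(1)] by auto
  show "?R 0 = a" using cutsD(1)[OF P(1)] by simp
  show "?R (n + m) = b" using cutsD(2)[OF Q(1)] Q(2) by simp
  fix i
  have R2: "?R i = Q (i - n)" if "i \<ge> n" for i using that cutsD(2)[OF P(1)] cutsD(1)[OF Q(1)] by auto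
  {
    assume i: "i < n + m"
    have "nice (?R i) (?R (Suc i)) \<and> e \<le> dist (?R i) (?R (Suc i))"
    proof (cases "i < n")
      case True
      then show ?thesis using cutsD(3,4)[OF P(1), of i] by simp
    next
      case False
      then have "?R i = Q (i - n)" "?R (Suc i) = Q (Suc (i - n))" using R2[of i] R2[of "Suc i"] Suc_diff_le by auto
      then show ?thesis using cutsD(3,4)[OF Q(1), of "i - n"] False i by simp
    qed
    then show "nice (?R i) (?R (Suc i))" "e \<le> dist (?R i) (?R (Suc i))" by auto
  }
  fix j k assume ijk: "i \<le> j \<and> j \<le> k \<and> k \<le> n + m"
  consider "k \<le> n" | "i \<ge> n" | "i < n" "n < k" by linarith
  then show "?R j \<in> seg (?R i) (?R k)"
  proof cases
    case 1
    then show ?thesis using ijk cutsD(5)[OF P(1), of i j k] by auto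
  next
    case 2
    then show ?thesis using ijk cutsD(5)[OF Q(1), of "i - n" "j - n" "k - n"] R2[of i] R2[of j] R2[of k] by auto
  next
    case 3
    have x: "?R i \<in> seg a p" "?R i \<in> T"
      using 3 cutsD(1,2)[OF P(1)] cutsD(5)[OF P(1), of 0 i n] PT[of i] by auto
    have y: "?R k \<in> seg p b" "?R k \<in> T"
      using 3 ijk cutsD(1,2)[OF Q(1)] cutsD(5)[OF Q(1), of 0 "k - n" m] QT[of "k - n"] by auto
    have s1: "seg (?R i) p \<subseteq> seg a p" using seg_split(1)[OF T(1,3) x(1)] by blast
    have s2: "seg p (?R k) \<subseteq> seg p b" using seg_split(1)[OF T(3,2) y(1)] by blast
    have "seg (?R i) p \<inter> seg p (?R k) \<subseteq> {p}" using s1 s2 seg_split(2)[OF T(1,2) p] by blast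
    then have un: "seg (?R i) (?R k) = seg (?R i) p \<union> seg p (?R k)"
      using x y T by (intro seg_join) auto
    show ?thesis
    proof (cases "j \<le> n")
      case True
      then have "?R j \<in> seg (?R i) p" using 3 ijk cutsD(5)[OF P(1), of i j n] cutsD(2)[OF P(1)] by auto
      then show ?thesis using un by blast
    next
      case False
      then have "?R j \<in> seg p (?R k)"
        using 3 ijk cutsD(5)[OF Q(1), of 0 "j - n" "k - n"] cutsD(1)[OF Q(1)] by auto
      then show ?thesis using un by blast
    qed
  qed
qed

text \<open>Always split the first piece again. Each split keeps at least the share \<open>c\<close>
  on both sides, so the shortest piece after \<open>n\<close> splits has at least the share
  \<open>c ^ n\<close>. This uses up any prescribed number of cuts.\<close>

lemma cuts_pad:
  assumes "nice a b" shows "\<exists>P. cuts (Suc n) (c ^ n * dist a b) a b P"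
  using assms
proof (induction n arbitrary: b)
  case 0
  then show ?case using cuts_single[of a b "dist a b"] by auto
next
  case (Suc n)
  obtain p where p: "bp p" "p \<in> seg a b" "p \<noteq> a" "p \<noteq> b" "nice a p" "nice p b"
      "c * dist a b \<le> dist a p" "c * dist a b \<le> dist p b"
    using nice_split[OF Suc.prems] by metis
  obtain P where P: "cuts (Suc n) (c ^ n * dist a p) a p P" using Suc.IH[OF p(5)] by blast
  have "c ^ Suc n * dist a b \<le> c ^ n * dist a p"
    using mult_left_mono[OF p(7), of "c ^ n"] c_pos by (simp add: mult_ac)
  then have 1: "cuts (Suc n) (c ^ Suc n * dist a b) a p P" by (rule cuts_weaken[OF P])
  have "c ^ n \<le> 1" using c_pos c_le by (intro power_le_one) auto
  then have "c ^ Suc n * dist a b \<le> c * dist a b"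
    using c_pos mult_right_mono[of "c ^ n" 1 "c * dist a b"] by (simp add: mult_ac)
  then have "cuts 1 (c ^ Suc n * dist a b) p b (\<lambda>i. if i = 0 then p else b)"
    using p by (intro cuts_single) auto
  then show ?case using cuts_glue[OF 1 _ _ _ p(2)] by fastforce
qed

section \<open>Cutting towards one end\<close>

text \<open>The threshold is the height that \<open>nice_split\<close> guarantees for the cut point
  of an arc longer than \<open>\<tau>\<close>. So each cut of such an arc consumes one element of
  this set.\<close>

definition high :: "real \<Rightarrow> 'a \<Rightarrow> 'a \<Rightarrow> 'a set" where
  "high \<tau> a b = {v. bp v \<and> v \<in> seg a b \<and> v \<noteq> a \<and> v \<noteq> b \<and> \<tau> / (3 * C) \<le> H v}"

text \<open>The first piece gets the target length \<open>\<tau>\<close> up to \<open>c\<close>.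
  \<open>2 \<le> n\<close> makes \<open>P (n - 1)\<close> an inner vertex, and the last clause keeps
  the final piece long, so that the other end can be treated inside it.\<close>

definition towards :: "nat \<Rightarrow> real \<Rightarrow> 'a \<Rightarrow> 'a \<Rightarrow> bool" where
  "towards N \<tau> a b \<longleftrightarrow> (\<exists>n P. 2 \<le> n \<and> n \<le> Suc N \<and> cuts n (c * \<tau>) a b P \<and>
    c * \<tau> \<le> dist a (P 1) \<and> dist a (P 1) \<le> \<tau> \<and> c * dist a b \<le> dist (P (n - 1)) b)"

text \<open>Cut at the point \<open>p\<close> of \<open>nice_split\<close>. If \<open>[a, p]\<close>
  is short enough it is also long enough, having at least the share \<open>c\<close> of an arc
  longer than \<open>\<tau>\<close>. Otherwise continue in \<open>[a, p]\<close>, where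
  \<open>p\<close> is no longer an inner point, so \<open>high\<close> has lost an element.\<close>

lemma cuts_towards:
  assumes "nice a b" "0 < \<tau>" "\<tau> < dist a b"
    and "finite (high \<tau> a b)" and "card (high \<tau> a b) \<le> N"
  shows "towards N \<tau> a b"
  using assms
proof (induction N arbitrary: b)
  case 0
  obtain p where p: "bp p" "p \<in> seg a b" "p \<noteq> a" "p \<noteq> b" "dist a b \<le> 3 * C * H p"
    using nice_split[OF 0(1)] by metis
  have "\<tau> / (3 * C) \<le> H p" using 0 p C0 by (simp add: field_simps)
  then have "p \<in> high \<tau> a b" using p by (simp add: high_def)
  then show ?case using 0 by auto
next
  case (Suc N)
  note ab = \<open>nice a b\<close> and \<tau> = \<open>0 < \<tau>\<close> \<open>\<tau> < dist a b\<close>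
  obtain p where p: "bp p" "p \<in> seg a b" "p \<noteq> a" "p \<noteq> b" "nice a p" "nice p b"
      "c * dist a b \<le> dist a p" "c * dist a b \<le> dist p b" "dist a b \<le> 3 * C * H p"
    using nice_split[OF ab] by metis
  note T = niceD[OF ab] and pT = bp_mem[OF p(1)]
  have "c * \<tau> \<le> c * dist a b" using \<tau> c_pos by simp
  then have gap: "c * \<tau> \<le> dist a p" "c * \<tau> \<le> dist p b" using p by auto
  have last: "cuts 1 (c * \<tau>) p b (\<lambda>i. if i = 0 then p else b)" using cuts_single[OF p(6)] gap by simp
  show ?case
  proof (cases "dist a p \<le> \<tau>")
    case True
    have "cuts 1 (c * \<tau>) a p (\<lambda>i. if i = 0 then a else p)" using cuts_single[OF p(5)] gap by simp
    from cuts_glue[OF this _ last _ p(2)]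
    obtain P where "cuts 2 (c * \<tau>) a b P" "P 1 = p" by (auto simp: numeral_2_eq_2)
    then show ?thesis unfolding towards_def using True gap p by (intro exI[of _ 2] exI[of _ P]) auto
  next
    case False
    have sub: "seg a p \<subseteq> seg a b" "b \<notin> seg a p"
      using seg_split[OF T(4,5) p(2)] ends_in_seg[OF pT T(5)] p by auto
    have "\<tau> / (3 * C) \<le> H p" using \<tau> p C0 by (simp add: field_simps)
    then have "high \<tau> a p \<subseteq> high \<tau> a b - {p}" "p \<in> high \<tau> a b" using sub p by (auto simp: high_def)
    moreover have fin: "finite (high \<tau> a b)" "card (high \<tau> a b) \<le> Suc N" using Suc.prems by auto
    ultimately have "finite (high \<tau> a p)" "card (high \<tau> a p) \<le> N"
      using card_mono[of "high \<tau> a b - {p}" "high \<tau> a p"] finite_subset[of "high \<tau> a p" "high \<tau> a b - {p}"] by auto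
    then obtain n P where n: "2 \<le> n" "n \<le> Suc N" "cuts n (c * \<tau>) a p P" "c * \<tau> \<le> dist a (P 1)" "dist a (P 1) \<le> \<tau>"
      using Suc.IH[OF p(5) \<tau>(1)] False unfolding towards_def by auto
    have "cuts (n + 1) (c * \<tau>) a b (\<lambda>i. if i \<le> n then P i else if i - n = 0 then p else b)"
      (is "cuts _ _ _ _ ?R")
      using cuts_glue[OF n(3) _ last _ p(2)] n(1) by auto
    moreover have "?R 1 = P 1" "?R (n + 1 - 1) = p" using n cutsD(2)[OF n(3)] by auto
    ultimately show ?thesis unfolding towards_def using n p by (intro exI[of _ "n + 1"] exI[of _ ?R]) auto
  qed
qed

text \<open>If \<open>\<tau>\<close> is at least a fixed share of the length, the points of
  \<open>high\<close> have mutual distances bounded by a fixed multiple of their height threshold,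
  and \<open>card_high_branch_points\<close> bounds their number uniformly.\<close>

lemma cuts_towards_uniform:
  assumes "\<kappa> > 0"
  shows "\<exists>N. \<forall>a b \<tau>. nice a b \<and> 0 < \<tau> \<and> \<tau> < dist a b \<and> \<kappa> * dist a b \<le> \<tau> \<longrightarrow>
    towards N \<tau> a b"
proof -
  let ?Q = "3 * C * K / \<kappa>"
  obtain N :: nat where N: "\<And>V \<delta>. \<lbrakk>\<delta> > 0; \<And>v. v \<in> V \<Longrightarrow> bp v \<and> \<delta> \<le> H v;
      \<And>v w. \<lbrakk>v \<in> V; w \<in> V\<rbrakk> \<Longrightarrow> dist v w \<le> ?Q * \<delta>\<rbrakk> \<Longrightarrow> finite V \<and> card V \<le> N"
    using card_high_branch_points[of ?Q] by blast
  show ?thesis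
  proof (rule exI[of _ N], intro allI impI)
    fix a b \<tau> assume *: "nice a b \<and> 0 < \<tau> \<and> \<tau> < dist a b \<and> \<kappa> * dist a b \<le> \<tau>"
    have "finite (high \<tau> a b) \<and> card (high \<tau> a b) \<le> N"
    proof (rule N)
      show "\<tau> / (3 * C) > 0" using * C0 by simp
      fix v w assume "v \<in> high \<tau> a b" "w \<in> high \<tau> a b"
      then have "dist v w \<le> K * dist a b" using dist_in_seg[of a b v w] niceD[of a b] * by (simp add: high_def)
      also have "\<dots> \<le> K * (\<tau> / \<kappa>)" using * assms K by (intro mult_left_mono) (auto simp: field_simps)
      also have "\<dots> = ?Q * (\<tau> / (3 * C))" using C0 by simp
      finally show "dist v w \<le> ?Q * (\<tau> / (3 * C))" .
    qed (simp add: high_def)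
    then show "towards N \<tau> a b"
      using cuts_towards[of a b \<tau> N] * by blast
  qed
qed

section \<open>Subdivision into a prescribed number of pieces\<close>

text \<open>Strictly below \<open>c\<^sup>2\<close>, because two targets have to fit:
  \<open>dist a b\<close> may be as small as \<open>c * sb\<close>, and after the end
  \<open>a\<close> has been served only the share \<open>c\<close> of it is certain to remain for
  the end \<open>b\<close>.\<close>

definition \<theta> :: real where "\<theta> = c\<^sup>2 / 2"

lemma \<theta>: "0 < \<theta>" "\<theta> < c\<^sup>2" "\<theta> < c" "\<theta> < 1"
proof -
  show "0 < \<theta>" "\<theta> < c\<^sup>2" using c_pos by (auto simp: \<theta>_def)
  have "c * c \<le> c * 1" using c_pos c_le by (intro mult_left_mono) auto
  then have "c\<^sup>2 \<le> c" by (simp add: power2_eq_square)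
  then show "\<theta> < c" "\<theta> < 1" using \<open>\<theta> < c\<^sup>2\<close> c_le by auto
qed

text \<open>\<open>m\<close> counts inner vertices, so there are \<open>Suc m\<close> pieces. The
  two end pieces satisfy the same relation to \<open>\<theta> * sa\<close> and
  \<open>\<theta> * sb\<close> as the arc \<open>[a, b]\<close> itself does to \<open>sa\<close> and
  \<open>sb\<close>.\<close>

definition divisible :: "nat \<Rightarrow> 'a \<Rightarrow> 'a \<Rightarrow> real \<Rightarrow> real \<Rightarrow> bool" where
  "divisible m a b sa sb \<longleftrightarrow> (\<exists>P. cuts (Suc m) (c ^ Suc m * \<theta> * dist a b) a b P \<and>
    c * (\<theta> * sa) \<le> dist a (P 1) \<and> dist a (P 1) \<le> \<theta> * sa \<and>
    c * (\<theta> * sb) \<le> dist (P m) b \<and> dist (P m) b \<le> \<theta> * sb)"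

lemma subdivision:
  "\<exists>m0. \<forall>m\<ge>m0. \<forall>a b sa sb. nice a b \<and> c * sa \<le> dist a b \<and> dist a b \<le> sa \<and>
      c * sb \<le> dist a b \<and> dist a b \<le> sb \<longrightarrow>
    divisible m a b sa sb"
proof -
  \<comment> \<open>The second pass works on an arc \<open>[q, b]\<close> whose length may exceed
    \<open>dist a b\<close> by the factor \<open>K\<close>; hence \<open>\<theta> / K\<close>
    instead of \<open>\<theta>\<close>.\<close>
  have kap: "\<theta> / K > 0" using \<theta> K by simp
  obtain N where N: "\<And>a b \<tau>. nice a b \<and> 0 < \<tau> \<and> \<tau> < dist a b \<and> \<theta> / K * dist a b \<le> \<tau> \<Longrightarrow>
    towards N \<tau> a b"
    using cuts_towards_uniform[OF kap] by blast
  show ?thesis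
  proof (rule exI[of _ "2 * N"], intro allI impI)
    fix m :: nat and a b sa sb
    assume m: "2 * N \<le> m"
    assume *: "nice a b \<and> c * sa \<le> dist a b \<and> dist a b \<le> sa \<and> c * sb \<le> dist a b \<and> dist a b \<le> sb"
    then have ab: "nice a b" and sa: "c * sa \<le> dist a b" "dist a b \<le> sa"
      and sb: "c * sb \<le> dist a b" "dist a b \<le> sb" by auto
    note T = niceD[OF ab]
    define d where "d = dist a b"
    have d: "d > 0" using T by (simp add: d_def)
    have pos: "sa > 0" "sb > 0" using sa sb d unfolding d_def by linarith+
    have K1: "\<theta> / K \<le> \<theta>" using \<theta> K by (simp add: field_simps)
    have \<tau>a: "0 < \<theta> * sa" "\<theta> * sa < d" "\<theta> / K * d \<le> \<theta> * sa" "\<theta> * d \<le> \<theta> * sa"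
    proof -
      show "0 < \<theta> * sa" using \<theta> pos by simp
      have "\<theta> * sa < c * sa" using \<theta> pos by simp
      then show "\<theta> * sa < d" using sa by (simp add: d_def)
      show 1: "\<theta> * d \<le> \<theta> * sa" using sa \<theta> by (simp add: d_def)
      have "\<theta> / K * d \<le> \<theta> * d" using K1 d by (intro mult_right_mono) auto
      then show "\<theta> / K * d \<le> \<theta> * sa" using 1 by linarith
    qed
    obtain n1 P1 where 1: "2 \<le> n1" "n1 \<le> Suc N" "cuts n1 (c * (\<theta> * sa)) a b P1"
        "c * (\<theta> * sa) \<le> dist a (P1 1)" "dist a (P1 1) \<le> \<theta> * sa" "c * d \<le> dist (P1 (n1 - 1)) b"
      using N[of a b "\<theta> * sa"] ab \<tau>a unfolding d_def towards_def by blast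
    \<comment> \<open>\<open>[q, b]\<close> is the last piece of the pass towards \<open>a\<close>;
      the pass towards \<open>b\<close> takes place inside it.\<close>
    define q where "q = P1 (n1 - 1)"
    have sdq: "cuts (n1 - 1) (c * (\<theta> * sa)) a q P1"
      using cuts_part[OF 1(3), of 0 "n1 - 1"] cutsD(1)[OF 1(3)] by (simp add: q_def)
    have qab: "q \<in> seg a b"
      using cutsD(5)[OF 1(3), of 0 "n1 - 1" n1] cutsD(1,2)[OF 1(3)] by (simp add: q_def)
    have "nice q (P1 (Suc (n1 - 1)))" using cutsD(3)[OF 1(3), of "n1 - 1"] 1(1) by (simp add: q_def)
    moreover have "P1 (Suc (n1 - 1)) = b" using cutsD(2)[OF 1(3)] 1(1) by simp
    ultimately have bq: "nice b q" using nice_sym by simp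
    note qT = niceD(5)[OF bq]
    have "c * (c * sb) \<le> c * d" using sb c_pos by (simp add: d_def)
    then have "c\<^sup>2 * sb \<le> dist b q"
      using 1(6) by (simp add: q_def power2_eq_square dist_commute mult_ac)
    moreover have "\<theta> * sb < c\<^sup>2 * sb" using \<theta> pos by simp
    ultimately have tb: "\<theta> * sb < dist b q" by linarith
    have "dist b q \<le> K * d" using dist_in_seg[of a b b q] T ends_in_seg[of a b] qab by (simp add: d_def)
    then have "\<theta> / K * dist b q \<le> \<theta> / K * (K * d)" using kap by (intro mult_left_mono) auto
    also have "\<dots> \<le> \<theta> * sb" using K sb \<theta> by (simp add: d_def)
    finally have "\<theta> / K * dist b q \<le> \<theta> * sb" .
    then obtain n2 P2 where 2: "2 \<le> n2" "n2 \<le> Suc N" "cuts n2 (c * (\<theta> * sb)) b q P2"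
        "c * (\<theta> * sb) \<le> dist b (P2 1)" "dist b (P2 1) \<le> \<theta> * sb"
      using N[of b q "\<theta> * sb"] bq tb \<theta> pos unfolding towards_def by (metis mult_pos_pos)
    define Q where "Q i = P2 (n2 - i)" for i
    have Q: "cuts n2 (c * (\<theta> * sb)) q b Q" unfolding Q_def using cuts_rev[OF 2(3)] 2(1) by simp
    \<comment> \<open>\<open>[q, r]\<close> is the piece left between the two passes; it absorbs all
      remaining cuts.\<close>
    define r where "r = Q 1"
    have qr: "nice q r" "c * (\<theta> * sb) \<le> dist q r"
      using cutsD(3,4)[OF Q, of 0] cutsD(1)[OF Q] 2(1) by (auto simp: r_def)
    have rqb: "r \<in> seg q b" using cutsD(5)[OF Q, of 0 1 n2] cutsD(1,2)[OF Q] 2(1) by (simp add: r_def)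
    have sdr: "cuts (n2 - 1) (c * (\<theta> * sb)) r b (\<lambda>i. Q (1 + i))"
      using cuts_part[OF Q, of 1 n2] cutsD(2)[OF Q] 2(1) by (simp add: r_def)
    \<comment> \<open>There are \<open>n1 - 1\<close> pieces before \<open>q\<close>,
      \<open>n2 - 1\<close> after \<open>r\<close> and \<open>Suc k\<close> between, in total
      \<open>Suc m\<close>. The subtraction is not truncated because \<open>n1\<close> and
      \<open>n2\<close> are at most \<open>Suc N\<close> and \<open>2 * N \<le> m\<close>.\<close>
    define k where "k = m + 2 - (n1 + n2)"
    have k: "n1 + n2 + k = m + 2" using m 1(2) 2(2) by (simp add: k_def)
    obtain R where R: "cuts (Suc k) (c ^ k * dist q r) q r R" using cuts_pad[OF qr(1)] by blast
    define e where "e = c ^ Suc m * \<theta> * d"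
    have cm: "c ^ Suc m \<le> c" "c ^ k * c \<ge> c ^ Suc m"
    proof -
      have c1: "0 \<le> c" "c \<le> 1" using c_pos c_le by auto
      show "c ^ Suc m \<le> c" using power_decreasing[of 1 "Suc m" c] c1 by simp
      have "c ^ Suc m \<le> c ^ Suc k" using c1 k 1(1) by (intro power_decreasing) auto
      then show "c ^ k * c \<ge> c ^ Suc m" by (simp add: mult.commute)
    qed
    have dsb: "\<theta> * d \<le> \<theta> * sb" using sb \<theta> by (simp add: d_def)
    have e1: "e \<le> c * (\<theta> * sa)" "e \<le> c * (\<theta> * sb)"
    proof -
      have "e \<le> c * (\<theta> * d)" unfolding e_def using mult_right_mono[OF cm(1), of "\<theta> * d"] \<theta> d by (simp add: mult_ac)
      then show "e \<le> c * (\<theta> * sa)" "e \<le> c * (\<theta> * sb)"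
        using mult_left_mono[OF dsb less_imp_le[OF c_pos]]
          mult_left_mono[OF \<tau>a(4) less_imp_le[OF c_pos]] by linarith+
    qed
    have e2: "e \<le> c ^ k * dist q r"
    proof -
      have "e \<le> c ^ k * c * (\<theta> * d)"
        unfolding e_def using mult_right_mono[OF cm(2), of "\<theta> * d"] \<theta> d by (simp add: mult_ac)
      also have "\<dots> \<le> c ^ k * c * (\<theta> * sb)" by (rule mult_left_mono[OF dsb]) (use c_pos in auto)
      also have "\<dots> \<le> c ^ k * dist q r" using qr(2) c_pos by (simp add: mult.assoc)
      finally show ?thesis .
    qed
    obtain U where U: "cuts (Suc k + (n2 - 1)) e q b U" "U (Suc k + (n2 - 1) - 1) = Q (n2 - 1)"
    proof -
      let ?U = "\<lambda>i. if i \<le> Suc k then R i else Q (1 + (i - Suc k))"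
      have "cuts (Suc k + (n2 - 1)) e q b ?U"
        using cuts_glue[OF cuts_weaken[OF R e2] _ cuts_weaken[OF sdr e1(2)] _ rqb] 2(1) by simp
      moreover have "?U (Suc k + (n2 - 1) - 1) = Q (n2 - 1)"
      proof (cases "n2 = 2")
        case True
        then show ?thesis using cutsD(2)[OF R] by (simp add: r_def)
      next
        case False
        then have "Suc k + (n2 - 1) - 1 > Suc k" "1 + (Suc k + (n2 - 1) - 1 - Suc k) = n2 - 1" using 2(1) by auto
        then show ?thesis by (metis not_le)
      qed
      ultimately show thesis using that by blast
    qed
    let ?P = "\<lambda>i. if i \<le> n1 - 1 then P1 i else U (i - (n1 - 1))"
    have P: "cuts (n1 - 1 + (Suc k + (n2 - 1))) e a b ?P"
      using cuts_glue[OF cuts_weaken[OF sdq e1(1)] _ U(1) _ qab] 1(1) by simp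
    have tot: "n1 - 1 + (Suc k + (n2 - 1)) = Suc m" using k 1(1) 2(1) by simp
    have "1 \<le> n1 - 1" using 1(1) by simp
    then have P1: "?P 1 = P1 1" by (simp only: if_True)
    have "m > n1 - 1" "m - (n1 - 1) = Suc k + (n2 - 1) - 1" using k 1(1) 2(1) by auto
    then have Pm: "?P m = Q (n2 - 1)" using U(2) by (metis not_le)
    also have "\<dots> = P2 1" unfolding Q_def using 2(1) by simp
    finally have Pm: "?P m = P2 1" .
    show "divisible m a b sa sb" unfolding divisible_def
    proof (rule exI[of _ ?P], intro conjI)
      show "cuts (Suc m) (c ^ Suc m * \<theta> * dist a b) a b ?P" using P unfolding tot e_def d_def .
      show "c * (\<theta> * sa) \<le> dist a (?P 1)" "dist a (?P 1) \<le> \<theta> * sa" unfolding P1 using 1 by auto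
      show "c * (\<theta> * sb) \<le> dist (?P m) b" "dist (?P m) b \<le> \<theta> * sb"
        unfolding Pm dist_commute[of _ b] using 2 by auto
    qed
  qed
qed

end

section \<open>Tiles\<close>

text \<open>In \<open>TLeaf a x\<close> the point \<open>x\<close> both names the branch of
  \<open>a\<close> and is the place of its next cut; \<open>p\<close> plays the latter role for the
  root. \<open>sa\<close> and \<open>sb\<close> are the target lengths at \<open>a\<close> and
  \<open>b\<close>.\<close>

datatype 'b tile = TRoot 'b | TLeaf 'b 'b | TEdge 'b 'b real real

primrec ends :: "'b tile \<Rightarrow> 'b set" where
  "ends (TRoot p) = {}"
| "ends (TLeaf a x) = {a}"
| "ends (TEdge a b sa sb) = {a, b}"

locale subdivided_tree = branching_tree T K C M for T :: "'a::metric_space set" and K C M +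
  fixes m :: nat and p0 :: 'a
  assumes m: "m > 0" and p0: "branch_point T p0" "diameter T \<le> M * height T p0"
    and subdiv: "\<And>a b sa sb. \<lbrakk>nice a b; c * sa \<le> dist a b; dist a b \<le> sa; c * sb \<le> dist a b; dist a b \<le> sb\<rbrakk>
      \<Longrightarrow> divisible m a b sa sb"
begin

primrec carrier :: "'a tile \<Rightarrow> 'a set" where
  "carrier (TRoot p) = T"
| "carrier (TLeaf a x) = Br a x"
| "carrier (TEdge a b sa sb) = E a b"

text \<open>What the next cut requires: a leaf tile carries the conclusions of
  \<open>leaf_center\<close>, and an edge tile those premises under which it is
  \<open>divisible\<close>.\<close>

primrec ok :: "'a tile \<Rightarrow> bool" where
  "ok (TRoot p) \<longleftrightarrow> bp p \<and> diameter T \<le> M * H p"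
| "ok (TLeaf a x) \<longleftrightarrow> nice a x \<and> diameter (Br a x) \<le> M * H x \<and> diameter (Br a x) \<le> C * M * dist a x \<and>
    (\<forall>B\<in>branches T x. a \<notin> B \<longrightarrow> B \<subseteq> Br a x)"
| "ok (TEdge a b sa sb) \<longleftrightarrow> nice a b \<and> c * sa \<le> dist a b \<and> dist a b \<le> sa \<and>
    c * sb \<le> dist a b \<and> dist a b \<le> sb"

primrec arity :: "'a tile \<Rightarrow> nat" where
  "arity (TRoot p) = 3"
| "arity (TLeaf a x) = 3"
| "arity (TEdge a b sa sb) = 2 * m + 1"

text \<open>Among the vertices \<open>P 0, ..., P (Suc m)\<close> on an edge tile the first and the
  last are its old ends.\<close>

primrec new_idx :: "'a tile \<Rightarrow> nat set" where
  "new_idx (TRoot p) = {0}"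
| "new_idx (TLeaf a x) = {0}"
| "new_idx (TEdge a b sa sb) = {1..m}"

definition \<epsilon> :: real where "\<epsilon> = c ^ Suc m * \<theta>"

text \<open>\<open>Br p x\<close> is the branch of \<open>p\<close> that hangs off \<open>[a, b]\<close>.\<close>

abbreviation hanging :: "'a \<Rightarrow> 'a \<Rightarrow> 'a \<Rightarrow> 'a \<Rightarrow> bool" where
  "hanging a b p x \<equiv> Br p x \<noteq> Br p a \<and> Br p x \<noteq> Br p b \<and> branches T p = {Br p a, Br p b, Br p x}"

text \<open>An edge tile carries at each of its ends a target length, which at a given vertex is multiplied
  by exactly \<open>\<theta>\<close> in every step.\<close>

abbreviation edge_child :: "real \<Rightarrow> real \<Rightarrow> (nat \<Rightarrow> 'a) \<Rightarrow> nat \<Rightarrow> 'a tile" where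
  "edge_child sa sb P i \<equiv> TEdge (P i) (P (Suc i))
    (if i = 0 then \<theta> * sa else dist (P i) (P (Suc i)))
    (if i = m then \<theta> * sb else dist (P i) (P (Suc i)))"

text \<open>\<open>f\<close> lists the children of \<open>t\<close>, \<open>P\<close> its new vertices. The children of an edge tile are
  alternately the edges between consecutive vertices and the branches off \<open>[a, b]\<close>.\<close>

primrec kids :: "'a tile \<Rightarrow> (nat \<Rightarrow> 'a tile) \<Rightarrow> (nat \<Rightarrow> 'a) \<Rightarrow> bool" where
  "kids (TRoot p) f P \<longleftrightarrow> P 0 = p \<and> (\<exists>x. (\<forall>i<3. f i = TLeaf p (x i)) \<and>
    inj_on (\<lambda>i. Br p (x i)) {..<3} \<and> branches T p = (\<lambda>i. Br p (x i)) ` {..<3})"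
| "kids (TLeaf a x) f P \<longleftrightarrow> P 0 = x \<and> f 0 = TEdge a x (dist a x) (dist a x) \<and>
    (\<exists>y z. f 1 = TLeaf x y \<and> f 2 = TLeaf x z \<and> Br x y \<noteq> Br x a \<and> Br x z \<noteq> Br x a \<and> Br x y \<noteq> Br x z \<and>
      branches T x = {Br x a, Br x y, Br x z})"
| "kids (TEdge a b sa sb) f P \<longleftrightarrow> cuts (Suc m) (\<epsilon> * dist a b) a b P \<and>
    (\<forall>i\<le>m. f (2 * i) = edge_child sa sb P i) \<and>
    (\<forall>i\<in>{1..m}. \<exists>x. f (2 * i - 1) = TLeaf (P i) x \<and> hanging a b (P i) x)"

text \<open>The centre found by \<open>leaf_center\<close> lies in the same branch, so it may
  replace the original representative in its name.\<close>

lemma ok_leaf: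
  assumes "bp a" "x \<in> T" "x \<noteq> a" "diameter (Br a x) \<le> M * H a"
  obtains y where "ok (TLeaf a y)" "Br a y = Br a x"
proof -
  obtain y where y: "y \<in> Br a x" "nice a y" "diameter (Br a x) \<le> M * H y"
    "diameter (Br a x) \<le> C * M * dist a y"
    "\<And>B. \<lbrakk>B \<in> branches T y; a \<notin> B\<rbrakk> \<Longrightarrow> B \<subseteq> Br a x"
    using leaf_center[OF assms] by metis
  have "Br a y = Br a x" using Br_eq[of a x y] assms y bp_mem niceD[OF y(2)] by auto
  then show thesis using that[of y] y by auto
qed

lemma okD_leaf:
  assumes "ok (TLeaf a x)"
  shows "nice a x" "bp a" "bp x" "a \<noteq> x" "a \<in> T" "x \<in> T"
    "diameter (Br a x) \<le> M * H x" "diameter (Br a x) \<le> C * M * dist a x"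
    "\<And>B. \<lbrakk>B \<in> branches T x; a \<notin> B\<rbrakk> \<Longrightarrow> B \<subseteq> Br a x"
  using assms niceD[of a x] by auto

lemma cuts_inj:
  assumes P: "cuts n e a b P" "i < j" "j \<le> n" shows "P i \<noteq> P j"
proof
  assume eq: "P i = P j"
  have n: "nice (P i) (P (Suc i))" using cutsD(3)[OF P(1), of i] P by auto
  have "P (Suc i) \<in> seg (P i) (P j)" using cutsD(5)[OF P(1)] P by auto
  then show False using eq niceD[OF n] by auto
qed

lemma cuts_bp:
  assumes P: "cuts (Suc n) e a b P" "i \<le> Suc n" shows "bp (P i)"
proof (cases "i = Suc n")
  case True
  then show ?thesis using niceD(2)[OF cutsD(3)[OF P(1), of n]] by simp
next
  case False
  then show ?thesis using niceD(1)[OF cutsD(3)[OF P(1), of i]] P by simp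
qed

lemma cuts_inner:
  assumes P: "cuts (Suc n) e a b P" "1 \<le> i" "i \<le> n"
  shows "P i \<in> seg a b" "P i \<noteq> a" "P i \<noteq> b" "bp (P i)"
  using cutsD[OF P(1)] cutsD(5)[OF P(1), of 0 i "Suc n"] cuts_inj[OF P(1), of 0 i] cuts_inj[OF P(1), of i "Suc n"]
    cuts_bp[OF P(1), of i] assms by auto

text \<open>Every new branch must satisfy the diameter bound of \<open>leaf_center\<close> at its
  base point. For the root this is the choice of \<open>p\<close>, for a leaf tile the bound
  \<open>diameter (Br a x) \<le> M * H x\<close>, and for an edge tile the clause on hanging
  branches in \<open>nice\<close>.\<close>

lemma kids_exist:
  assumes t: "ok t"
  shows "\<exists>f P. kids t f P \<and> (\<forall>i<arity t. ok (f i))"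
proof (cases t)
  case (TRoot p)
  then have p: "bp p" "diameter T \<le> M * H p" using t by auto
  obtain g where g: "bij_betw g {..<3::nat} (branches T p)"
    using ex_bij_betw_nat_finite[OF finite_branches[OF p(1)]] card_branches[OF p(1)]
    by (metis atLeast0LessThan)
  have "\<exists>y. ok (TLeaf p y) \<and> Br p y = g i" if i: "i < 3" for i
  proof -
    have "g i \<in> branches T p" using g i by (auto simp: bij_betw_def)
    then obtain x where x: "x \<in> T" "x \<noteq> p" "g i = Br p x" using branchE[OF p(1)] by metis
    have "diameter (Br p x) \<le> diameter T" using diam_mono Br_subset bp_mem p by auto
    then show ?thesis using ok_leaf[OF p(1) x(1,2)] p x by (metis order_trans)
  qed
  then obtain y where y: "\<And>i. i < 3 \<Longrightarrow> ok (TLeaf p (y i)) \<and> Br p (y i) = g i" by metis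
  have "inj_on (\<lambda>i. Br p (y i)) {..<3}" "branches T p = (\<lambda>i. Br p (y i)) ` {..<3}"
    using g y by (auto simp: bij_betw_def inj_on_def)
  then have "kids t (\<lambda>i. TLeaf p (y i)) (\<lambda>_. p)" using TRoot by auto
  moreover have "arity t = 3" using TRoot by simp
  ultimately show ?thesis using y by metis
next
  case (TLeaf a x)
  note o = okD_leaf[OF t[unfolded TLeaf]]
  obtain w where w: "w \<in> T" "w \<noteq> x" "Br x w \<noteq> Br x a" using other_branch[OF o(3)] by metis
  obtain v where v: "v \<in> T" "v \<noteq> x" "Br x v \<noteq> Br x a" "Br x v \<noteq> Br x w"
      "branches T x = {Br x a, Br x w, Br x v}"
    using third_branch[OF o(3,5) w(1) _ w(2)] w o by metis
  have small: "diameter (Br x d) \<le> M * H x" if d: "d \<in> T" "d \<noteq> x" "Br x d \<noteq> Br x a" for d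
  proof -
    have "a \<notin> Br x d" using Br_eq[of x d a] d o by auto
    then have "Br x d \<subseteq> Br a x" using o(9) Br_branch o d by auto
    then have "diameter (Br x d) \<le> diameter (Br a x)" using diam_mono Br_subset o by auto
    then show ?thesis using o by linarith
  qed
  obtain y where y: "ok (TLeaf x y)" "Br x y = Br x w" using ok_leaf[OF o(3) w(1,2) small] w by metis
  obtain z where z: "ok (TLeaf x z)" "Br x z = Br x v" using ok_leaf[OF o(3) v(1,2) small] v by metis
  let ?f = "\<lambda>i::nat. if i = 0 then TEdge a x (dist a x) (dist a x) else if i = 1 then TLeaf x y else TLeaf x z"
  have "kids t ?f (\<lambda>_. x)" using TLeaf v w y z by auto
  moreover have "ok (TEdge a x (dist a x) (dist a x))" using o c_le c_pos mult_right_mono[of c 1 "dist a x"] by auto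
  ultimately show ?thesis using y z by (intro exI[of _ ?f] exI[of _ "\<lambda>_. x"]) auto
next
  case (TEdge a b sa sb)
  then have ab: "nice a b" "c * sa \<le> dist a b" "dist a b \<le> sa" "c * sb \<le> dist a b" "dist a b \<le> sb"
    using t by auto
  note T = niceD[OF ab(1)]
  obtain P where P: "cuts (Suc m) (\<epsilon> * dist a b) a b P" "c * (\<theta> * sa) \<le> dist a (P 1)" "dist a (P 1) \<le> \<theta> * sa"
      "c * (\<theta> * sb) \<le> dist (P m) b" "dist (P m) b \<le> \<theta> * sb"
    using subdiv[OF ab] by (auto simp: \<epsilon>_def divisible_def)
  note sD = cutsD[OF P(1)]
  have "\<exists>x. ok (TLeaf (P i) x) \<and> hanging a b (P i) x" if i: "i \<in> {1..m}" for i
  proof -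
    have in': "P i \<in> seg a b" "P i \<noteq> a" "P i \<noteq> b" "bp (P i)" using cuts_inner[OF P(1), of i] i by auto
    have ne: "Br (P i) a \<noteq> Br (P i) b" using inner_Br[OF T(4,5) in'(1-3)] mem_Br[of a "P i"] T in' by metis
    obtain d where d: "d \<in> T" "d \<noteq> P i" "Br (P i) d \<noteq> Br (P i) a" "Br (P i) d \<noteq> Br (P i) b"
        "branches T (P i) = {Br (P i) a, Br (P i) b, Br (P i) d}"
      using third_branch[OF in'(4) T(4,5) _ _ ne] in' by metis
    have "a \<notin> Br (P i) d" "b \<notin> Br (P i) d"
      using Br_eq[of "P i" d a] Br_eq[of "P i" d b] bp_mem[OF in'(4)] d T in' by auto
    then have "diameter (Br (P i) d) \<le> M * H (P i)"
      using nice_inner(3)[OF ab(1) in'(4,1-3)] Br_branch in' d by auto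
    then obtain x where x: "ok (TLeaf (P i) x)" "Br (P i) x = Br (P i) d" using ok_leaf[OF in'(4) d(1,2)] by metis
    show ?thesis using x(1) d(3-5)[folded x(2)] by blast
  qed
  then obtain x where x: "\<And>i. i \<in> {1..m} \<Longrightarrow> ok (TLeaf (P i) (x i)) \<and> hanging a b (P i) (x i)"
    by metis
  define e where "e i = edge_child sa sb P i" for i
  \<comment> \<open>An odd index \<open>i\<close> belongs to the vertex numbered
    \<open>Suc (i div 2)\<close>, in agreement with the index \<open>2 * i - 1\<close> in
    \<open>kids\<close>.\<close>
  define f where "f i = (if even i then e (i div 2) else TLeaf (P (Suc (i div 2))) (x (Suc (i div 2))))" for i
  have f_odd: "f (2 * i - 1) = TLeaf (P i) (x i)" if "i \<in> {1..m}" for i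
  proof -
    obtain k where "i = Suc k" using \<open>i \<in> {1..m}\<close> by (cases i) auto
    then show ?thesis by (simp add: f_def)
  qed
  have kk: "kids t f P" unfolding TEdge kids.simps
  proof (intro conjI allI impI ballI)
    fix i assume i: "i \<in> {1..m}"
    show "\<exists>y. f (2 * i - 1) = TLeaf (P i) y \<and> hanging a b (P i) y"
      using f_odd[OF i] x[OF i] by blast
  qed (use P(1) in \<open>simp_all add: f_def e_def\<close>)
  have e: "ok (e i)" if i: "i \<le> m" for i
  proof -
    have n: "nice (P i) (P (Suc i))" using sD(3)[of i] i by simp
    have "c * dist (P i) (P (Suc i)) \<le> dist (P i) (P (Suc i))"
      using c_le c_pos mult_right_mono[of c 1 "dist (P i) (P (Suc i))"] by auto
    then show ?thesis using n P(2-5) sD(1,2) by (auto simp: e_def)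
  qed
  have "ok (f i)" if i: "i < 2 * m + 1" for i
  proof (cases "even i")
    case True
    then show ?thesis using e[of "i div 2"] i by (auto simp: f_def)
  next
    case False
    then have "Suc (i div 2) \<in> {1..m}" using i by (auto elim!: oddE)
    then show ?thesis using x False by (auto simp: f_def)
  qed
  moreover have "arity t = 2 * m + 1" using TEdge by simp
  ultimately show ?thesis using kk by metis
qed

section \<open>Incidence of the pieces of a subdivided edge tile\<close>

context
  fixes a b P e x
  assumes P: "cuts (Suc m) e a b P"
    and x: "\<And>i. i \<in> {1..m} \<Longrightarrow> hanging a b (P i) (x i)"
begin

lemma ab: "a \<in> T" "b \<in> T" "a \<noteq> b"
  using cutsD(1,2)[OF P] cuts_mem[OF P, of 0] cuts_mem[OF P, of "Suc m"] cuts_inj[OF P, of 0 "Suc m"] by auto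

lemma PT: "i \<le> Suc m \<Longrightarrow> P i \<in> T"
  using cuts_mem[OF P] by auto

lemma Pne: "\<lbrakk>i \<noteq> j; i \<le> Suc m; j \<le> Suc m\<rbrakk> \<Longrightarrow> P i \<noteq> P j"
  using cuts_inj[OF P, of i j] cuts_inj[OF P, of j i] by (cases "i < j") auto

lemma Pseg: "\<lbrakk>i \<le> j; j \<le> k; k \<le> Suc m\<rbrakk> \<Longrightarrow> P j \<in> seg (P i) (P k)"
  using cutsD(5)[OF P] by auto

lemma Br_left: assumes "i < j" "j \<le> m" shows "Br (P j) (P i) = Br (P j) a"
proof (cases "i = 0")
  case False
  then show ?thesis using inner_Br(2)[of "P 0" "P j" "P i"] PT Pne Pseg[of 0 i j] assms cutsD(1)[OF P] by auto
qed (simp add: cutsD(1)[OF P])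

lemma Br_right: assumes "j < i" "i \<le> Suc m" shows "Br (P j) (P i) = Br (P j) b"
proof (cases "i = Suc m")
  case False
  then show ?thesis using inner_Br(1)[of "P j" "P (Suc m)" "P i"] PT Pne Pseg[of j i "Suc m"] assms cutsD(2)[OF P] by auto
qed (simp add: cutsD(2)[OF P])

lemma Br_ab: assumes "1 \<le> j" "j \<le> m" shows "Br (P j) a \<inter> Br (P j) b = {P j}"
proof -
  have i: "P j \<in> seg a b" "P j \<noteq> a" "P j \<noteq> b" using cuts_inner[OF P] assms by auto
  have "Br (P j) a \<noteq> Br (P j) b" using inner_Br[OF ab(1,2) i] mem_Br[of a "P j"] ab i by metis
  then show ?thesis using Br_Int[of "P j" a b] ab PT[of j] assms i by auto
qed

lemma hair_point: assumes "i \<in> {1..m}"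
  obtains d where "d \<in> T" "d \<noteq> P i" "Br (P i) (x i) = Br (P i) d"
proof -
  have bpi: "bp (P i)" using cuts_inner[OF P] assms by auto
  have "Br (P i) (x i) \<in> branches T (P i)" using x[OF assms] by auto
  then show thesis using that branchE[OF bpi] by metis
qed

lemma hair_Int: assumes i: "i \<in> {1..m}"
  shows "Br (P i) (x i) \<inter> Br (P i) a = {P i}" "Br (P i) (x i) \<inter> Br (P i) b = {P i}"
proof -
  obtain d where d: "d \<in> T" "d \<noteq> P i" "Br (P i) (x i) = Br (P i) d" using hair_point[OF i] .
  have "P i \<noteq> a" "P i \<noteq> b" using cuts_inner[OF P, of i] i by auto
  then show "Br (P i) (x i) \<inter> Br (P i) a = {P i}" "Br (P i) (x i) \<inter> Br (P i) b = {P i}"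
    using Br_Int[of "P i" d a] Br_Int[of "P i" d b] x[OF i] PT[of i] ab d i by auto
qed

text \<open>Each piece lies on one side of every inner vertex from which it does not hang, and by
  \<open>Br_ab\<close> and \<open>hair_Int\<close> the three sides of a vertex meet only in that
  vertex. The intersection lemmas below follow from this.\<close>

lemma edge_left: assumes "i < j" "j \<le> m" shows "E (P i) (P (Suc i)) \<subseteq> Br (P j) a"
proof -
  have "E (P i) (P (Suc i)) \<subseteq> E (P i) (P j)"
    using E_mono[of "P i" "P j" "P (Suc i)"] PT Pne Pseg[of i "Suc i" j] assms by auto
  then show ?thesis using Br_left[OF assms] by (auto simp: E_def)
qed

lemma edge_right: assumes "j \<le> i" "i \<le> m" shows "E (P i) (P (Suc i)) \<subseteq> Br (P j) b"
proof -
  have "P i \<in> seg (P (Suc i)) (P j)" using Pseg[of j i "Suc i"] seg_sym[of "P (Suc i)" "P j"] PT assms by auto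
  then have "E (P (Suc i)) (P i) \<subseteq> E (P (Suc i)) (P j)"
    using E_mono[of "P (Suc i)" "P j" "P i"] PT Pne assms by auto
  then show ?thesis using Br_right[of j "Suc i"] assms E_sym[of "P i"] by (auto simp: E_def)
qed

lemma hair_left: assumes i: "i \<in> {1..m}" and j: "i < j" "j \<le> m" shows "Br (P i) (x i) \<subseteq> Br (P j) a"
proof -
  obtain d where d: "d \<in> T" "d \<noteq> P i" "Br (P i) (x i) = Br (P i) d" using hair_point[OF i] .
  have "P j \<in> Br (P i) b" using Br_right[of i j] mem_Br[of "P j" "P i"] PT[of j] Pne[of i j] j by auto
  moreover have "P i \<noteq> P j" by (rule Pne) (use i j in auto)
  ultimately have "P j \<notin> Br (P i) d" using hair_Int(2)[OF i] d(3) by (metis IntI singletonD)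
  then have "Br (P i) d \<subseteq> Br (P j) (P i)" using Br_nested[of "P i" d "P j"] PT Pne[of i j] d i j by auto
  then show ?thesis using Br_left[OF j] d by simp
qed

lemma hair_right: assumes i: "i \<in> {1..m}" and j: "1 \<le> j" "j < i" shows "Br (P i) (x i) \<subseteq> Br (P j) b"
proof -
  obtain d where d: "d \<in> T" "d \<noteq> P i" "Br (P i) (x i) = Br (P i) d" using hair_point[OF i] .
  have ne: "P i \<noteq> P j" by (rule Pne) (use i j in auto)
  have "P j \<in> Br (P i) (P j)" by (rule mem_Br[OF PT ne]) (use i j in auto)
  moreover have "Br (P i) (P j) = Br (P i) a" by (rule Br_left) (use i j in auto)
  ultimately have "P j \<in> Br (P i) a" by simp
  then have n: "P j \<notin> Br (P i) d" using hair_Int(1)[OF i] d(3) ne by (metis IntI singletonD)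
  have "Br (P i) d \<subseteq> Br (P j) (P i)"
    by (rule Br_nested[OF PT d(1) PT d(2)[symmetric] ne n]) (use i j in auto)
  then show ?thesis using Br_right[of j i] d i j by simp
qed

lemma vertex_in_edge: assumes "k \<le> Suc m" "i \<le> m" shows "P k \<in> E (P i) (P (Suc i)) \<longleftrightarrow> k = i \<or> k = Suc i"
proof
  assume k: "P k \<in> E (P i) (P (Suc i))"
  show "k = i \<or> k = Suc i"
  proof (rule ccontr)
    assume "\<not> ?thesis"
    then consider "k < i" | "k > Suc i" by linarith
    then show False
    proof cases
      case 1
      then have "P k \<notin> Br (P i) (P (Suc i))"
        using inner_Br(4)[of "P k" "P (Suc i)" "P i"] PT Pne Pseg[of k i "Suc i"] assms by auto
      then show False using k by (simp add: E_def)
    next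
      case 2
      then have "P k \<notin> Br (P (Suc i)) (P i)"
        using inner_Br(3)[of "P i" "P k" "P (Suc i)"] PT Pne Pseg[of i "Suc i" k] assms by auto
      then show False using k by (simp add: E_def)
    qed
  qed
qed (use seg_subset_E[of "P i" "P (Suc i)"] ends_in_seg[of "P i" "P (Suc i)"] PT Pne[of i "Suc i"] assms in auto)

lemma edge_edge: assumes "i < j" "j \<le> m"
  shows "E (P i) (P (Suc i)) \<inter> E (P j) (P (Suc j)) \<subseteq> {P i, P (Suc i)} \<inter> {P j, P (Suc j)}"
proof -
  have "E (P i) (P (Suc i)) \<inter> E (P j) (P (Suc j)) \<subseteq> {P j}"
  proof -
    have "E (P j) (P (Suc j)) \<subseteq> Br (P j) b" using edge_right[of j j] assms by auto
    moreover have "Br (P j) a \<inter> Br (P j) b = {P j}" using Br_ab assms by auto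
    ultimately show ?thesis using edge_left[OF assms] by blast
  qed
  moreover have "P j \<in> E (P i) (P (Suc i)) \<Longrightarrow> j = Suc i" using vertex_in_edge[of j i] assms by auto
  ultimately show ?thesis by auto
qed

lemma edge_hair: assumes "i \<le> m" "j \<in> {1..m}"
  shows "E (P i) (P (Suc i)) \<inter> Br (P j) (x j) \<subseteq> {P i, P (Suc i)} \<inter> {P j}"
proof -
  have "E (P i) (P (Suc i)) \<inter> Br (P j) (x j) \<subseteq> {P j}"
  proof (cases "i < j")
    case True
    then have "E (P i) (P (Suc i)) \<subseteq> Br (P j) a" using edge_left assms by auto
    then show ?thesis using hair_Int(1)[OF assms(2)] by blast
  next
    case False
    then have "E (P i) (P (Suc i)) \<subseteq> Br (P j) b" using edge_right assms by auto
    then show ?thesis using hair_Int(2)[OF assms(2)] by blast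
  qed
  moreover have "P j \<in> E (P i) (P (Suc i)) \<Longrightarrow> j = i \<or> j = Suc i" using vertex_in_edge[of j i] assms by auto
  ultimately show ?thesis by auto
qed

lemma vertex_in_hair: assumes "k \<le> Suc m" "j \<in> {1..m}" "P k \<in> Br (P j) (x j)" shows "k = j"
proof (rule ccontr)
  assume kj: "k \<noteq> j"
  have "P k \<in> Br (P j) (P k)" using mem_Br PT Pne[of k j] kj assms by auto
  then have "P k \<in> Br (P j) a \<or> P k \<in> Br (P j) b"
    using Br_left[of k j] Br_right[of j k] kj assms by (cases "k < j") auto
  then show False using hair_Int[OF assms(2)] assms(3) Pne[of k j] kj assms by auto
qed

lemma hair_hair: assumes "i \<in> {1..m}" "j \<in> {1..m}" "i \<noteq> j" shows "Br (P i) (x i) \<inter> Br (P j) (x j) = {}"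
proof -
  have "Br (P i) (x i) \<inter> Br (P j) (x j) \<subseteq> {P j}"
  proof (cases "i < j")
    case True
    then have "Br (P i) (x i) \<subseteq> Br (P j) a" using hair_left assms by auto
    then show ?thesis using hair_Int(1)[OF assms(2)] by blast
  next
    case False
    then have "Br (P i) (x i) \<subseteq> Br (P j) b" using hair_right assms by auto
    then show ?thesis using hair_Int(2)[OF assms(2)] by blast
  qed
  moreover have "P j \<notin> Br (P i) (x i)" using vertex_in_hair[of j i] assms by auto
  ultimately show ?thesis by auto
qed

text \<open>Induction over the initial arcs \<open>[a, P (Suc k)]\<close> with
  \<open>E_split\<close> at the last inner vertex. Since a vertex has just three branches, the one
  hanging off is all that remains besides the two directions of the arc.\<close>

lemma pieces_cover: "E a b = (\<Union>i\<le>m. E (P i) (P (Suc i))) \<union> (\<Union>i\<in>{1..m}. Br (P i) (x i))"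
proof -
  have "E a (P (Suc k)) = (\<Union>i\<le>k. E (P i) (P (Suc i))) \<union> (\<Union>i\<in>{1..k}. Br (P i) (x i))" if "k \<le> m" for k
    using that
  proof (induction k)
    case 0
    then show ?case using cutsD(1)[OF P] by simp
  next
    case (Suc k)
    let ?p = "P (Suc k)" and ?q = "P (Suc (Suc k))"
    have k: "Suc k \<in> {1..m}" using Suc.prems by auto
    have pq: "?p \<in> seg a ?q" "?p \<noteq> a" "?p \<noteq> ?q" "?q \<in> T"
      using Pseg[of 0 "Suc k" "Suc (Suc k)"] cutsD(1)[OF P] Pne[of "Suc k" 0] Pne[of "Suc k" "Suc (Suc k)"]
        PT Suc.prems by auto
    have qb: "Br ?p ?q = Br ?p b" using Br_right[of "Suc k" "Suc (Suc k)"] Suc.prems by auto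
    have mem: "a \<in> Br ?p a" "?q \<in> Br ?p b" using mem_Br[of a ?p] mem_Br[of ?q ?p] pq ab qb by auto
    have nq: "?q \<noteq> a" using Pne[of "Suc (Suc k)" 0] cutsD(1)[OF P] Suc.prems by auto
    have no: "a \<notin> Br ?p (x (Suc k))" "?q \<notin> Br ?p (x (Suc k))"
      using hair_Int[OF k] mem pq(2,3) by (metis IntI singletonD)+
    have "{B \<in> branches T ?p. a \<notin> B \<and> ?q \<notin> B} = {Br ?p (x (Suc k))}" using x[OF k] no mem by auto
    then have "E a ?q = E a ?p \<union> E ?p ?q \<union> \<Union> {Br ?p (x (Suc k))} \<union> {?p}"
      using E_split[OF ab(1) pq(4,1,2,3)] by (simp only:)
    then have "E a ?q = E a ?p \<union> E ?p ?q \<union> Br ?p (x (Suc k))" by (simp add: insert_absorb)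
    moreover have "E a ?p = (\<Union>i\<le>k. E (P i) (P (Suc i))) \<union> (\<Union>i\<in>{1..k}. Br (P i) (x i))"
      using Suc by auto
    ultimately show ?case by (simp add: atMost_Suc atLeastAtMostSuc_conv Un_ac)
  qed
  from this[of m] show ?thesis using cutsD(2)[OF P] by simp
qed

end

end

section \<open>Children of tiles\<close>

context subdivided_tree
begin

lemma edge_kids:
  assumes "kids (TEdge a b sa sb) f P"
  obtains x where "cuts (Suc m) (\<epsilon> * dist a b) a b P"
    "\<And>i. i \<in> {1..m} \<Longrightarrow> hanging a b (P i) (x i)"
    "\<And>i. i \<le> m \<Longrightarrow> f (2 * i) = edge_child sa sb P i"
    "\<And>i. i \<in> {1..m} \<Longrightarrow> f (2 * i - 1) = TLeaf (P i) (x i)"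
proof -
  have "\<forall>i\<in>{1..m}. \<exists>x. f (2 * i - 1) = TLeaf (P i) x \<and> hanging a b (P i) x" using assms by simp
  then obtain x where x: "\<And>i. i \<in> {1..m} \<Longrightarrow> f (2 * i - 1) = TLeaf (P i) (x i) \<and>
      hanging a b (P i) (x i)" by metis
  show thesis
  proof (rule that[of x])
    show "cuts (Suc m) (\<epsilon> * dist a b) a b P" using assms by simp
    show "f (2 * i) = edge_child sa sb P i" if "i \<le> m" for i using assms that by simp
  qed (use x in blast)+
qed

lemma edge_idx:
  assumes "i < 2 * m + 1"
  obtains k where "k \<le> m" "i = 2 * k" | k where "k \<in> {1..m}" "i = 2 * k - 1"
proof (cases "even i")
  case True
  then show thesis using that(1)[of "i div 2"] assms by auto
next
  case False
  then obtain k where "i = 2 * k + 1" by (elim oddE)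
  then show thesis using that(2)[of "Suc k"] assms by auto
qed

lemma root_kids:
  assumes "ok (TRoot p)" "kids (TRoot p) f P"
  obtains x where "P 0 = p" "\<And>i. i < 3 \<Longrightarrow> f i = TLeaf p (x i)" "branches T p = (\<lambda>i. Br p (x i)) ` {..<3}"
    "\<And>i j. \<lbrakk>i < 3; j < 3; i \<noteq> j\<rbrakk> \<Longrightarrow> Br p (x i) \<inter> Br p (x j) = {p}"
proof -
  have p: "bp p" "p \<in> T" using assms bp_mem by auto
  obtain x where x: "P 0 = p" "\<And>i. i < 3 \<Longrightarrow> f i = TLeaf p (x i)" "inj_on (\<lambda>i. Br p (x i)) {..<3}"
      "branches T p = (\<lambda>i. Br p (x i)) ` {..<3}"
    using assms(2) by auto
  have "Br p (x i) \<inter> Br p (x j) = {p}" if ij: "i < 3" "j < 3" "i \<noteq> j" for i j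
  proof -
    obtain d where d: "d \<in> T" "d \<noteq> p" "Br p (x i) = Br p d" using branchE[OF p(1), of "Br p (x i)"] x(4) ij by auto
    obtain d' where d': "d' \<in> T" "d' \<noteq> p" "Br p (x j) = Br p d'" using branchE[OF p(1), of "Br p (x j)"] x(4) ij by auto
    have "Br p d \<noteq> Br p d'" using inj_onD[OF x(3), of i j] d d' ij by auto
    then show ?thesis using Br_Int[of p d d'] d d' p by auto
  qed
  then show thesis using that x by blast
qed

lemma leaf_kids:
  assumes t: "ok (TLeaf a x)" and k: "kids (TLeaf a x) f P"
  obtains y z where "P 0 = x" "f 0 = TEdge a x (dist a x) (dist a x)" "f 1 = TLeaf x y" "f 2 = TLeaf x z"
    "Br x y \<inter> Br x a = {x}" "Br x z \<inter> Br x a = {x}" "Br x y \<inter> Br x z = {x}"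
    "branches T x = {Br x a, Br x y, Br x z}" "Br x y \<subseteq> Br a x" "Br x z \<subseteq> Br a x"
proof -
  note o = okD_leaf[OF t]
  obtain y z where yz: "f 1 = TLeaf x y" "f 2 = TLeaf x z" "Br x y \<noteq> Br x a" "Br x z \<noteq> Br x a" "Br x y \<noteq> Br x z"
      "branches T x = {Br x a, Br x y, Br x z}"
    using k by auto
  obtain d where d: "d \<in> T" "d \<noteq> x" "Br x y = Br x d" using branchE[OF o(3), of "Br x y"] yz(6) by auto
  obtain e where e: "e \<in> T" "e \<noteq> x" "Br x z = Br x e" using branchE[OF o(3), of "Br x z"] yz(6) by auto
  have i1: "Br x d \<inter> Br x a = {x}" by (rule Br_Int) (use d yz(3) o(4-6) in auto)
  have i2: "Br x e \<inter> Br x a = {x}" by (rule Br_Int) (use e yz(4) o(4-6) in auto)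
  have i3: "Br x d \<inter> Br x e = {x}" by (rule Br_Int) (use d e yz(5) o(4-6) in auto)
  have a: "a \<in> Br x a" using mem_Br o by auto
  then have "a \<notin> Br x d" "a \<notin> Br x e" using i1 i2 o(4) by (metis IntI singletonD)+
  then have "Br x d \<subseteq> Br a x" "Br x e \<subseteq> Br a x" using o(9) Br_branch[OF o(3)] d e by auto
  then show thesis
    by (intro that[of y z]) (use k yz(1,2,6) i1 i2 i3 d(3) e(3) in simp_all)
qed

lemma ends_subset: assumes "ok t" shows "ends t \<subseteq> carrier t"
proof (cases t)
  case (TEdge a b sa sb)
  then show ?thesis using assms mem_Br[of a b] mem_Br[of b a] niceD[of a b] by (simp add: E_def)
qed simp_all

lemma carrier_subset: assumes "ok t" shows "carrier t \<subseteq> T"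
proof (cases t)
  case (TLeaf a x)
  then show ?thesis using assms Br_subset[of a x] niceD[of a x] by simp
next
  case (TEdge a b sa sb)
  then show ?thesis using assms E_subset[of a b] niceD[of a b] by simp
qed simp

lemma compact_carrier: assumes "ok t" shows "compact (carrier t)"
proof (cases t)
  case (TLeaf a x)
  then show ?thesis using assms compact_Br[of a x] niceD[of a x] by simp
next
  case (TEdge a b sa sb)
  then show ?thesis using assms compact_E[of a b] niceD[of a b] by simp
qed (simp add: compact_T)

text \<open>The ends separate a tile from the rest of the tree. This is what lets arcs be traced
  from tile to tile when disjoint tiles are separated.\<close>

lemma carrier_exit:
  assumes "ok t" "x \<in> carrier t" "y \<in> T" "y \<notin> carrier t" shows "\<exists>z\<in>ends t. z \<in> seg x y"
proof (cases t)
  case (TRoot p)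
  then show ?thesis using assms by auto
next
  case (TLeaf a w)
  then show ?thesis using assms seg_through[of a w x y] niceD[of a w] by auto
next
  case (TEdge a b sa sb)
  then show ?thesis using assms E_through[of a b x y] niceD[of a b] by auto
qed

lemma kids_cover:
  assumes t: "ok t" and k: "kids t f P" shows "carrier t = (\<Union>i<arity t. carrier (f i))"
proof (cases t)
  case (TRoot p)
  obtain x where x: "P 0 = p" "\<And>i. i < 3 \<Longrightarrow> f i = TLeaf p (x i)" "branches T p = (\<lambda>i. Br p (x i)) ` {..<3}"
    using root_kids[of p f P] t k TRoot by metis
  have p: "p \<in> T" using t TRoot bp_mem by auto
  have "T = (\<Union>i<3. Br p (x i))"
  proof
    show "(\<Union>i<3. Br p (x i)) \<subseteq> T" using Br_subset p by auto
    show "T \<subseteq> (\<Union>i<3. Br p (x i))"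
    proof
      fix y assume y: "y \<in> T"
      show "y \<in> (\<Union>i<3. Br p (x i))"
      proof (cases "y = p")
        case True
        then show ?thesis by (intro UN_I[of 0]) auto
      next
        case False
        then have "Br p y \<in> branches T p" using branches_eq[OF p] y by auto
        then obtain i where "i < 3" "Br p y = Br p (x i)" using x(3) by auto
        then show ?thesis using mem_Br[of y p] y False by blast
      qed
    qed
  qed
  then show ?thesis using TRoot x(2) by auto
next
  case (TLeaf a x)
  obtain y z where yz: "f 0 = TEdge a x (dist a x) (dist a x)" "f 1 = TLeaf x y" "f 2 = TLeaf x z"
    "branches T x = {Br x a, Br x y, Br x z}" "Br x y \<subseteq> Br a x" "Br x z \<subseteq> Br a x"
    using leaf_kids[of a x f P] t k TLeaf by metis
  note o = okD_leaf[OF t[unfolded TLeaf]]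
  have "Br a x = E a x \<union> Br x y \<union> Br x z"
  proof
    show "E a x \<union> Br x y \<union> Br x z \<subseteq> Br a x" using yz by (auto simp: E_def)
    show "Br a x \<subseteq> E a x \<union> Br x y \<union> Br x z"
    proof
      fix w assume w: "w \<in> Br a x"
      show "w \<in> E a x \<union> Br x y \<union> Br x z"
      proof (cases "w \<in> Br x a \<or> w = x")
        case True
        then show ?thesis using w by (auto simp: E_def)
      next
        case False
        have wT: "w \<in> T" using w Br_subset o by blast
        then have "Br x w \<in> branches T x" "w \<in> Br x w" using Br_branch o(3) False mem_Br[of w x] by auto
        then show ?thesis using yz(4) False by auto
      qed
    qed
  qed
  moreover have "{..<3} = {0, 1, 2::nat}" by auto
  ultimately show ?thesis using TLeaf yz(1-3) by auto
next
  case (TEdge a b sa sb)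
  obtain x where P: "cuts (Suc m) (\<epsilon> * dist a b) a b P" and
    x: "\<And>i. i \<in> {1..m} \<Longrightarrow> hanging a b (P i) (x i)" and
    e: "\<And>i. i \<le> m \<Longrightarrow> f (2 * i) = edge_child sa sb P i" and
    h: "\<And>i. i \<in> {1..m} \<Longrightarrow> f (2 * i - 1) = TLeaf (P i) (x i)"
    using edge_kids[OF k[unfolded TEdge]] by blast
  have "(\<Union>i<2 * m + 1. carrier (f i)) = (\<Union>i\<le>m. E (P i) (P (Suc i))) \<union> (\<Union>i\<in>{1..m}. Br (P i) (x i))"
  proof
    show "(\<Union>i<2 * m + 1. carrier (f i)) \<subseteq> (\<Union>i\<le>m. E (P i) (P (Suc i))) \<union> (\<Union>i\<in>{1..m}. Br (P i) (x i))"
    proof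
      fix y assume "y \<in> (\<Union>i<2 * m + 1. carrier (f i))"
      then obtain i where i: "i < 2 * m + 1" "y \<in> carrier (f i)" by auto
      show "y \<in> (\<Union>i\<le>m. E (P i) (P (Suc i))) \<union> (\<Union>i\<in>{1..m}. Br (P i) (x i))"
        by (rule edge_idx[OF i(1)]) (use i(2) e h in auto)
    qed
    show "(\<Union>i\<le>m. E (P i) (P (Suc i))) \<union> (\<Union>i\<in>{1..m}. Br (P i) (x i)) \<subseteq> (\<Union>i<2 * m + 1. carrier (f i))"
    proof (intro Un_least UN_least)
      fix i assume i: "i \<in> {..m}"
      then have "carrier (f (2 * i)) = E (P i) (P (Suc i))" using e by simp
      then show "E (P i) (P (Suc i)) \<subseteq> (\<Union>i<2 * m + 1. carrier (f i))" using i by (intro subsetI UN_I[of "2 * i"]) auto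
    next
      fix i assume i: "i \<in> {1..m}"
      then have "carrier (f (2 * i - 1)) = Br (P i) (x i)" using h by simp
      then show "Br (P i) (x i) \<subseteq> (\<Union>i<2 * m + 1. carrier (f i))" using i by (intro subsetI UN_I[of "2 * i - 1"]) auto
    qed
  qed
  then show ?thesis using TEdge pieces_cover[OF P x] by auto
qed

lemma kids_Int:
  assumes t: "ok t" and k: "kids t f P" and ij: "i < arity t" "j < arity t" "i \<noteq> j"
  shows "carrier (f i) \<inter> carrier (f j) \<subseteq> ends (f i) \<inter> ends (f j)"
proof (cases t)
  case (TRoot p)
  obtain x where x: "P 0 = p" "\<And>i. i < 3 \<Longrightarrow> f i = TLeaf p (x i)"
      "\<And>i j. \<lbrakk>i < 3; j < 3; i \<noteq> j\<rbrakk> \<Longrightarrow> Br p (x i) \<inter> Br p (x j) = {p}"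
    using root_kids[of p f P] t k TRoot by metis
  then show ?thesis using ij TRoot by auto
next
  case (TLeaf a x)
  obtain y z where yz: "f 0 = TEdge a x (dist a x) (dist a x)" "f 1 = TLeaf x y" "f 2 = TLeaf x z"
    "Br x y \<inter> Br x a = {x}" "Br x z \<inter> Br x a = {x}" "Br x y \<inter> Br x z = {x}"
    using leaf_kids[of a x f P] t k TLeaf by metis
  have "i = 0 \<or> i = 1 \<or> i = 2" "j = 0 \<or> j = 1 \<or> j = 2" using ij TLeaf by auto
  then show ?thesis using ij(3) yz by (elim disjE) (auto simp: E_def)
next
  case (TEdge a b sa sb)
  obtain x where P: "cuts (Suc m) (\<epsilon> * dist a b) a b P" and
    x: "\<And>i. i \<in> {1..m} \<Longrightarrow> hanging a b (P i) (x i)" and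
    e: "\<And>i. i \<le> m \<Longrightarrow> f (2 * i) = edge_child sa sb P i" and
    h: "\<And>i. i \<in> {1..m} \<Longrightarrow> f (2 * i - 1) = TLeaf (P i) (x i)"
    using edge_kids[OF k[unfolded TEdge]] by blast
  have ij': "i < 2 * m + 1" "j < 2 * m + 1" using ij TEdge by auto
  show ?thesis
  proof (rule edge_idx[OF ij'(1)]; rule edge_idx[OF ij'(2)])
    fix u v assume uv: "u \<le> m" "i = 2 * u" "v \<le> m" "j = 2 * v"
    then have "u < v \<or> v < u" using ij(3) by auto
    then show ?thesis using edge_edge[OF P x, of u v] edge_edge[OF P x, of v u] uv e[of u] e[of v] by auto
  next
    fix u v assume uv: "u \<le> m" "i = 2 * u" "v \<in> {1..m}" "j = 2 * v - 1"
    show ?thesis using edge_hair[OF P x uv(1,3)] uv(2,4) e[OF uv(1)] h[OF uv(3)] by auto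
  next
    fix u v assume uv: "u \<in> {1..m}" "i = 2 * u - 1" "v \<le> m" "j = 2 * v"
    show ?thesis using edge_hair[OF P x uv(3,1)] uv(2,4) e[OF uv(3)] h[OF uv(1)] by auto
  next
    fix u v assume uv: "u \<in> {1..m}" "i = 2 * u - 1" "v \<in> {1..m}" "j = 2 * v - 1"
    then show ?thesis using hair_hair[OF P x uv(1,3)] ij(3) h[OF uv(1)] h[OF uv(3)] by auto
  qed
qed

text \<open>Together with the statement on new vertices in \<open>kids_new\<close> it says that a
  vertex, once created, is an end of every later tile containing it. Hence incidence can be decided
  from the ends.\<close>

lemma kids_old_ends:
  assumes t: "ok t" and k: "kids t f P" and i: "i < arity t"
  shows "ends t \<inter> carrier (f i) \<subseteq> ends (f i)"
proof (cases t)
  case (TLeaf a x)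
  obtain y z where yz: "f 0 = TEdge a x (dist a x) (dist a x)" "f 1 = TLeaf x y" "f 2 = TLeaf x z"
    "Br x y \<inter> Br x a = {x}" "Br x z \<inter> Br x a = {x}"
    using leaf_kids[of a x f P] t k TLeaf by metis
  have "i = 0 \<or> i = 1 \<or> i = 2" using i TLeaf by auto
  moreover have "a \<in> Br x a" using okD_leaf[OF t[unfolded TLeaf]] mem_Br by auto
  ultimately show ?thesis using yz TLeaf by (elim disjE) auto
next
  case (TEdge a b sa sb)
  obtain x where P: "cuts (Suc m) (\<epsilon> * dist a b) a b P" and
    x: "\<And>i. i \<in> {1..m} \<Longrightarrow> hanging a b (P i) (x i)" and
    e: "\<And>i. i \<le> m \<Longrightarrow> f (2 * i) = edge_child sa sb P i" and
    h: "\<And>i. i \<in> {1..m} \<Longrightarrow> f (2 * i - 1) = TLeaf (P i) (x i)"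
    using edge_kids[OF k[unfolded TEdge]] by blast
  have ends: "ends t = {P 0, P (Suc m)}" using TEdge cutsD(1,2)[OF P] by simp
  have i': "i < 2 * m + 1" using i TEdge by auto
  show ?thesis
  proof (rule edge_idx[OF i'])
    fix u assume u: "u \<le> m" "i = 2 * u"
    have "P 0 \<in> E (P u) (P (Suc u)) \<Longrightarrow> u = 0" "P (Suc m) \<in> E (P u) (P (Suc u)) \<Longrightarrow> u = m"
      using vertex_in_edge[OF P x, of 0 u] vertex_in_edge[OF P x, of "Suc m" u] u by auto
    then show ?thesis using ends e[OF u(1)] u by auto
  next
    fix u assume u: "u \<in> {1..m}" "i = 2 * u - 1"
    have "P 0 \<notin> Br (P u) (x u)" "P (Suc m) \<notin> Br (P u) (x u)"
      using vertex_in_hair[OF P x, of 0 u] vertex_in_hair[OF P x, of "Suc m" u] u by auto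
    then show ?thesis using ends h[OF u(1)] u by auto
  qed
qed simp

lemma kids_new:
  assumes t: "ok t" and k: "kids t f P" and j: "j \<in> new_idx t"
  shows "P j \<in> carrier t" "P j \<notin> ends t" "bp (P j)" "\<And>i. \<lbrakk>i < arity t; P j \<in> carrier (f i)\<rbrakk> \<Longrightarrow> P j \<in> ends (f i)"
    "inj_on P (new_idx t)"
proof -
  have "P j \<in> carrier t \<and> P j \<notin> ends t \<and> bp (P j) \<and> (\<forall>i<arity t. P j \<in> carrier (f i) \<longrightarrow> P j \<in> ends (f i)) \<and>
    inj_on P (new_idx t)"
  proof (cases t)
    case (TRoot p)
    then show ?thesis using root_kids[of p f P] t k j bp_mem by fastforce
  next
    case (TLeaf a x)
    obtain y z where yz: "P 0 = x" "f 0 = TEdge a x (dist a x) (dist a x)" "f 1 = TLeaf x y" "f 2 = TLeaf x z"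
      using leaf_kids[of a x f P] t k TLeaf by metis
    have "i = 0 \<or> i = 1 \<or> i = 2" if "i < arity t" for i using that TLeaf by auto
    moreover have "ends (f 0) = {a, x}" "ends (f 1) = {x}" "ends (f 2) = {x}" using yz by auto
    ultimately have "\<forall>i<arity t. x \<in> ends (f i)" by fastforce
    then show ?thesis using yz(1) TLeaf j okD_leaf[OF t[unfolded TLeaf]] mem_Br[of x a] by auto
  next
    case (TEdge a b sa sb)
    obtain x where P: "cuts (Suc m) (\<epsilon> * dist a b) a b P" and
      x: "\<And>i. i \<in> {1..m} \<Longrightarrow> hanging a b (P i) (x i)" and
      e: "\<And>i. i \<le> m \<Longrightarrow> f (2 * i) = edge_child sa sb P i" and
      h: "\<And>i. i \<in> {1..m} \<Longrightarrow> f (2 * i - 1) = TLeaf (P i) (x i)"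
      using edge_kids[OF k[unfolded TEdge]] by blast
    have j': "1 \<le> j" "j \<le> m" using j TEdge by auto
    note i' = cuts_inner[OF P j']
    have "P j \<in> E a b" using seg_subset_E[OF ab[OF P x]] i' by auto
    moreover have "inj_on P {1..m}" using Pne[OF P x] by (intro inj_onI) (metis atLeastAtMost_iff le_SucI)
    moreover have "P j \<in> ends (f i)" if i: "i < 2 * m + 1" "P j \<in> carrier (f i)" for i
    proof (rule edge_idx[OF i(1)])
      fix u assume u: "u \<le> m" "i = 2 * u"
      then have "P j \<in> E (P u) (P (Suc u))" using i e by auto
      then show ?thesis using vertex_in_edge[OF P x, of j u] u e[OF u(1)] j' by auto
    next
      fix u assume u: "u \<in> {1..m}" "i = 2 * u - 1"
      then have "P j \<in> Br (P u) (x u)" using i(2) h[OF u(1)] by simp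
      then show ?thesis using vertex_in_hair[OF P x, of j u] u h[OF u(1)] j' by auto
    qed
    ultimately show ?thesis using TEdge i' by auto
  qed
  then show "P j \<in> carrier t" "P j \<notin> ends t" "bp (P j)" "\<And>i. \<lbrakk>i < arity t; P j \<in> carrier (f i)\<rbrakk> \<Longrightarrow> P j \<in> ends (f i)"
    "inj_on P (new_idx t)" by auto
qed

section \<open>Sizes and target lengths\<close>

text \<open>Except at the root this is a distance between two marked points, which
  \<open>cuts\<close> controls directly; \<open>sz_bounds\<close> makes it comparable to the
  diameter.\<close>

primrec sz :: "'a tile \<Rightarrow> real" where
  "sz (TRoot p) = diameter T"
| "sz (TLeaf a x) = dist a x"
| "sz (TEdge a b sa sb) = dist a b"

definition L' :: real where "L' = max L (C * M)"
text \<open>The worst child is a branch off an edge tile: by \<open>nice_length\<close> its base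
  point has height at least \<open>\<epsilon> / (3 * C * M)\<close> times the length of the edge,
  and \<open>leaf_sz\<close> costs a further factor \<open>C * M\<close>.\<close>

definition \<eta> :: real where "\<eta> = \<epsilon> / (3 * C\<^sup>2 * M\<^sup>2)"

lemma L'1: "L' \<ge> 1"
  using L1 by (simp add: L'_def)

lemma \<epsilon>: "0 < \<epsilon>" "\<epsilon> \<le> 1"
proof -
  show "0 < \<epsilon>" using c_pos \<theta> by (simp add: \<epsilon>_def)
  have "c ^ Suc m \<le> 1" using c_pos c_le by (intro power_le_one) auto
  then have "c ^ Suc m * \<theta> \<le> 1 * 1" using c_pos \<theta> by (intro mult_mono) auto
  then show "\<epsilon> \<le> 1" by (simp add: \<epsilon>_def)
qed

lemma \<eta>_bounds: "0 < \<eta>" "\<eta> \<le> 1 / (C * M\<^sup>2)" "\<eta> \<le> \<epsilon> / (3 * C * M)" "\<eta> \<le> \<epsilon>" "\<eta> \<le> 1 / M" "\<eta> \<le> 1"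
proof -
  have p: "C\<^sup>2 \<ge> C" "C \<ge> 1" "M\<^sup>2 \<ge> M" "M \<ge> 1" using C M1 by (auto simp: power2_eq_square)
  have q: "C * M\<^sup>2 \<le> 3 * C\<^sup>2 * M\<^sup>2" "3 * C * M \<le> 3 * C\<^sup>2 * M\<^sup>2" "1 \<le> 3 * C\<^sup>2 * M\<^sup>2" "M \<le> 3 * C\<^sup>2 * M\<^sup>2"
  proof -
    show "C * M\<^sup>2 \<le> 3 * C\<^sup>2 * M\<^sup>2" using p by (intro mult_right_mono) auto
    show "3 * C * M \<le> 3 * C\<^sup>2 * M\<^sup>2" using p by (intro mult_mono) auto
    have "1 * 1 * 1 \<le> 3 * C\<^sup>2 * M\<^sup>2" using p by (intro mult_mono) auto
    then show "1 \<le> 3 * C\<^sup>2 * M\<^sup>2" by simp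
    have "1 * M \<le> 3 * C\<^sup>2 * M\<^sup>2" using p by (intro mult_mono) auto
    then show "M \<le> 3 * C\<^sup>2 * M\<^sup>2" by simp
  qed
  have d: "\<epsilon> / y \<le> e / x" if "0 < x" "x \<le> y" "\<epsilon> \<le> e" for x y e :: real
    using that \<epsilon> by (intro frac_le) auto
  show "0 < \<eta>" unfolding \<eta>_def using \<epsilon> C0 M1 by simp
  show "\<eta> \<le> 1 / (C * M\<^sup>2)" unfolding \<eta>_def using \<epsilon> C0 M1 q by (intro d) auto
  show "\<eta> \<le> \<epsilon> / (3 * C * M)" unfolding \<eta>_def using \<epsilon> C0 M1 q by (intro d) auto
  show "\<eta> \<le> 1 / M" unfolding \<eta>_def using \<epsilon> C0 M1 q by (intro d) auto
  show 1: "\<eta> \<le> \<epsilon>" using d[of 1 "3 * C\<^sup>2 * M\<^sup>2" \<epsilon>] q by (simp add: \<eta>_def)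
  show "\<eta> \<le> 1" using 1 \<epsilon> by linarith
qed

lemma sz_pos: "ok t \<Longrightarrow> sz t > 0"
proof (cases t)
  case (TRoot p)
  assume "ok t"
  then have p: "bp p" using TRoot by simp
  obtain d where d: "d \<in> T" "d \<noteq> p" using other_branch[OF p] by metis
  have "diameter (Br p d) \<le> diameter T" using diam_mono Br_subset bp_mem p by auto
  then show ?thesis using diam_Br_pos[of p d] d bp_mem[OF p] TRoot by auto
qed (use niceD in auto)

lemma sz_bounds: assumes t: "ok t" shows "sz t \<le> diameter (carrier t)" "diameter (carrier t) \<le> L' * sz t"
proof -
  have "sz t \<le> diameter (carrier t) \<and> diameter (carrier t) \<le> L' * sz t"
  proof (cases t)
    case (TRoot p)
    then show ?thesis using L'1 sz_pos[OF t] by simp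
  next
    case (TLeaf a x)
    note o = okD_leaf[OF t[unfolded TLeaf]]
    have "dist a x \<le> diameter (Br a x)" using dist_le_diameter[of a "Br a x" x] Br_subset o by auto
    moreover have "C * M * dist a x \<le> L' * dist a x" by (intro mult_right_mono) (auto simp: L'_def)
    ultimately have "dist a x \<le> diameter (Br a x) \<and> diameter (Br a x) \<le> L' * dist a x" using o(8) by linarith
    then show ?thesis using TLeaf by simp
  next
    case (TEdge a b sa sb)
    then have n: "nice a b" using t by simp
    note T = niceD[OF n]
    have "dist a b \<le> diameter (E a b)"
      using dist_le_diameter[of a "E a b" b] ends_in_seg[OF T(4,5)] seg_subset_E[OF T(4,5,3)] E_subset T by blast
    moreover have "L * dist a b \<le> L' * dist a b" by (intro mult_right_mono) (auto simp: L'_def)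
    ultimately show ?thesis using TEdge diam_E[OF n] by simp
  qed
  then show "sz t \<le> diameter (carrier t)" "diameter (carrier t) \<le> L' * sz t" by auto
qed

lemma leaf_sz:
  assumes "ok (TLeaf p y)" "H p \<ge> h" shows "h / (C * M) \<le> dist p y"
proof -
  note o = okD_leaf[OF assms(1)]
  have "h \<le> diameter (Br p y)" using H_le[OF o(2) Br_branch[OF o(2,6)]] o assms(2) by force
  then have "h \<le> C * M * dist p y" using o by linarith
  then show ?thesis using C0 M1 by (simp add: field_simps)
qed

lemma kids_sz:
  assumes t: "ok t" and k: "kids t f P" and f: "\<And>i. i < arity t \<Longrightarrow> ok (f i)"
  shows "\<And>i. i < arity t \<Longrightarrow> \<eta> * sz t \<le> sz (f i)" "\<And>j. j \<in> new_idx t \<Longrightarrow> \<eta> * sz t \<le> H (P j)"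
proof -
  have "(\<forall>i<arity t. \<eta> * sz t \<le> sz (f i)) \<and> (\<forall>j\<in>new_idx t. \<eta> * sz t \<le> H (P j))"
  proof (cases t)
    case (TRoot p)
    obtain x where x: "P 0 = p" "\<And>i. i < 3 \<Longrightarrow> f i = TLeaf p (x i)" using root_kids[of p f P] t k TRoot by metis
    have H: "diameter T / M \<le> H p" using t TRoot M1 by (simp add: field_simps)
    have e: "\<eta> * diameter T \<le> diameter T / (C * M\<^sup>2)" "\<eta> * diameter T \<le> diameter T / M"
      using mult_right_mono[OF \<eta>_bounds(2), of "diameter T"] mult_right_mono[OF \<eta>_bounds(5), of "diameter T"]
        sz_pos[OF t] TRoot by auto
    have "\<eta> * diameter T \<le> dist p (x i)" if "i < 3" for i
      using leaf_sz[of p "x i", OF _ H] f[of i] x(2)[OF that] that TRoot e by (simp add: power2_eq_square mult_ac)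
    then show ?thesis using TRoot x H e by auto
  next
    case (TLeaf a x)
    obtain y z where yz: "P 0 = x" "f 0 = TEdge a x (dist a x) (dist a x)" "f 1 = TLeaf x y" "f 2 = TLeaf x z"
      using leaf_kids[of a x f P] t k TLeaf by metis
    note o = okD_leaf[OF t[unfolded TLeaf]]
    have "dist a x \<le> diameter (Br a x)" using sz_bounds(1)[OF t] TLeaf by simp
    then have H: "dist a x / M \<le> H x" using o(7) M1 by (simp add: field_simps)
    have e: "\<eta> * dist a x \<le> dist a x / (C * M\<^sup>2)" "\<eta> * dist a x \<le> dist a x / M" "\<eta> * dist a x \<le> dist a x"
      using mult_right_mono[OF \<eta>_bounds(2), of "dist a x"] mult_right_mono[OF \<eta>_bounds(5), of "dist a x"]
        mult_right_mono[OF \<eta>_bounds(6), of "dist a x"] by auto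
    have "\<eta> * dist a x \<le> dist x y" "\<eta> * dist a x \<le> dist x z"
      using leaf_sz[of x y, OF _ H] leaf_sz[of x z, OF _ H] f[of 1] f[of 2] yz TLeaf e
      by (auto simp: power2_eq_square mult_ac)
    moreover have "i = 0 \<or> i = 1 \<or> i = 2" if "i < 3" for i :: nat using that by auto
    ultimately show ?thesis using TLeaf yz H e by fastforce
  next
    case (TEdge a b sa sb)
    obtain x where P: "cuts (Suc m) (\<epsilon> * dist a b) a b P" and
      e: "\<And>i. i \<le> m \<Longrightarrow> f (2 * i) = edge_child sa sb P i" and
      h: "\<And>i. i \<in> {1..m} \<Longrightarrow> f (2 * i - 1) = TLeaf (P i) (x i)"
      using edge_kids[OF k[unfolded TEdge]] by metis
    have H: "\<epsilon> * dist a b / (3 * C * M) \<le> H (P j)" if "j \<le> m" for j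
    proof -
      have "\<epsilon> * dist a b \<le> dist (P j) (P (Suc j))" using cutsD(4)[OF P, of j] that by simp
      also have "\<dots> \<le> 3 * C * M * H (P j)" using nice_length cutsD(3)[OF P, of j] that by simp
      finally show ?thesis using C0 M1 by (simp add: field_simps)
    qed
    have s: "\<eta> * dist a b \<le> \<epsilon> * dist a b / (3 * C * M)" "\<eta> * dist a b \<le> \<epsilon> * dist a b"
      using mult_right_mono[OF \<eta>_bounds(3), of "dist a b"] mult_right_mono[OF \<eta>_bounds(4), of "dist a b"] by auto
    have "\<eta> * dist a b \<le> sz (f i)" if i: "i < 2 * m + 1" for i
    proof (rule edge_idx[OF i])
      fix u assume u: "u \<le> m" "i = 2 * u"
      then show ?thesis using cutsD(4)[OF P, of u] e[OF u(1)] s by simp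
    next
      fix u assume u: "u \<in> {1..m}" "i = 2 * u - 1"
      have "ok (TLeaf (P u) (x u))" using f[of i] h[OF u(1)] u i TEdge by simp
      then have "\<epsilon> * dist a b / (3 * C * M) / (C * M) \<le> dist (P u) (x u)"
        by (rule leaf_sz[OF _ H]) (use u in auto)
      moreover have "\<epsilon> * dist a b / (3 * C * M) / (C * M) = \<eta> * dist a b"
        by (simp add: \<eta>_def power2_eq_square mult_ac)
      ultimately show ?thesis using h[OF u(1)] u by simp
    qed
    moreover have "\<eta> * dist a b \<le> H (P j)" if "j \<in> {1..m}" for j using H[of j] s that by auto
    ultimately show ?thesis using TEdge by simp
  qed
  then show "\<And>i. i < arity t \<Longrightarrow> \<eta> * sz t \<le> sz (f i)" "\<And>j. j \<in> new_idx t \<Longrightarrow> \<eta> * sz t \<le> H (P j)" by auto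
qed

text \<open>The target length at an end. At a leaf tile it is set so that multiplication by \<open>\<theta>\<close> gives the
  length of the edge child.\<close>

primrec sc :: "'a tile \<Rightarrow> 'a \<Rightarrow> real" where
  "sc (TRoot p) x = 0"
| "sc (TLeaf a y) x = dist a y / \<theta>"
| "sc (TEdge a b sa sb) x = (if x = a then sa else sb)"

lemma sc_bounds:
  assumes t: "ok t" and x: "x \<in> ends t" shows "sz t \<le> sc t x" "sc t x \<le> sz t / \<theta>"
proof -
  have "sz t \<le> sc t x \<and> sc t x \<le> sz t / \<theta>"
  proof (cases t)
    case (TRoot p)
    then show ?thesis using x by simp
  next
    case (TLeaf a y)
    have "\<theta> * dist a y \<le> 1 * dist a y" using \<theta> by (intro mult_right_mono) auto
    then have "dist a y \<le> dist a y / \<theta>" using \<theta> by (simp add: field_simps)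
    then show ?thesis using TLeaf by simp
  next
    case (TEdge a b sa sb)
    then have ab: "c * sa \<le> dist a b" "dist a b \<le> sa" "c * sb \<le> dist a b" "dist a b \<le> sb" using t by auto
    have up: "s \<le> dist a b / \<theta>" if "c * s \<le> dist a b" "dist a b \<le> s" for s
    proof -
      have "0 \<le> s" using that zero_le_dist[of a b] by linarith
      then have "\<theta> * s \<le> c * s" using \<theta> by (intro mult_right_mono) auto
      then show ?thesis using that \<theta> by (simp add: field_simps)
    qed
    show ?thesis using TEdge ab up by auto
  qed
  then show "sz t \<le> sc t x" "sc t x \<le> sz t / \<theta>" by auto
qed

text \<open>Equality rather than comparability is the point: two tiles sharing the end
  \<open>x\<close> receive the same factor in every generation, so their ratio does not
  drift.\<close>

lemma kids_sc:
  assumes t: "ok t" and k: "kids t f P" and i: "i < arity t" and x: "x \<in> ends t" "x \<in> ends (f i)"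
  shows "sc (f i) x = \<theta> * sc t x"
proof (cases t)
  case (TRoot p)
  then show ?thesis using x by simp
next
  case (TLeaf a w)
  obtain y z where yz: "P 0 = w" "f 0 = TEdge a w (dist a w) (dist a w)" "f 1 = TLeaf w y" "f 2 = TLeaf w z"
    using leaf_kids[of a w f P] t k TLeaf by metis
  have "i = 0 \<or> i = 1 \<or> i = 2" using i TLeaf by auto
  then show ?thesis using yz TLeaf x okD_leaf[OF t[unfolded TLeaf]] \<theta> by (elim disjE) auto
next
  case (TEdge a b sa sb)
  obtain y where P: "cuts (Suc m) (\<epsilon> * dist a b) a b P" and
    y: "\<And>i. i \<in> {1..m} \<Longrightarrow> hanging a b (P i) (y i)" and
    e: "\<And>i. i \<le> m \<Longrightarrow> f (2 * i) = edge_child sa sb P i" and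
    h: "\<And>i. i \<in> {1..m} \<Longrightarrow> f (2 * i - 1) = TLeaf (P i) (y i)"
    using edge_kids[OF k[unfolded TEdge]] by blast
  have i': "i < 2 * m + 1" using i TEdge by simp
  have ab: "a = P 0" "b = P (Suc m)" using cutsD(1,2)[OF P] by auto
  note ne = Pne[OF P y]
  have ab': "P 0 \<noteq> P (Suc m)" using ne[of 0 "Suc m"] by simp
  show ?thesis
  proof (rule edge_idx[OF i'])
    fix u assume u: "u \<le> m" "i = 2 * u"
    have fi: "f i = TEdge (P u) (P (Suc u)) (if u = 0 then \<theta> * sa else dist (P u) (P (Suc u)))
        (if u = m then \<theta> * sb else dist (P u) (P (Suc u)))" using e u by simp
    obtain v where v: "x = P v" "v = 0 \<or> v = Suc m" using x(1) TEdge ab by auto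
    obtain w where w: "x = P w" "w = u \<or> w = Suc u" using x(2) fi by auto
    have "v = w" using ne[of v w] v w u(1) by fastforce
    then consider "x = P 0" "u = 0" | "x = P (Suc m)" "u = m" using v w u(1) by auto
    then show ?thesis
    proof cases
      case 1
      then show ?thesis using fi TEdge ab by simp
    next
      case 2
      then show ?thesis using fi TEdge ab ab' ne[of "Suc m" m] by simp
    qed
  next
    fix u assume u: "u \<in> {1..m}" "i = 2 * u - 1"
    then have "x = P u" using h x by simp
    then show ?thesis using x(1) TEdge ab ne[of u 0] ne[of u "Suc m"] u(1) by auto
  qed
qed

end

section \<open>Addresses\<close>

text \<open>From here up to the labels no tree occurs: shapes, arities and names of ends depend only
  on \<open>m\<close> and the address, and are thus common to both trees.\<close>

datatype tile_shape = SRoot | SLeaf | SEdge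

primrec arity_of :: "nat \<Rightarrow> tile_shape \<Rightarrow> nat" where
  "arity_of m SRoot = 3"
| "arity_of m SLeaf = 3"
| "arity_of m SEdge = 2 * m + 1"

primrec next_shape :: "tile_shape \<Rightarrow> nat \<Rightarrow> tile_shape" where
  "next_shape SRoot i = SLeaf"
| "next_shape SLeaf i = (if i = 0 then SEdge else SLeaf)"
| "next_shape SEdge i = (if even i then SEdge else SLeaf)"

primrec shape :: "nat list \<Rightarrow> tile_shape" where
  "shape [] = SRoot"
| "shape (i # w) = next_shape (shape w) i"

primrec word :: "nat \<Rightarrow> nat list \<Rightarrow> bool" where
  "word m [] \<longleftrightarrow> True"
| "word m (i # w) \<longleftrightarrow> word m w \<and> i < arity_of m (shape w)"

text \<open>Names for the ends of the tile with address \<open>w\<close>: the label \<open>(v, j)\<close> is the \<open>j\<close>-th new vertex of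
  the tile with address \<open>v\<close>. Only the first label is meaningful for a leaf tile, none for the root.\<close>

primrec lab :: "nat \<Rightarrow> nat list \<Rightarrow> (nat list \<times> nat) \<times> (nat list \<times> nat)" where
  "lab m [] = (([], 0), ([], 0))"
| "lab m (i # w) = (case shape w of
      SRoot \<Rightarrow> ((w, 0), (w, 0))
    | SLeaf \<Rightarrow> if i = 0 then (fst (lab m w), (w, 0)) else ((w, 0), (w, 0))
    | SEdge \<Rightarrow> if even i
        then (if i = 0 then fst (lab m w) else (w, i div 2),
              if i = 2 * m then snd (lab m w) else (w, Suc (i div 2)))
        else ((w, Suc (i div 2)), (w, Suc (i div 2))))"

definition labs :: "nat \<Rightarrow> nat list \<Rightarrow> (nat list \<times> nat) set" where
  "labs m w = (case shape w of SRoot \<Rightarrow> {} | SLeaf \<Rightarrow> {fst (lab m w)} | SEdge \<Rightarrow> {fst (lab m w), snd (lab m w)})"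

lemma finite_words: "finite {w. word m w \<and> length w = n}"
proof (induction n)
  case (Suc n)
  have "{w. word m w \<and> length w = Suc n} \<subseteq> (\<lambda>(i, w). i # w) ` ({..<2 * m + 3} \<times> {w. word m w \<and> length w = n})"
  proof
    fix w assume w: "w \<in> {w. word m w \<and> length w = Suc n}"
    then obtain i v where v: "w = i # v" by (cases w) auto
    have "i < arity_of m (shape v)" using w v by simp
    then have "i < 2 * m + 3" by (cases "shape v") auto
    then show "w \<in> (\<lambda>(i, w). i # w) ` ({..<2 * m + 3} \<times> {w. word m w \<and> length w = n})" using w v by auto
  qed
  then show ?case by (rule finite_subset) (use Suc in auto)
qed (simp add: conj_commute cong: conj_cong)

lemma word_append: "word m (v @ w) \<Longrightarrow> word m w"
  by (induction v) auto

context subdivided_tree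
begin

primrec shape_of :: "'a tile \<Rightarrow> tile_shape" where
  "shape_of (TRoot p) = SRoot"
| "shape_of (TLeaf a x) = SLeaf"
| "shape_of (TEdge a b sa sb) = SEdge"

lemma arity_shape: "arity t = arity_of m (shape_of t)"
  by (cases t) auto

lemma kids_shape:
  assumes t: "ok t" and k: "kids t f P" and i: "i < arity t"
  shows "shape_of (f i) = next_shape (shape_of t) i"
proof (cases t)
  case (TRoot p)
  obtain x where "\<And>i. i < 3 \<Longrightarrow> f i = TLeaf p (x i)"     using root_kids[of p f P] t k TRoot by metis
  then show ?thesis using i TRoot by simp
next
  case (TLeaf a x)
  then have "i = 0 \<or> i = 1 \<or> i = 2" using i by auto
  moreover obtain y z where "f 0 = TEdge a x (dist a x) (dist a x)" "f 1 = TLeaf x y" "f 2 = TLeaf x z"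
    using leaf_kids[of a x f P] t k TLeaf by metis
  ultimately show ?thesis using TLeaf by (elim disjE) simp_all
next
  case (TEdge a b sa sb)
  obtain x where e: "\<And>i. i \<le> m \<Longrightarrow> f (2 * i) = edge_child sa sb P i" and
    h: "\<And>i. i \<in> {1..m} \<Longrightarrow> f (2 * i - 1) = TLeaf (P i) (x i)"
    using edge_kids[OF k[unfolded TEdge]] by metis
  have i': "i < 2 * m + 1" using i TEdge by simp
  show ?thesis
  proof (rule edge_idx[OF i'])
    fix u assume u: "u \<le> m" "i = 2 * u"
    show ?thesis using e[OF u(1)] u(2) TEdge by simp
  next
    fix u assume u: "u \<in> {1..m}" "i = 2 * u - 1"
    then have "odd i" by (cases u) auto
    then show ?thesis using h[OF u(1)] u(2) TEdge by simp
  qed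
qed

definition kid :: "'a tile \<Rightarrow> (nat \<Rightarrow> 'a tile) \<times> (nat \<Rightarrow> 'a)" where
  "kid t = (SOME z. kids t (fst z) (snd z) \<and> (\<forall>i<arity t. ok (fst z i)))"

lemma kid: assumes "ok t" shows "kids t (fst (kid t)) (snd (kid t))" "\<And>i. i < arity t \<Longrightarrow> ok (fst (kid t) i)"
proof -
  have "\<exists>z. kids t (fst z) (snd z) \<and> (\<forall>i<arity t. ok (fst z i))" using kids_exist[OF assms] by auto
  from someI_ex[OF this]
  show "kids t (fst (kid t)) (snd (kid t))" "\<And>i. i < arity t \<Longrightarrow> ok (fst (kid t) i)"
    unfolding kid_def by auto
qed

primrec tile_at :: "nat list \<Rightarrow> 'a tile" where
  "tile_at [] = TRoot p0"
| "tile_at (i # w) = fst (kid (tile_at w)) i"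

definition pt :: "nat list \<times> nat \<Rightarrow> 'a" where
  "pt l = snd (kid (tile_at (fst l))) (snd l)"

abbreviation "X w \<equiv> carrier (tile_at w)"

lemma tile_at: assumes "word m w" shows "ok (tile_at w)" "shape_of (tile_at w) = shape w"
proof -
  have "ok (tile_at w) \<and> shape_of (tile_at w) = shape w" using assms
  proof (induction w)
    case Nil
    then show ?case using p0 by simp
  next
    case (Cons i w)
    then have t: "ok (tile_at w)" "shape_of (tile_at w) = shape w" "i < arity (tile_at w)"
      by (auto simp: arity_shape)
    then show ?case using kid[OF t(1)] kids_shape[OF t(1) kid(1)[OF t(1)] t(3)] by simp
  qed
  then show "ok (tile_at w)" "shape_of (tile_at w) = shape w" by auto
qed

lemma word_Cons: "word m (i # w) \<longleftrightarrow> word m w \<and> i < arity (tile_at w)"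
  using tile_at(2)[of w] arity_shape[of "tile_at w"] by auto

lemma kids_at: "word m w \<Longrightarrow> kids (tile_at w) (\<lambda>i. tile_at (i # w)) (\<lambda>j. pt (w, j))"
  using kid(1)[OF tile_at(1), of w] by (simp add: pt_def)

primrec named :: "'a tile \<Rightarrow> (nat list \<times> nat) \<times> (nat list \<times> nat) \<Rightarrow> bool" where
  "named (TRoot p) l \<longleftrightarrow> True"
| "named (TLeaf a x) l \<longleftrightarrow> pt (fst l) = a"
| "named (TEdge a b sa sb) l \<longleftrightarrow> pt (fst l) = a \<and> pt (snd l) = b"

lemma named: "word m w \<Longrightarrow> named (tile_at w) (lab m w)"
proof (induction w)
  case (Cons i w)
  have w: "word m w" "i < arity (tile_at w)" using Cons.prems word_Cons[of i w] by auto
  note t = tile_at[OF w(1)]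
  note k = kids_at[OF w(1)]
  have IH: "named (tile_at w) (lab m w)" using Cons.IH w by simp
  show ?case
  proof (cases "tile_at w")
    case (TRoot p)
    obtain x where "pt (w, 0) = p" "\<And>i. i < 3 \<Longrightarrow> tile_at (i # w) = TLeaf p (x i)"
      using root_kids[of p "\<lambda>i. tile_at (i # w)" "\<lambda>j. pt (w, j)"] t(1) k TRoot by metis
    moreover have "shape w = SRoot" using t(2) TRoot by simp
    ultimately show ?thesis using w(2) TRoot by (simp del: tile_at.simps)
  next
    case (TLeaf a x)
    obtain y z where yz: "pt (w, 0) = x" "tile_at (0 # w) = TEdge a x (dist a x) (dist a x)"
        "tile_at (1 # w) = TLeaf x y" "tile_at (2 # w) = TLeaf x z"
      using leaf_kids[of a x "\<lambda>i. tile_at (i # w)" "\<lambda>j. pt (w, j)"] t(1) k TLeaf by metis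
    have "shape w = SLeaf" using t(2) TLeaf by simp
    moreover have "i = 0 \<or> i = 1 \<or> i = 2" using w(2) TLeaf by auto
    moreover have "pt (fst (lab m w)) = a" using IH TLeaf by simp
    ultimately show ?thesis using yz by (elim disjE) (simp_all del: tile_at.simps)
  next
    case (TEdge a b sa sb)
    let ?P = "\<lambda>j. pt (w, j)"
    obtain y where P: "cuts (Suc m) (\<epsilon> * dist a b) a b ?P" and
      e: "\<And>i. i \<le> m \<Longrightarrow> tile_at ((2 * i) # w) = edge_child sa sb ?P i" and
      h: "\<And>i. i \<in> {1..m} \<Longrightarrow> tile_at ((2 * i - 1) # w) = TLeaf (?P i) (y i)"
      using edge_kids[OF k[unfolded TEdge]] by metis
    have s: "shape w = SEdge" using t(2) TEdge by simp
    have ab: "pt (fst (lab m w)) = a" "pt (snd (lab m w)) = b" "?P 0 = a" "?P (Suc m) = b"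
      using IH TEdge cutsD(1,2)[OF P] by auto
    have i: "i < 2 * m + 1" using w(2) TEdge by simp
    show ?thesis
    proof (rule edge_idx[OF i])
      fix u assume u: "u \<le> m" "i = 2 * u"
      show ?thesis using e[OF u(1)] u s ab m by (simp del: tile_at.simps)
    next
      fix u assume u: "u \<in> {1..m}" "i = 2 * u - 1"
      then obtain v where v: "u = Suc v" by (cases u) auto
      show ?thesis using h[OF u(1)] u s v by (simp del: tile_at.simps)
    qed
  qed
qed simp

lemma ends_labs: assumes "word m w" shows "ends (tile_at w) = pt ` labs m w" "inj_on pt (labs m w)"
proof -
  have "ends (tile_at w) = pt ` labs m w \<and> inj_on pt (labs m w)"
  proof (cases "tile_at w")
    case (TEdge a b sa sb)
    then have "a \<noteq> b" "shape w = SEdge" using tile_at[OF assms] niceD(3)[of a b] by auto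
    then show ?thesis using named[OF assms] TEdge by (auto simp: labs_def)
  qed (use named[OF assms] tile_at[OF assms] in \<open>simp_all add: labs_def\<close>)
  then show "ends (tile_at w) = pt ` labs m w" "inj_on pt (labs m w)" by auto
qed

lemma labs_Cons:
  assumes "word m (i # w)" shows "labs m (i # w) \<subseteq> labs m w \<union> Pair w ` new_idx (tile_at w)"
proof -
  have w: "word m w" "i < arity (tile_at w)" using assms word_Cons[of i w] by auto
  note t = tile_at[OF w(1)]
  show ?thesis
  proof (cases "tile_at w")
    case (TRoot p)
    then show ?thesis using t(2) by (simp add: labs_def)
  next
    case (TLeaf a x)
    then show ?thesis using t(2) by (simp add: labs_def)
  next
    case (TEdge a b sa sb)
    then have s: "shape w = SEdge" using t(2) by simp
    have i: "i < 2 * m + 1" using w(2) TEdge by simp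
    show ?thesis
    proof (rule edge_idx[OF i])
      fix u assume u: "u \<le> m" "i = 2 * u"
      then show ?thesis using s TEdge by (auto simp: labs_def)
    next
      fix u assume u: "u \<in> {1..m}" "i = 2 * u - 1"
      then obtain v where v: "u = Suc v" by (cases u) auto
      then show ?thesis using s TEdge u by (auto simp: labs_def)
    qed
  qed
qed

text \<open>Old labels denote ends of the tile, new ones denote vertices that are not ends.
  Injectivity around one tile is what turns an equality of points into an equality of labels in
  \<open>X_Int\<close>.\<close>

lemma inj_labs_new:
  assumes w: "word m w" shows "inj_on pt (labs m w \<union> Pair w ` new_idx (tile_at w))"
proof -
  note t = tile_at(1)[OF w] and k = kids_at[OF w]
  have 1: "pt (w, j) \<notin> pt ` labs m w" if "j \<in> new_idx (tile_at w)" for j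
    using kids_new(2)[OF t k that] ends_labs(1)[OF w] by simp
  have 2: "j = j'" if "j \<in> new_idx (tile_at w)" "j' \<in> new_idx (tile_at w)" "pt (w, j) = pt (w, j')" for j j'
    using inj_onD[OF kids_new(5)[OF t k that(1)]] that by simp
  show ?thesis
  proof (rule inj_onI)
    fix l l' assume l: "l \<in> labs m w \<union> Pair w ` new_idx (tile_at w)" "l' \<in> labs m w \<union> Pair w ` new_idx (tile_at w)"
      and eq: "pt l = pt l'"
    show "l = l'"
    proof (cases "l \<in> labs m w")
      case True
      have "l' \<in> labs m w"
      proof (rule ccontr)
        assume "l' \<notin> labs m w"
        then obtain j where j: "l' = (w, j)" "j \<in> new_idx (tile_at w)" using l(2) by blast
        have "pt l \<in> pt ` labs m w" using True by (rule imageI)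
        then show False using 1[OF j(2)] eq j(1) by simp
      qed
      then show ?thesis using inj_onD[OF ends_labs(2)[OF w] eq] True by simp
    next
      case False
      then obtain j where j: "l = (w, j)" "j \<in> new_idx (tile_at w)" using l(1) by blast
      have "l' \<notin> labs m w"
      proof
        assume "l' \<in> labs m w"
        then have "pt l' \<in> pt ` labs m w" by (rule imageI)
        then show False using 1[OF j(2)] eq j(1) by simp
      qed
      then obtain j' where j': "l' = (w, j')" "j' \<in> new_idx (tile_at w)" using l(2) by blast
      then show ?thesis using 2[OF j(2) j'(2)] j j' eq by simp
    qed
  qed
qed

text \<open>Siblings meet only in common ends, which have common labels. For children of different
  tiles, induction makes a common point a vertex with a label shared by the parents; being an old
  vertex, it is an end of both children under the same label. So incidence does not depend on the
  tree.\<close>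

lemma X_Int:
  assumes "word m u" "word m w" "length u = length w" "u \<noteq> w"
  shows "X u \<inter> X w = pt ` (labs m u \<inter> labs m w)"
proof
  show "pt ` (labs m u \<inter> labs m w) \<subseteq> X u \<inter> X w"
    using ends_subset[OF tile_at(1)] ends_labs(1) assms by blast
  show "X u \<inter> X w \<subseteq> pt ` (labs m u \<inter> labs m w)"
    using assms
  proof (induction u arbitrary: w)
    case (Cons i u)
    then obtain j v where w: "w = j # v" "length u = length v" by (cases w) auto
    have u: "word m u" "i < arity (tile_at u)" "word m v" "j < arity (tile_at v)"
      using Cons.prems w word_Cons by auto
    note tu = tile_at(1)[OF u(1)] and ku = kids_at[OF u(1)]
    note tv = tile_at(1)[OF u(3)] and kv = kids_at[OF u(3)]
    show ?case
    proof (cases "u = v")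
      case True
      then have ij: "i \<noteq> j" "j < arity (tile_at u)" and wj: "word m (j # u)" using Cons.prems w u by auto
      have "X (i # u) \<inter> X (j # u) \<subseteq> ends (tile_at (i # u)) \<inter> ends (tile_at (j # u))"
        by (rule kids_Int[OF tu ku u(2) ij(2,1)])
      also have "\<dots> = pt ` labs m (i # u) \<inter> pt ` labs m (j # u)"
        using ends_labs(1)[OF Cons.prems(1)] ends_labs(1)[OF wj] by (simp only:)
      also have "\<dots> = pt ` (labs m (i # u) \<inter> labs m (j # u))"
        by (rule inj_on_image_Int[OF inj_labs_new[OF u(1)], symmetric])
          (use labs_Cons Cons.prems w True in auto)
      finally show ?thesis using w True by simp
    next
      case False
      show ?thesis
      proof
        fix x assume x: "x \<in> X (i # u) \<inter> X w"
        have "X (i # u) \<subseteq> X u" using kids_cover[OF tu ku] u(2) by auto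
        moreover have "X (j # v) \<subseteq> X v" using kids_cover[OF tv kv] u(4) by auto
        ultimately have "x \<in> X u \<inter> X v" using x w by auto
        then obtain l where l: "l \<in> labs m u" "l \<in> labs m v" "x = pt l"
          using Cons.IH[OF u(1,3) w(2) False] by auto
        have key: "l \<in> labs m (k # s)"
          if s: "word m s" "l \<in> labs m s" "k < arity (tile_at s)" "x \<in> X (k # s)" for k s
        proof -
          have "x \<in> ends (tile_at s)" using ends_labs(1)[OF s(1)] s(2) l(3) by auto
          then have "x \<in> ends (tile_at (k # s))"
            using kids_old_ends[OF tile_at(1)[OF s(1)] kids_at[OF s(1)] s(3)] s(4) by auto
          moreover have ks: "word m (k # s)" using s word_Cons by auto
          ultimately obtain l' where l': "l' \<in> labs m (k # s)" "x = pt l'" using ends_labs(1)[OF ks] by auto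
          then have "l = l'" using inj_onD[OF inj_labs_new[OF s(1)], of l l'] labs_Cons[OF ks] s(2) l(3) by auto
          then show ?thesis using l' by simp
        qed
        have "l \<in> labs m (i # u)" using key u l x by blast
        moreover have "l \<in> labs m (j # v)" using key u l x w by blast
        ultimately show "x \<in> pt ` (labs m (i # u) \<inter> labs m w)" using l w by auto
      qed
    qed
  qed simp
qed

lemma X_Int_ends:
  assumes "word m u" "word m w" "length u = length w" "u \<noteq> w"
  shows "X u \<inter> X w \<subseteq> ends (tile_at u) \<inter> ends (tile_at w)"
  using X_Int[OF assms] ends_labs(1) assms by auto

lemma X_child_subset: "word m (i # w) \<Longrightarrow> X (i # w) \<subseteq> X w"
  using kids_cover[OF tile_at(1) kids_at, of w] word_Cons by auto

lemma X_append_subset: "word m (v @ w) \<Longrightarrow> X (v @ w) \<subseteq> X w"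
proof (induction v)
  case (Cons i v)
  then show ?case using X_child_subset[of i "v @ w"] by auto
qed simp

lemma X_subset: "word m w \<Longrightarrow> X w \<subseteq> T"
  using carrier_subset tile_at by blast

lemma sz_child: "word m (i # w) \<Longrightarrow> \<eta> * sz (tile_at w) \<le> sz (tile_at (i # w))"
  using kids_sz(1)[OF tile_at(1) kids_at, of w i] word_Cons tile_at(1) by (metis word.simps(2))

section \<open>Comparison of tiles in one generation\<close>

text \<open>\<open>L' / \<eta>\<close> compares the sizes of siblings through their parent, and
  \<open>1 / \<theta>\<close> passes from size to target length.\<close>

definition B :: real where "B = L' / (\<theta> * \<eta>)"

lemma B: "B \<ge> 1" 
proof -
  have "\<theta> * \<eta> \<le> 1 * 1" using \<theta> \<eta>_bounds by (intro mult_mono) auto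
  then show ?thesis using L'1 \<theta> \<eta>_bounds unfolding B_def by (simp add: field_simps)
qed

text \<open>When two addresses first differ, the tiles are siblings and comparable through their
  parent. Afterwards both target lengths at \<open>x\<close> are multiplied by exactly
  \<open>\<theta>\<close> in each generation, so one constant lasts for all generations.\<close>

lemma sc_comparable:
  assumes "word m u" "word m w" "length u = length w" "x \<in> ends (tile_at u)" "x \<in> ends (tile_at w)"
  shows "sc (tile_at u) x \<le> B * sc (tile_at w) x"
  using assms
proof (induction u arbitrary: w)
  case (Cons i u)
  then obtain j v where w: "w = j # v" "length u = length v" by (cases w) auto
  have u: "word m u" "i < arity (tile_at u)" "word m v" "j < arity (tile_at v)" "word m (j # v)"
    using Cons.prems w word_Cons by auto
  note tu = tile_at(1)[OF u(1)] and ku = kids_at[OF u(1)]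
  note tv = tile_at(1)[OF u(3)] and kv = kids_at[OF u(3)]
  note ti = tile_at(1)[OF Cons.prems(1)] and tj = tile_at(1)[OF u(5)]
  show ?case
  proof (cases "u = v")
    case True
    have "sz (tile_at (i # u)) \<le> diameter (X (i # u))" by (rule sz_bounds(1)[OF ti])
    also have "\<dots> \<le> diameter (X u)"
      using diam_mono X_child_subset[OF Cons.prems(1)] X_subset[OF u(1)] by auto
    also have "\<dots> \<le> L' * sz (tile_at u)" by (rule sz_bounds(2)[OF tu])
    finally have 1: "sz (tile_at (i # u)) \<le> L' * sz (tile_at u)" .
    have 2: "\<eta> * sz (tile_at u) \<le> sc (tile_at (j # v)) x"
      using sz_child[OF u(5)] sc_bounds(1)[OF tj, of x] Cons.prems w True by (simp del: tile_at.simps)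
    have "sc (tile_at (i # u)) x \<le> sz (tile_at (i # u)) / \<theta>" using sc_bounds(2)[OF ti] Cons.prems by auto
    also have "\<dots> \<le> L' * sz (tile_at u) / \<theta>" using 1 \<theta> by (intro divide_right_mono) auto
    also have "\<dots> = B * (\<eta> * sz (tile_at u))" using \<eta>_bounds(1) by (simp add: B_def)
    also have "\<dots> \<le> B * sc (tile_at (j # v)) x" using 2 B by (intro mult_left_mono) auto
    finally show ?thesis using w by (simp del: tile_at.simps)
  next
    case False
    have "x \<in> X (i # u)" "x \<in> X (j # v)" using ends_subset[OF ti] ends_subset[OF tj] Cons.prems w by blast+
    then have "x \<in> X u \<inter> X v" using X_child_subset Cons.prems(1) u(5) by blast
    then have x: "x \<in> ends (tile_at u)" "x \<in> ends (tile_at v)" using X_Int_ends[OF u(1,3) w(2) False] by auto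
    have "sc (tile_at (i # u)) x = \<theta> * sc (tile_at u) x" using kids_sc[OF tu ku u(2) x(1)] Cons.prems by auto
    moreover have "sc (tile_at (j # v)) x = \<theta> * sc (tile_at v) x"
      using kids_sc[OF tv kv u(4) x(2)] Cons.prems w by auto
    moreover have "sc (tile_at u) x \<le> B * sc (tile_at v) x" by (rule Cons.IH[OF u(1,3) w(2) x])
    ultimately show ?thesis using \<theta> w by (simp del: tile_at.simps)
  qed
qed simp

definition A1 :: real where "A1 = L' * B / \<theta>"

lemma A1: "A1 \<ge> 1"
proof -
  have "1 * 1 \<le> L' * B" using L'1 B by (intro mult_mono) auto
  then show ?thesis using \<theta> unfolding A1_def by (simp add: field_simps)
qed

text \<open>The tiles share an end \<open>x\<close>, and the diameter of either one is comparable to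
  its target length at \<open>x\<close>.\<close>

lemma X_adjacent:
  assumes "word m u" "word m w" "length u = length w" "X u \<inter> X w \<noteq> {}"
  shows "diameter (X u) \<le> A1 * diameter (X w)"
proof (cases "u = w")
  case True
  have "0 \<le> diameter (X w)" using sz_bounds(1) sz_pos tile_at(1)[OF assms(2)] by force
  then show ?thesis using True A1 mult_right_mono[of 1 A1 "diameter (X w)"] by simp
next
  case False
  note tu = tile_at(1)[OF assms(1)] and tw = tile_at(1)[OF assms(2)]
  obtain x where x: "x \<in> ends (tile_at u)" "x \<in> ends (tile_at w)"
    using X_Int_ends[OF assms(1-3) False] assms(4) by blast
  have "diameter (X u) \<le> L' * sc (tile_at u) x"
    using sz_bounds(2)[OF tu] mult_left_mono[OF sc_bounds(1)[OF tu x(1)], of L'] L'1 by linarith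
  also have "\<dots> \<le> L' * (B * sc (tile_at w) x)"
    using sc_comparable[OF assms(1-3) x] L'1 by (intro mult_left_mono) auto
  also have "\<dots> \<le> L' * (B * (sz (tile_at w) / \<theta>))"
    using sc_bounds(2)[OF tw x(2)] L'1 B by (intro mult_left_mono) auto
  also have "\<dots> \<le> L' * (B * (diameter (X w) / \<theta>))"
    using sz_bounds(1)[OF tw] L'1 B \<theta> by (intro mult_left_mono divide_right_mono) auto
  finally show ?thesis by (simp add: A1_def)
qed

lemma X_cover: "T = (\<Union>w\<in>{w. word m w \<and> length w = n}. X w)"
proof (induction n)
  case 0
  have "{w. word m w \<and> length w = 0} = {[]}" by auto
  then show ?case by simp
next
  case (Suc n)
  show ?case
  proof
    show "(\<Union>w\<in>{w. word m w \<and> length w = Suc n}. X w) \<subseteq> T" using X_subset by auto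
    show "T \<subseteq> (\<Union>w\<in>{w. word m w \<and> length w = Suc n}. X w)"
    proof
      fix x assume "x \<in> T"
      then obtain w where w: "word m w" "length w = n" "x \<in> X w" using Suc by auto
      then obtain i where "i < arity (tile_at w)" "x \<in> X (i # w)"
        using kids_cover[OF tile_at(1) kids_at, of w] by auto
      then show "x \<in> (\<Union>w\<in>{w. word m w \<and> length w = Suc n}. X w)"
        using w word_Cons[of i w] by (intro UN_I[of "i # w"]) auto
    qed
  qed
qed

text \<open>Follow the arc from \<open>x\<close> to \<open>y\<close>. The first tile entered after leaving \<open>X u\<close> for the last time
  is crossed from one of its ends to another.\<close>

lemma X_separated:
  assumes u: "word m u" and w: "word m w" and len: "length u = length w" and disj: "X u \<inter> X w = {}"
    and x: "x \<in> X u" and y: "y \<in> X w"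
  shows "diameter (X u) \<le> A1 * L' * K * dist x y"
proof -
  note tu = tile_at(1)[OF u] and tw = tile_at(1)[OF w]
  have xT: "x \<in> T" and yT: "y \<in> T" using x y X_subset u w by auto
  have yu: "y \<notin> X u" and xy: "x \<noteq> y" using disj x y by auto
  obtain g where g: "arc g" "g 0 = x" "g 1 = y" "path_image g = seg x y" "path_image g \<subseteq> T"
    using seg_param xT yT xy by metis
  have cont: "continuous_on {0..1} g" and inj: "inj_on g {0..1}" using g(1) by (auto simp: arc_def path_def)
  have clX: "closed (X v)" if "word m v" for v using compact_imp_closed[OF compact_carrier[OF tile_at(1)[OF that]]] .
  define D where "D = {0..1} \<inter> g -` X u"
  have "closed D" unfolding D_def
    using clX[OF u] cont by (intro continuous_closed_preimage) auto
  then have "compact D" using compact_Int_closed[of "{0..1}" D] by (simp add: D_def Int_absorb1 Int_left_absorb)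
  moreover have "0 \<in> D" unfolding D_def using g x by simp
  ultimately obtain s where s: "s \<in> D" "\<And>t. t \<in> D \<Longrightarrow> t \<le> s" using compact_attains_sup[of D] by auto
  have s01: "0 \<le> s" "s < 1" using s(1) g yu unfolding D_def by (auto simp: less_le)
  define z where "z = g s"
  have zu: "z \<in> X u" using s(1) by (simp add: D_def z_def)
  have zT: "z \<in> T" using zu X_subset u by auto
  have after: "g t \<notin> X u" if "s < t" "t \<le> 1" for t using s(2)[of t] that s01 by (auto simp: D_def)
  have zseg: "z \<in> seg x y" using g(4) s01 by (auto simp: path_image_def z_def)
  have zy: "seg z y = g ` {s..1}" using seg_subarc[of g s 1] g s01 by (simp add: z_def)
  have z: "z \<in> ends (tile_at u)"
  proof -
    obtain e where e: "e \<in> ends (tile_at u)" "e \<in> seg z y" using carrier_exit[OF tu zu yT yu] by blast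
    then obtain t where t: "s \<le> t" "t \<le> 1" "e = g t" using zy by auto
    have "e \<in> X u" using e ends_subset[OF tu] by auto
    then have "t = s" using after[of t] t by force
    then show ?thesis using e t by (simp add: z_def)
  qed
  let ?W = "{v. word m v \<and> length v = length u}"
  \<comment> \<open>Finitely many tiles cover the part of the arc after \<open>z\<close>, so one of
    them accumulates at \<open>z\<close> and, being closed, contains it.\<close>
  obtain v where v: "v \<in> ?W" "z \<in> closure (g ` {s<..1} \<inter> X v)"
  proof -
    have "g ` closure {s<..1} \<subseteq> closure (g ` {s<..1})"
    proof (rule image_closure_subset)
      show "continuous_on (closure {s<..1}) g"
        using cont s01 by (auto intro: continuous_on_subset)
    qed (simp_all add: closure_subset)
    then have "z \<in> closure (g ` {s<..1})" using s01 by (auto simp: z_def)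
    also have "g ` {s<..1} = (\<Union>v\<in>?W. g ` {s<..1} \<inter> X v)"
    proof -
      have "g ` {s<..1} \<subseteq> T" using g(5) s01 by (auto simp: path_image_def)
      then show ?thesis using X_cover[of "length u"] by blast
    qed
    finally have "z \<in> closure (\<Union>v\<in>?W. g ` {s<..1} \<inter> X v)" .
    moreover have "closure (\<Union>v\<in>?W. g ` {s<..1} \<inter> X v) \<subseteq> (\<Union>v\<in>?W. closure (g ` {s<..1} \<inter> X v))"
      by (rule closure_minimal[OF UN_mono[OF order_refl closure_subset]])
        (intro closed_UN finite_words ballI closed_closure)
    ultimately show thesis using that by blast
  qed
  have wv: "word m v" "length v = length u" using v(1) by auto
  note tv = tile_at(1)[OF wv(1)]
  have "closure (g ` {s<..1} \<inter> X v) \<subseteq> X v" using clX[OF wv(1)] by (intro closure_minimal) auto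
  then have zv: "z \<in> X v" using v(2) by auto
  have "g ` {s<..1} \<inter> X v \<noteq> {}" using v(2) by auto
  then obtain t where t: "s < t" "t \<le> 1" "g t \<in> X v" by auto
  have uv: "u \<noteq> v" using after[OF t(1,2)] t(3) by auto
  have zev: "z \<in> ends (tile_at v)" using X_Int_ends[OF u wv(1) _ uv] wv zu zv by auto
  \<comment> \<open>If \<open>y\<close> lies in \<open>X v\<close>, it is common to
    \<open>X v\<close> and \<open>X w\<close> and hence an end. Otherwise the arc has to leave
    \<open>X v\<close> through an end after the parameter \<open>t\<close>.\<close>
  have "\<exists>e\<in>ends (tile_at v). e \<in> seg x y \<and> e \<noteq> z"
  proof (cases "y \<in> X v")
    case True
    have "w \<noteq> v" using zv zu disj by auto
    then have "y \<in> ends (tile_at v)" using X_Int_ends[OF w wv(1)] wv len y True by auto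
    then show ?thesis using ends_in_seg[OF xT yT] zu yu by blast
  next
    case False
    obtain e where e: "e \<in> ends (tile_at v)" "e \<in> seg (g t) y" using carrier_exit[OF tv t(3) yT False] by blast
    have "seg (g t) y = g ` {t..1}" using seg_subarc[of g t 1] g s01 t by simp
    then obtain r where r: "t \<le> r" "r \<le> 1" "e = g r" using e by auto
    have "e \<in> seg x y" using r t s01 g(4) by (auto simp: path_image_def)
    moreover have "e \<noteq> z" using inj_onD[OF inj, of r s] r t s01 by (auto simp: z_def)
    ultimately show ?thesis using e by auto
  qed
  then obtain e where e: "e \<in> ends (tile_at v)" "e \<in> seg x y" "e \<noteq> z" by blast
  \<comment> \<open>Two different ends force \<open>v\<close> to be an edge tile, and its size is
    their distance.\<close>
  have "sz (tile_at v) = dist z e" using e zev by (cases "tile_at v") (auto simp: dist_commute)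
  also have "\<dots> \<le> K * dist x y" using dist_in_seg[OF xT yT zseg e(2)] .
  finally have szv: "sz (tile_at v) \<le> K * dist x y" .
  have "diameter (X u) \<le> A1 * diameter (X v)" using X_adjacent[OF u wv(1)] wv zu zv by auto
  also have "\<dots> \<le> A1 * (L' * sz (tile_at v))" using sz_bounds(2)[OF tv] A1 by (intro mult_left_mono) auto
  also have "\<dots> \<le> A1 * (L' * (K * dist x y))" using szv A1 L'1 by (intro mult_left_mono) auto
  finally show ?thesis by (simp add: mult.assoc)
qed

lemma X_child: assumes "word m (i # w)" shows "diameter (X w) \<le> L' / \<eta> * diameter (X (i # w))"
proof -
  have w: "word m w" using assms by simp
  have "diameter (X w) \<le> L' * sz (tile_at w)" by (rule sz_bounds(2)[OF tile_at(1)[OF w]])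
  also have "\<dots> = L' / \<eta> * (\<eta> * sz (tile_at w))" using \<eta>_bounds(1) by simp
  also have "\<dots> \<le> L' / \<eta> * sz (tile_at (i # w))"
    using sz_child[OF assms] L'1 \<eta>_bounds(1) by (intro mult_left_mono) auto
  also have "\<dots> \<le> L' / \<eta> * diameter (X (i # w))"
    using sz_bounds(1)[OF tile_at(1)[OF assms]] L'1 \<eta>_bounds(1) by (intro mult_left_mono) auto
  finally show ?thesis .
qed

section \<open>Geometric decay\<close>

definition inner :: "nat list \<Rightarrow> 'a set" where
  "inner w = X w - ends (tile_at w)"

text \<open>Any new vertex would serve; taking the least index merely fixes one.\<close>

definition center :: "nat list \<Rightarrow> 'a" where
  "center w = pt (w, Min (new_idx (tile_at w)))"

lemma center:
  assumes w: "word m w"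
  shows "center w \<in> inner w" "bp (center w)" "\<eta> * sz (tile_at w) \<le> H (center w)"
    "\<And>i. word m (i # w) \<Longrightarrow> center w \<notin> inner (i # w)"
proof -
  note t = tile_at(1)[OF w] and k = kids_at[OF w]
  have "new_idx (tile_at w) \<noteq> {}" "finite (new_idx (tile_at w))" using m by (cases "tile_at w"; simp)+
  then have i: "Min (new_idx (tile_at w)) \<in> new_idx (tile_at w)" by simp
  show "center w \<in> inner w" "bp (center w)" using kids_new[OF t k i] by (auto simp: center_def inner_def)
  have "ok (tile_at (i # w))" if "i < arity (tile_at w)" for i using tile_at(1)[of "i # w"] word_Cons w that by blast
  then show "\<eta> * sz (tile_at w) \<le> H (center w)" using kids_sz(2)[OF t k _ i] by (simp add: center_def)
  show "center w \<notin> inner (i # w)" if "word m (i # w)" for i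
    using kids_new(4)[OF t k i, of i] that word_Cons[of i w] by (auto simp: center_def inner_def)
qed

lemma inner_child: assumes "word m (i # w)" shows "inner (i # w) \<subseteq> inner w"
proof -
  have w: "word m w" "i < arity (tile_at w)" using assms word_Cons by auto
  show ?thesis
    using X_child_subset[OF assms] kids_old_ends[OF tile_at(1)[OF w(1)] kids_at[OF w(1)] w(2)]
    by (auto simp: inner_def)
qed

text \<open>The centre of a tile is an end of every child containing it, whereas the centres of
  descendants lie in the inner parts of children. Hence the centres along a chain are distinct; the
  clause about \<open>inner\<close> is the invariant that shows this in the induction.\<close>

lemma centers_along:
  assumes "word m (v @ w)"
  shows "\<exists>V. card V = length v \<and> finite V \<and>
    (\<forall>p\<in>V. bp p \<and> p \<in> X w \<and> p \<notin> inner (v @ w) \<and> \<eta> / L' * diameter (X (v @ w)) \<le> H p)"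
  using assms
proof (induction v)
  case (Cons i v)
  then obtain V where V: "card V = length v" "finite V"
      "\<And>p. p \<in> V \<Longrightarrow> bp p \<and> p \<in> X w \<and> p \<notin> inner (v @ w) \<and> \<eta> / L' * diameter (X (v @ w)) \<le> H p"
    by auto
  have vw: "word m (v @ w)" "word m (i # v @ w)" using Cons by auto
  note ce = center[OF vw(1)]
  have d: "diameter (X (i # v @ w)) \<le> diameter (X (v @ w))"
    using diam_mono X_child_subset[OF vw(2)] X_subset[OF vw(1)] by auto
  have "\<eta> / L' * diameter (X (v @ w)) \<le> \<eta> * sz (tile_at (v @ w))"
    using mult_left_mono[OF sz_bounds(2)[OF tile_at(1)[OF vw(1)]], of "\<eta> / L'"] L'1 \<eta>_bounds(1) by simp
  then have Hc: "\<eta> / L' * diameter (X (v @ w)) \<le> H (center (v @ w))" using ce(3) by linarith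
  have e: "\<eta> / L' * diameter (X (i # v @ w)) \<le> \<eta> / L' * diameter (X (v @ w))"
    using d L'1 \<eta>_bounds(1) by (intro mult_left_mono) auto
  have new: "center (v @ w) \<notin> V" using V(3) ce(1) by blast
  have cX: "center (v @ w) \<in> X w" using ce(1) X_append_subset[OF vw(1)] by (auto simp: inner_def)
  show ?case
  proof (intro exI[of _ "insert (center (v @ w)) V"] conjI ballI)
    fix p assume p: "p \<in> insert (center (v @ w)) V"
    show "bp p" "p \<in> X w" using p V(3) ce(2) cX by auto
    show "p \<notin> inner ((i # v) @ w)" using p V(3) ce(4)[OF vw(2)] inner_child[OF vw(2)] by auto
    show "\<eta> / L' * diameter (X ((i # v) @ w)) \<le> H p" using p V(3)[of p] Hc e by (auto simp del: tile_at.simps)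
  qed (use V new in auto)
qed (auto intro: exI[of _ "{}"])

text \<open>If the diameter did not halve along a long chain, the centres of the chain would be too
  many branch points of height comparable to \<open>diameter (X w)\<close> inside
  \<open>X w\<close>.\<close>

lemma X_halving:
  obtains N where "N > 0" "\<And>v w. \<lbrakk>word m (v @ w); length v = N\<rbrakk> \<Longrightarrow> diameter (X (v @ w)) \<le> diameter (X w) / 2"
proof -
  let ?Q = "2 * L' / \<eta>"
  obtain N :: nat where N: "\<And>V \<delta>. \<lbrakk>\<delta> > 0; \<And>v. v \<in> V \<Longrightarrow> bp v \<and> \<delta> \<le> H v;
      \<And>v w. \<lbrakk>v \<in> V; w \<in> V\<rbrakk> \<Longrightarrow> dist v w \<le> ?Q * \<delta>\<rbrakk> \<Longrightarrow> finite V \<and> card V \<le> N"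
    using card_high_branch_points[of ?Q] by blast
  show thesis
  proof (rule that[of "Suc N"])
    fix v w assume vw: "word m (v @ w)" "length v = Suc N"
    show "diameter (X (v @ w)) \<le> diameter (X w) / 2"
    proof (rule ccontr)
      assume n: "\<not> diameter (X (v @ w)) \<le> diameter (X w) / 2"
      have w: "word m w" using word_append vw by auto
      have dw: "diameter (X w) > 0" using sz_bounds(1)[OF tile_at(1)[OF w]] sz_pos[OF tile_at(1)[OF w]] by linarith
      \<comment> \<open>Chosen so that \<open>?Q * \<delta> = diameter (X w)\<close>.\<close>
      define \<delta> where "\<delta> = \<eta> / L' * (diameter (X w) / 2)"
      have \<delta>: "\<delta> > 0" using dw L'1 \<eta>_bounds(1) by (simp add: \<delta>_def)
      obtain V where V: "card V = length v" "finite V"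
        "\<And>p. p \<in> V \<Longrightarrow> bp p \<and> p \<in> X w \<and> \<eta> / L' * diameter (X (v @ w)) \<le> H p"
        using centers_along[OF vw(1)] by blast
      have "\<delta> \<le> \<eta> / L' * diameter (X (v @ w))"
        unfolding \<delta>_def using n L'1 \<eta>_bounds(1) by (intro mult_left_mono) auto
      then have "\<And>p. p \<in> V \<Longrightarrow> bp p \<and> \<delta> \<le> H p" using V(3) by force
      moreover have "dist p q \<le> ?Q * \<delta>" if "p \<in> V" "q \<in> V" for p q
      proof -
        have "dist p q \<le> diameter (X w)" using dist_le_diameter[of p "X w" q] V(3) that X_subset[OF w] by auto
        also have "\<dots> = ?Q * \<delta>" using L'1 \<eta>_bounds(1) by (simp add: \<delta>_def)
        finally show ?thesis .
      qed
      ultimately have "card V \<le> N" using N[OF \<delta>] by blast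
      then show False using V(1) vw(2) by simp
    qed
  qed simp
qed

lemma X_decay:
  obtains \<rho> where "0 < \<rho>" "\<rho> < 1"
    "\<And>v w. word m (v @ w) \<Longrightarrow> diameter (X (v @ w)) \<le> 2 * \<rho> ^ length v * diameter (X w)"
proof -
  obtain N where N: "N > 0" "\<And>v w. \<lbrakk>word m (v @ w); length v = N\<rbrakk> \<Longrightarrow> diameter (X (v @ w)) \<le> diameter (X w) / 2"
    using X_halving by blast
  \<comment> \<open>One block of \<open>N\<close> generations then contributes exactly the factor
    1/2, and the constant 2 in the claim pays for an incomplete block.\<close>
  define \<rho> where "\<rho> = root N (1 / 2)"
  have \<rho>: "0 < \<rho>" "\<rho> < 1" "\<rho> ^ N = 1 / 2" using N(1) by (auto simp: \<rho>_def)
  have "diameter (X (v @ w)) \<le> 2 * \<rho> ^ length v * diameter (X w)" if "word m (v @ w)" for v w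
    using that
  proof (induction "length v" arbitrary: v rule: less_induct)
    case less
    have w: "word m w" using word_append less.prems by auto
    have dw: "diameter (X w) \<ge> 0" using sz_bounds(1)[OF tile_at(1)[OF w]] sz_pos[OF tile_at(1)[OF w]] by linarith
    show ?case
    proof (cases "length v < N")
      case True
      have "diameter (X (v @ w)) \<le> diameter (X w)"
        using diam_mono X_append_subset[OF less.prems] X_subset[OF w] by auto
      moreover have "\<rho> ^ N \<le> \<rho> ^ length v" using \<rho> True by (intro power_decreasing) auto
      then have "1 \<le> 2 * \<rho> ^ length v" using \<rho>(3) by simp
      then have "1 * diameter (X w) \<le> 2 * \<rho> ^ length v * diameter (X w)" using dw by (intro mult_right_mono) auto
      ultimately show ?thesis by simp
    next
      case False
      define a b where "a = take N v" and "b = drop N v"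
      have ab: "v = a @ b" "length a = N" "length b = length v - N" using False by (auto simp: a_def b_def)
      have abw: "word m (a @ b @ w)" using less.prems ab(1) by simp
      have bw: "word m (b @ w)" by (rule word_append[OF abw])
      have lb: "length b < length v" using ab(3) N(1) False by linarith
      have "diameter (X (v @ w)) \<le> diameter (X (b @ w)) / 2" using N(2)[OF abw ab(2)] ab(1) by simp
      also have "\<dots> \<le> (2 * \<rho> ^ length b * diameter (X w)) / 2"
        by (rule divide_right_mono[OF less.hyps[OF lb bw]]) simp
      also have "\<dots> = 2 * (\<rho> ^ N * \<rho> ^ length b) * diameter (X w)" using \<rho>(3) by simp
      also have "\<rho> ^ N * \<rho> ^ length b = \<rho> ^ length v" using ab False by (simp add: power_add[symmetric])
      finally show ?thesis .
    qed
  qed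
  then show thesis using that \<rho> by blast
qed

lemma tiling_exists: "\<exists>A \<rho>. tiling {w. word m w} X T A \<rho>"
proof -
  obtain \<rho> where \<rho>: "0 < \<rho>" "\<rho> < 1"
    "\<And>v w. word m (v @ w) \<Longrightarrow> diameter (X (v @ w)) \<le> 2 * \<rho> ^ length v * diameter (X w)"
    using X_decay by blast
  define A where "A = 2 + A1 + A1 * L' * K + L' / \<eta>"
  have "0 \<le> A1 * L' * K" "0 \<le> L' / \<eta>" using A1 L'1 K \<eta>_bounds(1) by auto
  then have A: "A \<ge> 2" "A \<ge> A1" "A \<ge> A1 * L' * K" "A \<ge> L' / \<eta>" using A1 by (auto simp: A_def)
  have pos: "diameter (X w) > 0" if "word m w" for w
    using sz_bounds(1)[OF tile_at(1)[OF that]] sz_pos[OF tile_at(1)[OF that]] by linarith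
  have "tiling {w. word m w} X T A \<rho>"
  proof (unfold_locales; (unfold mem_Collect_eq)?)
    fix w assume w: "word m w"
    have "X w = (\<Union>i<arity (tile_at w). X (i # w))" using kids_cover[OF tile_at(1) kids_at] w by auto
    also have "{..<arity (tile_at w)} = {i. word m (i # w)}" using word_Cons w by auto
    finally show "X w = (\<Union>i\<in>{i. word m (i # w)}. X (i # w))" .
  next
    fix u w assume "word m u" "word m w" "length u = length w" "X u \<inter> X w \<noteq> {}"
    then show "diameter (X u) \<le> A * diameter (X w)"
      using X_adjacent[of u w] mult_right_mono[OF A(2) less_imp_le[OF pos[of w]]] by linarith
  next
    fix u w x y assume "word m u" "word m w" "length u = length w" "X u \<inter> X w = {}" "x \<in> X u" "y \<in> X w"
    then show "diameter (X u) \<le> A * dist x y"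
      using X_separated[of u w x y] mult_right_mono[OF A(3) zero_le_dist[of x y]] by linarith
  next
    fix i w assume "word m (i # w)"
    then show "diameter (X w) \<le> A * diameter (X (i # w))"
      using X_child[of i w] mult_right_mono[OF A(4) less_imp_le[OF pos[of "i # w"]]] by linarith
  next
    fix v w assume vw: "word m (v @ w)"
    have "2 * (\<rho> ^ length v * diameter (X w)) \<le> A * (\<rho> ^ length v * diameter (X w))"
      using A(1) \<rho> pos[OF word_append[OF vw]] by (intro mult_right_mono) auto
    then show "diameter (X (v @ w)) \<le> A * \<rho> ^ length v * diameter (X w)" using \<rho>(3)[OF vw] by (simp add: mult.assoc)
  qed (use A \<rho> compact_T compact_imp_closed[OF compact_carrier[OF tile_at(1)]] pos in auto)
  then show ?thesis by blast
qed

end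

section \<open>Common constants and conclusion\<close>

text \<open>The two trees come with different constants; passing to the maxima makes their tilings a
  \<open>tiling_pair\<close>.\<close>

lemma tiling_weaken:
  assumes "tiling W X S A \<rho>" "A \<le> A'" "\<rho> \<le> \<rho>'" "\<rho>' < 1" shows "tiling W X S A' \<rho>'"
proof -
  interpret tiling W X S A \<rho> by fact
  have A0: "0 < A" "0 < A'" using A assms by auto
  have d: "A * diameter (X w) \<le> A' * diameter (X w)" if "w \<in> W" for w
    using assms diam_pos[OF that] by (intro mult_right_mono) auto
  show ?thesis
  proof
    fix u w assume "u \<in> W" "w \<in> W" "length u = length w" "X u \<inter> X w \<noteq> {}"
    then show "diameter (X u) \<le> A' * diameter (X w)" using adjacent d by (meson order_trans)
  next
    fix u w x y assume "u \<in> W" "w \<in> W" "length u = length w" "X u \<inter> X w = {}" "x \<in> X u" "y \<in> X w"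
    then show "diameter (X u) \<le> A' * dist x y"
      using separated assms(2) by (meson mult_right_mono order_trans zero_le_dist)
  next
    fix i w assume "i # w \<in> W"
    then show "diameter (X w) \<le> A' * diameter (X (i # w))" using child d by (meson order_trans)
  next
    fix v w assume vw: "v @ w \<in> W"
    have "A * \<rho> ^ length v \<le> A' * \<rho>' ^ length v"
      using assms A0 \<rho> by (intro mult_mono power_mono) auto
    then have "A * \<rho> ^ length v * diameter (X w) \<le> A' * \<rho>' ^ length v * diameter (X w)"
      using diam_pos[OF append_mem[OF vw]] by (intro mult_right_mono) auto
    then show "diameter (X (v @ w)) \<le> A' * \<rho>' ^ length v * diameter (X w)" using decay[OF vw] by linarith
  next
    show "1 < A'" "0 < \<rho>'" "\<rho>' < 1" using A \<rho> assms by auto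
  qed (fact compact Nil_mem tl_mem root cover closed diam_pos)+
qed

text \<open>The right-hand side of the equivalence mentions no tree, so two models with the same
  \<open>m\<close> have the same incidences. The case \<open>u = w\<close> is excluded because the
  root has no labels and still meets itself.\<close>

definition modelled :: "nat \<Rightarrow> 'a::metric_space set \<Rightarrow> bool" where
  "modelled m T \<longleftrightarrow> (\<exists>X A \<rho>. tiling {w. word m w} X T A \<rho> \<and>
    (\<forall>u w. word m u \<and> word m w \<and> length u = length w \<and> u \<noteq> w \<longrightarrow>
      (X u \<inter> X w = {} \<longleftrightarrow> labs m u \<inter> labs m w = {})))"

lemma universal_tiling:
  fixes T :: "'a::metric_space set"
  assumes "quasiconformal_tree T" "trivalent T" "uniformly_branching T"
  shows "\<exists>m0. \<forall>m\<ge>m0. modelled m T"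
proof -
  have mt: "metric_tree T" and db: "doubling T" using assms(1) by (auto simp: quasiconformal_tree_def)
  obtain K where K: "K \<ge> 1" "\<And>x y. \<lbrakk>x \<in> T; y \<in> T\<rbrakk> \<Longrightarrow> diameter (tree_arc T x y) \<le> K * dist x y"
    using assms(1) unfolding quasiconformal_tree_def bounded_turning_def by blast
  obtain C1 where C1: "C1 > 0" "\<And>p q. \<lbrakk>branch_point T p; branch_point T q; p \<noteq> q\<rbrakk> \<Longrightarrow>
      1 / C1 * min (height T p) (height T q) \<le> dist p q"
    using assms(3) unfolding uniformly_branching_def uniformly_relatively_separated_branch_points_def by blast
  obtain C2 where C2: "C2 > 0" "\<And>x y. \<lbrakk>x \<in> T; y \<in> T; x \<noteq> y\<rbrakk> \<Longrightarrow>
      \<exists>p\<in>tree_arc T x y. branch_point T p \<and> 1 / C2 * dist x y \<le> height T p"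
    using assms(3) unfolding uniformly_branching_def uniformly_relatively_dense_branch_points_def by blast
  define C where "C = max 1 (max C1 C2)"
  have sep: "min (height T p) (height T q) \<le> C * dist p q" if "branch_point T p" "branch_point T q" "p \<noteq> q" for p q
  proof -
    have "min (height T p) (height T q) \<le> C1 * dist p q" using C1(2)[OF that] C1(1) by (simp add: field_simps)
    also have "\<dots> \<le> C * dist p q" by (intro mult_right_mono) (auto simp: C_def)
    finally show ?thesis .
  qed
  have dense: "\<exists>p\<in>tree_arc T x y. branch_point T p \<and> dist x y \<le> C * height T p"
    if xy: "x \<in> T" "y \<in> T" "x \<noteq> y" for x y
  proof -
    obtain p where p: "p \<in> tree_arc T x y" "branch_point T p" "1 / C2 * dist x y \<le> height T p"
      using C2(2)[OF xy] by blast
    have h: "0 \<le> height T p" by (rule order_trans[OF _ p(3)]) (use C2(1) in simp)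
    have "dist x y \<le> C2 * height T p" using p(3) C2(1) by (simp add: field_simps)
    also have "\<dots> \<le> C * height T p" using h by (intro mult_right_mono) (auto simp: C_def)
    finally show ?thesis using p by blast
  qed
  obtain x y where "x \<in> T" "y \<in> T" "x \<noteq> y" using mt by (auto simp: metric_tree_def)
  then obtain p0 where p0: "branch_point T p0" "dist x y \<le> C * height T p0" using dense by blast
  have C: "C \<ge> 1" by (simp add: C_def)
  have "0 < C * height T p0" using p0(2) \<open>x \<noteq> y\<close> by (smt (verit) zero_less_dist_iff)
  then have h0: "height T p0 > 0" using C by (simp add: zero_less_mult_iff)
  \<comment> \<open>The second entry makes the whole tree an admissible root tile, to be cut at
    \<open>p0\<close>.\<close>
  define M where "M = max (4 * C) (diameter T / height T p0)"
  interpret branching_tree T K C M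
    by unfold_locales (use mt db K C sep dense assms(2) in \<open>auto simp: M_def\<close>)
  have Mp0: "diameter T \<le> M * height T p0"
    using h0 mult_right_mono[of "diameter T / height T p0" M "height T p0"] by (simp add: M_def)
  obtain m0 where m0: "\<And>m a b sa sb. \<lbrakk>m \<ge> m0; nice a b \<and> c * sa \<le> dist a b \<and> dist a b \<le> sa \<and>
      c * sb \<le> dist a b \<and> dist a b \<le> sb\<rbrakk> \<Longrightarrow>
    divisible m a b sa sb"
    using subdivision by blast
  show ?thesis
  proof (rule exI[of _ "max 1 m0"], intro allI impI)
    fix m assume m: "max 1 m0 \<le> m"
    interpret st: subdivided_tree T K C M m p0
      by unfold_locales (use m0[of m] m p0 Mp0 in auto)
    obtain A \<rho> where t: "tiling {w. word m w} st.X T A \<rho>" using st.tiling_exists by blast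
    have "st.X u \<inter> st.X w = {} \<longleftrightarrow> labs m u \<inter> labs m w = {}"
      if "word m u" "word m w" "length u = length w" "u \<noteq> w" for u w
      using st.X_Int[OF that] by simp
    then show "modelled m T" unfolding modelled_def using t by blast
  qed
qed

theorem corollary1p5:
  fixes S :: "'a::metric_space set" and T :: "'b::metric_space set"
  assumes "quasiconformal_tree S" and "trivalent S" and "uniformly_branching S"
    and "quasiconformal_tree T" and "trivalent T" and "uniformly_branching T"
  shows "quasisymmetrically_equivalent S T"
proof -
  obtain m1 where m1: "\<forall>m\<ge>m1. modelled m S"
    using universal_tiling[OF assms(1-3)] by blast
  obtain m2 where m2: "\<forall>m\<ge>m2. modelled m T"
    using universal_tiling[OF assms(4-6)] by blast
  define m where "m = max m1 m2"
  obtain X A \<rho> where X: "tiling {w. word m w} X S A \<rho>"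
      "\<And>u w. \<lbrakk>word m u; word m w; length u = length w; u \<noteq> w\<rbrakk> \<Longrightarrow> X u \<inter> X w = {} \<longleftrightarrow> labs m u \<inter> labs m w = {}"
    using m1[rule_format, of m] by (auto simp: m_def modelled_def)
  obtain Y A' \<rho>' where Y: "tiling {w. word m w} Y T A' \<rho>'"
      "\<And>u w. \<lbrakk>word m u; word m w; length u = length w; u \<noteq> w\<rbrakk> \<Longrightarrow> Y u \<inter> Y w = {} \<longleftrightarrow> labs m u \<inter> labs m w = {}"
    using m2[rule_format, of m] by (auto simp: m_def modelled_def)
  have 1: "max \<rho> \<rho>' < 1" using tiling.\<rho>(2)[OF X(1)] tiling.\<rho>(2)[OF Y(1)] by simp
  interpret X: tiling "{w. word m w}" X S "max A A'" "max \<rho> \<rho>'"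
    by (rule tiling_weaken[OF X(1)]) (use 1 in auto)
  interpret Y: tiling "{w. word m w}" Y T "max A A'" "max \<rho> \<rho>'"
    by (rule tiling_weaken[OF Y(1)]) (use 1 in auto)
  interpret tiling_pair "{w. word m w}" X S Y T "max A A'" "max \<rho> \<rho>'"
  proof
    fix u w assume uw: "u \<in> {w. word m w}" "w \<in> {w. word m w}" "length u = length w"
    show "X u \<inter> X w = {} \<longleftrightarrow> Y u \<inter> Y w = {}"
    proof (cases "u = w")
      case True
      then show ?thesis using X.nonempty Y.nonempty uw by auto
    next
      case False
      then show ?thesis using X(2) Y(2) uw by auto
    qed
  qed
  show ?thesis unfolding quasisymmetrically_equivalent_def using corr_quasisymmetry by blast
qed

end
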